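(* Suppose Assumptions 1 and 2 hold (and, for Algorithm 1, also Assumption 3), let $\alpha>1$ be a constant with $\Phi(c_2)\le\alpha$, where $\Phi(x)=(1+x)/(1-x)$, and let $w_\star$ be the unique minimizer of $P$. Assume that $P$ is $\tau_o$-gradient dominant for some $\tau_o>0$, i.e. $P(w)-P(w_\star)\le\frac{\tau_o}{2}\|\mathcal{G}_\eta(w)\|^2$ for every $w\in\operatorname{dom}(P)$ and every $\eta>0$. Assume that during the iterations $\widetilde\eta\in\{\eta_1,\eta_2\}$, and that $b,\gamma$ are chosen so that $$\left(2+4\eta_2^2\right)\frac{n-b}{b(n-1)}L^2\gamma^2m-\Big(\frac{2}{\eta_2}-L\gamma-3\Big)\leq 0 .$$ Set $$\xi=\frac{(2+4\eta_2^2)\alpha\hat{\beta}^2}{(m+1)\eta_1^2(1-\hat{\beta})^2(1+\hat{\beta})},\qquad C=\left(\frac{1-\hat{\beta}}{\alpha}\tau+\frac{(1-\hat{\beta})^2(1+\hat{\beta})}{2\alpha\hat{\beta}^2}\right)\sigma^2,\qquad \xi'=\frac{\tau_o}{(m+1)\eta_1^2\gamma},$$ and assume $\xi'<1$. (i) For Algorithm 1, let $\delta'_k=\frac{\tau_o\xi}{2}\big(\mathbb{E}[\|\nabla f(\widetilde w_k)\|^2]+C\big)$ for $k=0,\dots,s-1$, $\delta'=\max_{0\le k\le s-1}\delta'_k$ and $\varepsilon=\frac{\delta'}{1-\xi'}>0$. Then $$\mathbb{E}\left[P(\widetilde{w}_s)-P(w_{\star})\right]\leq(\xi')^s\,\mathbb{E}\left[P(\widetilde{w}_0)-P(w_{\star})-\varepsilon\right]+\varepsilon,$$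 so that $\{\mathbb{E}[P(\widetilde w_s)-P(w_\star)]\}$ converges linearly with rate $\xi'$ to an $\varepsilon$-ball around zero. (ii) For Algorithm 2, let $\delta''_k=\frac{\tau_o\xi}{2}\,\mathbb{E}[\|\nabla f(\widetilde w_k)\|^2]$ for $k=0,\dots,s-1$, $\delta''=\max_{0\le k\le s-1}\delta''_k$ and $\epsilon=\frac{\delta''}{1-\xi'}>0$. Then $$\mathbb{E}\left[P(\widetilde{w}_s)-P(w_{\star})\right]\leq(\xi')^s\,\mathbb{E}\left[P(\widetilde{w}_0)-P(w_{\star})-\epsilon\right]+\epsilon,$$ so that $\{\mathbb{E}[P(\widetilde w_s)-P(w_\star)]\}$ converges linearly with rate $\xi'$ to an $\epsilon$-ball around zero.
   Context: Problem: minimize $P(w)=f(w)+\varphi(w)$ over $w\in\mathbb{R}^d$, where $f=\frac1n\sum_{i=1}^n f_i$ with smooth $f_i:\mathbb{R}^d\to\mathbb{R}$ (possibly nonconvex), and $\varphi:\mathbb{R}^d\to\mathbb{R}\cup\{+\infty\}$ is proper, closed and convex. $P$ is bounded from below and $\operatorname{dom}(f)\cap\operatorname{dom}(\varphi)\ne\emptyset$. $\operatorname{prox}_{\eta\varphi}(x)=\arg\min_u\{\varphi(u)+\frac1{2\eta}\|u-x\|^2\}$. Gradient mapping: $\mathcal{G}_\eta(w)=\frac1\eta\big(w-\operatorname{prox}_{\eta\varphi}(w-\eta\nabla f(w))\big)$. For $\mathcal{B}\subset\{1,\dots,n\}$ with $|\mathcal{B}|=b$: $f_{\mathcal{B}}=\frac1b\sum_{i\in\mathcal{B}}f_i$.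 Algorithm 1. Inputs: $\widetilde w_0\in\mathbb{R}^d$, epoch length $m$, batch size $b$, $\gamma\in(0,1]$, thresholds $\eta_2>0,\beta_o>0,\rho>0$, line-search constants $0<c_1<c_2<1$. Put $h^{(0)}=\nabla f(\widetilde w_0)$. For epochs $s=1,\dots,S$: set $w_0^{(s)}=\widetilde w_{s-1}$, $v_0^{(s)}=\nabla f(w_0^{(s)})$, $d_0^{(s)}=-h^{(s-1)}$. For $k=1,2,\dots$: pick $\mathcal{B}_k\subset\{1,\dots,n\}$ of size $b$ uniformly at random, and set $v_k^{(s)}=\nabla f_{\mathcal{B}_k}(w_k^{(s)})-\nabla f_{\mathcal{B}_k}(w_{k-1}^{(s)})+v_{k-1}^{(s)}$ and $d_k^{(s)}=-v_k^{(s)}+\beta_kd_{k-1}^{(s)}$. For $k\ge0$: a line search finds $\widetilde\eta$ with $f_{\mathcal{B}_k}(w_k^{(s)}+\widetilde\eta d_k^{(s)})\le f_{\mathcal{B}_k}(w_k^{(s)})+c_1\widetilde\eta\langle\nabla f_{\mathcal{B}_k}(w_k^{(s)}),d_k^{(s)}\rangle$ and $|\langle v_{k+1}^{(s)},d_k^{(s)}\rangle|\le-c_2\langle v_k^{(s)},d_k^{(s)}\rangle$; then $\eta=\min\{\widetilde\eta,\eta_2\}$, $y_k^{(s)}=\operatorname{prox}_{\eta\varphi}(w_k^{(s)}+\eta d_k^{(s)})$, $w_{k+1}^{(s)}=(1-\gamma)w_k^{(s)}+\gamma y_k^{(s)}$. The epoch ends with $\widetilde w_s=w_m^{(s)}$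 and $h^{(s)}=v_m^{(s)}$ (quantities with index $m$ or $m+1$ are given by the same recursions). Algorithm 2 (deterministic restart) is identical except that $d_0^{(s)}=-v_0^{(s)}=-\nabla f(w_0^{(s)})$ in every epoch $s\ge1$. Conjugate parameter: let $\beta_k^{FR}=\|v_k^{(s)}\|^2/\|v_{k-1}^{(s)}\|^2$ and $\beta_k^{PR}=\langle v_k^{(s)},v_k^{(s)}-v_{k-1}^{(s)}\rangle/\|v_{k-1}^{(s)}\|^2$. Then $\beta_k$ is either $\min\{\beta_o,\rho\beta_k^{FR}\}$ or $\beta_k^{PR}$ truncated to $[-\beta_k^{FR},\beta_k^{FR}]$; the analysis is for any $\beta_k$ with $|\beta_k|\le\beta_k^{FR}$. Assumption 1: there is $L>0$ with $\frac1n\sum_{i=1}^n\|\nabla f_i(w)-\nabla f_i(w')\|^2\le L^2\|w-w'\|^2$ for all $w,w'\in\operatorname{dom}(f)$. Assumption 2: there is $\hat\beta<1$ with $\|v_{k+1}^{(s)}\|^2/\|v_k^{(s)}\|^2\le\hat\beta$ for all $k,s\ge0$. Assumption 3 (needed only for Algorithm 1): there is $\sigma>0$ with $\mathbb{E}[\|v_k^{(s)}-\nabla f(w_k^{(s)})\|^2]\le\sigma^2$ for all $k,s\ge0$. Constants: $0<\eta_1\le\eta_2$; $\tau>0$ is a constant with $\mathbb{E}\big[\big|\|v_k^{(s)}\|^2-\|\nabla f(w_k^{(s)})\|^2\big|\big]\le\tau\sigma^2$ for all $s,k\ge0$. *)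

theory Defs
  imports "HOL-Probability.Probability"
begin

definition gradient :: "('a::real_inner \<Rightarrow> real) \<Rightarrow> 'a \<Rightarrow> 'a" where
  "gradient g x = (THE D. GDERIV g x :> D)"

definition batch_fun :: "(nat \<Rightarrow> 'a \<Rightarrow> real) \<Rightarrow> nat set \<Rightarrow> 'a \<Rightarrow> real" where
  "batch_fun f I w = (\<Sum>i\<in>I. f i w) / real (card I)"

abbreviation full_fun :: "nat \<Rightarrow> (nat \<Rightarrow> 'a \<Rightarrow> real) \<Rightarrow> 'a \<Rightarrow> real" where
  "full_fun n f \<equiv> batch_fun f {1..n}"

definition objective :: "nat \<Rightarrow> (nat \<Rightarrow> 'a \<Rightarrow> real) \<Rightarrow> ('a \<Rightarrow> ereal) \<Rightarrow> 'a \<Rightarrow> ereal" where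
  "objective n f \<phi> w = ereal (full_fun n f w) + \<phi> w"

definition epigraph_ereal :: "('a \<Rightarrow> ereal) \<Rightarrow> ('a \<times> real) set" where
  "epigraph_ereal \<phi> = {(x, r). \<phi> x \<le> ereal r}"

definition closed_proper_convex :: "('a::real_normed_vector \<Rightarrow> ereal) \<Rightarrow> bool" where
  "closed_proper_convex \<phi> \<longleftrightarrow>
     (\<forall>x. \<phi> x \<noteq> -\<infinity>) \<and> (\<exists>x. \<phi> x \<noteq> \<infinity>) \<and>
     closed (epigraph_ereal \<phi>) \<and> convex (epigraph_ereal \<phi>)"

definition prox :: "real \<Rightarrow> ('a::real_normed_vector \<Rightarrow> ereal) \<Rightarrow> 'a \<Rightarrow> 'a" where
  "prox \<eta> \<phi> x =
     arg_min (\<lambda>u. \<phi> u + ereal (1 / (2 * \<eta>) * (norm (u - x))\<^sup>2)) (\<lambda>_. True)"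

definition gradient_mapping ::
  "nat \<Rightarrow> (nat \<Rightarrow> 'a::real_inner \<Rightarrow> real) \<Rightarrow> ('a \<Rightarrow> ereal) \<Rightarrow> real \<Rightarrow> 'a \<Rightarrow> 'a" where
  "gradient_mapping n f \<phi> \<eta> w =
     (1 / \<eta>) *\<^sub>R (w - prox \<eta> \<phi> (w - \<eta> *\<^sub>R gradient (full_fun n f) w))"

definition gradient_dominant ::
  "real \<Rightarrow> nat \<Rightarrow> (nat \<Rightarrow> 'a::real_inner \<Rightarrow> real) \<Rightarrow> ('a \<Rightarrow> ereal) \<Rightarrow> 'a \<Rightarrow> bool" where
  "gradient_dominant \<tau>\<^sub>o n f \<phi> wstar \<longleftrightarrow>
     (\<forall>w \<eta>. objective n f \<phi> w \<noteq> \<infinity> \<longrightarrow> \<eta> > 0 \<longrightarrow>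
        objective n f \<phi> w - objective n f \<phi> wstar
          \<le> ereal (\<tau>\<^sub>o / 2 * (norm (gradient_mapping n f \<phi> \<eta> w))\<^sup>2))"

text \<open>Expectation of an extended-real random variable, as the difference of the expectations of
  its positive and negative parts (\<^const>\<open>e2ennreal\<close> sends negative arguments to 0).\<close>

definition ereal_expectation :: "'w measure \<Rightarrow> ('w \<Rightarrow> ereal) \<Rightarrow> ereal" where
  "ereal_expectation M X =
     enn2ereal (\<integral>\<^sup>+\<omega>. e2ennreal (X \<omega>) \<partial>M) - enn2ereal (\<integral>\<^sup>+\<omega>. e2ennreal (- X \<omega>) \<partial>M)"

text \<open>One realised epoch. The arguments \<open>B\<close>, \<open>\<beta>\<close>, \<open>t\<close>, \<open>w\<close>, \<open>v\<close>, \<open>d\<close> are the batches, the conjugate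
  parameters, the step sizes returned by the line search, the iterates, the gradient estimators and
  the directions, all indexed by the inner iteration. As \<open>v 0\<close> is the full gradient, the line search
  of inner iteration 0 is performed on the full function. The conjugate parameter is any number
  bounded in modulus by the Fletcher--Reeves value. The initial point \<open>w 0\<close> and
  direction \<open>d 0\<close> are not constrained here.\<close>

definition line_search ::
  "(nat \<Rightarrow> 'a::real_inner \<Rightarrow> real) \<Rightarrow> real \<Rightarrow> real \<Rightarrow> nat set \<Rightarrow> real \<Rightarrow> 'a \<Rightarrow> 'a \<Rightarrow> 'a \<Rightarrow> 'a \<Rightarrow> bool" where
  "line_search f c\<^sub>1 c\<^sub>2 I t w d v v_next \<longleftrightarrow>
     t > 0 \<and>
     batch_fun f I (w + t *\<^sub>R d) \<le> batch_fun f I w + c\<^sub>1 * t * (gradient (batch_fun f I) w \<bullet> d) \<and>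
     \<bar>v_next \<bullet> d\<bar> \<le> - c\<^sub>2 * (v \<bullet> d)"

definition cg_epoch ::
  "nat \<Rightarrow> (nat \<Rightarrow> 'a::real_inner \<Rightarrow> real) \<Rightarrow> ('a \<Rightarrow> ereal) \<Rightarrow> nat \<Rightarrow> real \<Rightarrow> real \<Rightarrow> real \<Rightarrow> real \<Rightarrow>
   (nat \<Rightarrow> nat set) \<Rightarrow> (nat \<Rightarrow> real) \<Rightarrow> (nat \<Rightarrow> real) \<Rightarrow> (nat \<Rightarrow> 'a) \<Rightarrow> (nat \<Rightarrow> 'a) \<Rightarrow> (nat \<Rightarrow> 'a) \<Rightarrow> bool" where
  "cg_epoch n f \<phi> m \<gamma> \<eta>\<^sub>2 c\<^sub>1 c\<^sub>2 B \<beta> t w v d \<longleftrightarrow>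
     B 0 = {1..n} \<and>
     v 0 = gradient (full_fun n f) (w 0) \<and>
     (\<forall>k\<in>{1..m+1}.
        v k = gradient (batch_fun f (B k)) (w k) - gradient (batch_fun f (B k)) (w (k-1)) + v (k-1) \<and>
        \<bar>\<beta> k\<bar> \<le> (norm (v k))\<^sup>2 / (norm (v (k-1)))\<^sup>2 \<and>
        d k = - v k + \<beta> k *\<^sub>R d (k-1)) \<and>
     (\<forall>k\<le>m.
        line_search f c\<^sub>1 c\<^sub>2 (B k) (t k) (w k) (d k) (v k) (v (k+1)) \<and>
        (let \<eta> = min (t k) \<eta>\<^sub>2; y = prox \<eta> \<phi> (w k + \<eta> *\<^sub>R d k)
         in w (k+1) = (1 - \<gamma>) *\<^sub>R w k + \<gamma> *\<^sub>R y))"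

text \<open>Below, processes are indexed by the epoch and then by the inner iteration. The
  \<open>\<sigma>\<close>-algebra \<open>F s k\<close> is the information available immediately before the batch \<open>B s k\<close> is picked.
  The iterate \<open>w s k\<close> is known at that time; the remaining quantities with index \<open>k\<close>, the step
  size in particular, are known before \<open>B s (k+1)\<close> is picked.\<close>

definition adapted_run ::
  "'w measure \<Rightarrow> (nat \<Rightarrow> nat \<Rightarrow> 'w measure) \<Rightarrow> nat \<Rightarrow> nat \<Rightarrow> nat \<Rightarrow>
   (nat \<Rightarrow> nat \<Rightarrow> 'w \<Rightarrow> nat set) \<Rightarrow> (nat \<Rightarrow> nat \<Rightarrow> 'w \<Rightarrow> real) \<Rightarrow> (nat \<Rightarrow> nat \<Rightarrow> 'w \<Rightarrow> real) \<Rightarrow>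
   (nat \<Rightarrow> nat \<Rightarrow> 'w \<Rightarrow> 'a::topological_space) \<Rightarrow> (nat \<Rightarrow> nat \<Rightarrow> 'w \<Rightarrow> 'a) \<Rightarrow> (nat \<Rightarrow> nat \<Rightarrow> 'w \<Rightarrow> 'a) \<Rightarrow> bool" where
  "adapted_run M F n m S B \<beta> t w v d \<longleftrightarrow>
     (\<forall>s\<in>{1..S}. \<forall>k\<le>m+2. subalgebra M (F s k)) \<and>
     (\<forall>s\<in>{1..S}. \<forall>k\<le>m+1. sets (F s k) \<subseteq> sets (F s (k+1))) \<and>
     (\<forall>s\<in>{1..<S}. sets (F s (m+2)) \<subseteq> sets (F (s+1) 0)) \<and>
     (\<forall>s\<in>{1..S}. \<forall>k\<le>m+1.
        w s k \<in> borel_measurable (F s k) \<and>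
        B s k \<in> measurable (F s (k+1)) (count_space (Pow {1..n})) \<and>
        v s k \<in> borel_measurable (F s (k+1)) \<and>
        d s k \<in> borel_measurable (F s (k+1)) \<and>
        \<beta> s k \<in> borel_measurable (F s (k+1)) \<and>
        t s k \<in> borel_measurable (F s (k+1)))"

text \<open>The batch is uniformly distributed and independent of the past.\<close>

definition uniform_batches ::
  "'w measure \<Rightarrow> (nat \<Rightarrow> nat \<Rightarrow> 'w measure) \<Rightarrow> nat \<Rightarrow> nat \<Rightarrow> nat \<Rightarrow> nat \<Rightarrow>
   (nat \<Rightarrow> nat \<Rightarrow> 'w \<Rightarrow> nat set) \<Rightarrow> bool" where
  "uniform_batches M F n m b S B \<longleftrightarrow>
     (\<forall>s\<in>{1..S}. \<forall>k\<in>{1..m+1}. \<forall>A\<in>sets (F s k). \<forall>I.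
        measure M ({\<omega>\<in>space M. B s k \<omega> = I} \<inter> A)
          = pmf (pmf_of_set {J. J \<subseteq> {1..n} \<and> card J = b}) I * measure M A)"

definition outer_iterate :: "'a \<Rightarrow> nat \<Rightarrow> (nat \<Rightarrow> nat \<Rightarrow> 'w \<Rightarrow> 'a) \<Rightarrow> nat \<Rightarrow> 'w \<Rightarrow> 'a" where
  "outer_iterate w\<^sub>0 m w s \<omega> = (if s = 0 then w\<^sub>0 else w s m \<omega>)"

definition cg_run where
  "cg_run d_init M F n f \<phi> m b \<gamma> \<eta>\<^sub>2 c\<^sub>1 c\<^sub>2 w\<^sub>0 S B \<beta> t w v d \<longleftrightarrow>
     prob_space M \<and>
     adapted_run M F n m S B \<beta> t w v d \<and>
     uniform_batches M F n m b S B \<and>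
     (AE \<omega> in M. \<forall>s\<in>{1..S}.
        w s 0 \<omega> = outer_iterate w\<^sub>0 m w (s-1) \<omega> \<and>
        d s 0 \<omega> = d_init s \<omega> \<and>
        cg_epoch n f \<phi> m \<gamma> \<eta>\<^sub>2 c\<^sub>1 c\<^sub>2 (\<lambda>k. B s k \<omega>) (\<lambda>k. \<beta> s k \<omega>) (\<lambda>k. t s k \<omega>)
          (\<lambda>k. w s k \<omega>) (\<lambda>k. v s k \<omega>) (\<lambda>k. d s k \<omega>))"

definition algorithm1 where
  "algorithm1 M F n f \<phi> m b \<gamma> \<eta>\<^sub>2 c\<^sub>1 c\<^sub>2 w\<^sub>0 S B \<beta> t w v d \<longleftrightarrow>
     cg_run (\<lambda>s \<omega>. - (if s = 1 then gradient (full_fun n f) w\<^sub>0 else v (s-1) m \<omega>))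
       M F n f \<phi> m b \<gamma> \<eta>\<^sub>2 c\<^sub>1 c\<^sub>2 w\<^sub>0 S B \<beta> t w v d"

definition algorithm2 where
  "algorithm2 M F n f \<phi> m b \<gamma> \<eta>\<^sub>2 c\<^sub>1 c\<^sub>2 w\<^sub>0 S B \<beta> t w v d \<longleftrightarrow>
     cg_run (\<lambda>s \<omega>. - gradient (full_fun n f) (w s 0 \<omega>))
       M F n f \<phi> m b \<gamma> \<eta>\<^sub>2 c\<^sub>1 c\<^sub>2 w\<^sub>0 S B \<beta> t w v d"

text \<open>The distance of \<open>a s\<close> to the ball of radius \<open>\<epsilon>\<close> around zero is at most \<open>r ^ s\<close> times that
  of \<open>a 0\<close>, up to the horizon \<open>N\<close>. The horizon is needed because the radius used below
  is a maximum over the epochs performed.\<close>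

definition linear_to_ball :: "(nat \<Rightarrow> ereal) \<Rightarrow> real \<Rightarrow> real \<Rightarrow> nat \<Rightarrow> bool" where
  "linear_to_ball a r \<epsilon> N \<longleftrightarrow>
     (\<forall>s\<le>N. max 0 (\<bar>a s\<bar> - ereal \<epsilon>) \<le> ereal (r ^ s) * max 0 (\<bar>a 0\<bar> - ereal \<epsilon>))"

end

theory Submission
  imports Defs
begin

text \<open>Everything happens inside one epoch. If \<open>D k\<close> is the expected optimality gap of the \<open>k\<close>-th iterate,
\<open>x = \<gamma> \<eta>\<^sub>1\<^sup>2 / \<tau>\<^sub>o\<close>, and \<open>m\<close> is the epoch length, then \<open>\<xi>' = 1 / ((m + 1) x)\<close>, and the goal is
\<open>D m \<le> \<xi>' (D 0 + error)\<close>, where the error collects the mismatch between the search direction and the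
negative gradient. Iterating this over the epochs gives linear convergence to a ball.

A proximal gradient step with an inexact direction decreases the objective by a multiple of the squared
gradient mapping, which gradient dominance turns into the contraction \<open>1 - x\<close>, and by a multiple \<open>r k\<close>
of the squared step length; it increases it by a multiple of the squared direction error. After
the first step of an epoch, that error has two sources: the variance of the recursive gradient estimator, which is at most the sampling
variance accumulated over the previous steps, hence a multiple of \<open>T k = r 0 + \<dots> + r (k-1)\<close>, and the
conjugate term \<open>\<beta>\<^sub>k d\<^sub>k\<^sub>-\<^sub>1\<close>.

Summing these inequalities bounds the average gap of the epoch. The epoch returns its last iterate,
whose gap may exceed the average, so a sharper argument is needed. It rests on two gains.
The first is in the step inequality (\<open>prox_step_mixed\<close>): mixing two comparisons of the step, one with
the current point and one with the exact step, halves the coefficient of the direction error and leaves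
the same multiple of the squared step length.
The second is the recursion lemma (\<open>recursion_with_memory_last_bound\<close>) for
\<open>D (k+1) \<le> (1 - x) D k + h k + T k / (2 m) - r k\<close>: as \<open>D\<close> stays nonnegative, a large early
step can be paid for only once, and \<open>D m \<le> \<xi>' D 0\<close> up to noise. Noise entering late may be
weighted by more than \<open>\<xi>'\<close>, but unless all gaps vanish, gradient dominance, smoothness and the bound on the
step sizes force \<open>x \<le> 1/3\<close> (\<open>gap_zero_or_condition_number\<close>, \<open>rate_le_third\<close>), and the noise decays geometrically, so the
excess is controlled by the supremum of \<open>(k - 1) h k\<close> (\<open>weighted_sum_le\<close>).

The conjugate term is bounded pathwise by the curvature condition of the line search and the geometric
decay of the estimators (\<open>conjugate_direction_error_le\<close>). Without a restart the initial
direction of an epoch is not the negative gradient, so its slope can be large compared with the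
gradient; a splitting parameter distributes this slope over the squared gradient and the
difference of the squared norms, and \<open>direction_error_budget\<close> shows that some choice of the parameter
keeps both parts within the constants claimed. \<open>epoch_contraction\<close> combines everything for one epoch,
for any initial direction; the two algorithms differ only in how large the initial mismatch is.

All processes of an epoch are almost surely bounded, because the estimators decrease and the proximal
operator is nonexpansive; this gives every integrability needed. If the initial point lies outside the
domain of \<open>\<phi>\<close>, the initial expected gap is infinite and the bounds are trivial.\<close>

section \<open>Gradients of averages\<close>

lemma norm_add_scaleR_squared:
  fixes a b :: "'a::real_inner"
  shows "(norm (a + t *\<^sub>R b))\<^sup>2 = (norm a)\<^sup>2 + 2 * t * (a \<bullet> b) + t\<^sup>2 * (norm b)\<^sup>2"
  unfolding power2_norm_eq_inner inner_add_left inner_add_right inner_scaleR_left inner_scaleR_right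
  by (simp add: inner_commute power2_eq_square algebra_simps)

lemma gradient_eq:
  assumes "GDERIV g x :> D"
  shows "gradient g x = D"
  unfolding gradient_def
proof (rule the_equality)
  show "GDERIV g x :> D" by fact
next
  fix E assume "GDERIV g x :> E"
  hence "(\<lambda>h. h \<bullet> E) = (\<lambda>h. h \<bullet> D)"
    using assms unfolding gderiv_def by (rule has_derivative_unique)
  hence "(E - D) \<bullet> E = (E - D) \<bullet> D" by (rule fun_cong)
  hence "(E - D) \<bullet> (E - D) = 0" by (simp add: inner_diff_right)
  thus "E = D" by simp
qed

lemma GDERIV_gradient:
  fixes g :: "'a::euclidean_space \<Rightarrow> real"
  assumes "g differentiable (at x)"
  shows "GDERIV g x :> gradient g x"
proof -
  obtain D where D: "(g has_derivative D) (at x)" using assms by (auto simp: differentiable_def)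
  have "linear D" using has_derivative_linear[OF D] .
  hence "D = (\<lambda>h. h \<bullet> adjoint D 1)" using adjoint_works[of D _ 1] by auto
  hence "GDERIV g x :> adjoint D 1" using D unfolding gderiv_def by simp
  thus ?thesis using gradient_eq by metis
qed

lemma GDERIV_batch_fun:
  assumes "\<And>i. i \<in> I \<Longrightarrow> GDERIV (f i) x :> D i"
  shows "GDERIV (batch_fun f I) x :> (1 / real (card I)) *\<^sub>R (\<Sum>i\<in>I. D i)"
proof -
  have "((\<lambda>w. (1 / real (card I)) *\<^sub>R (\<Sum>i\<in>I. f i w)) has_derivative
      (\<lambda>h. (1 / real (card I)) *\<^sub>R (\<Sum>i\<in>I. h \<bullet> D i))) (at x)"
    using assms unfolding gderiv_def by (intro has_derivative_scaleR_right has_derivative_sum)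
  moreover have "(\<lambda>w. (1 / real (card I)) *\<^sub>R (\<Sum>i\<in>I. f i w)) = batch_fun f I"
    by (auto simp: batch_fun_def)
  ultimately show ?thesis unfolding gderiv_def by (simp add: inner_sum_right)
qed

lemma gradient_batch_fun:
  fixes f :: "nat \<Rightarrow> 'a::euclidean_space \<Rightarrow> real"
  assumes "\<And>i. i \<in> I \<Longrightarrow> f i differentiable (at x)"
  shows "gradient (batch_fun f I) x = (1 / real (card I)) *\<^sub>R (\<Sum>i\<in>I. gradient (f i) x)"
  by (rule gradient_eq, rule GDERIV_batch_fun) (use assms GDERIV_gradient in blast)

lemma norm_average_squared_le:
  fixes a :: "'i \<Rightarrow> 'a::real_normed_vector"
  shows "(norm ((1 / real (card I)) *\<^sub>R (\<Sum>i\<in>I. a i)))\<^sup>2 \<le> (\<Sum>i\<in>I. (norm (a i))\<^sup>2) / real (card I)"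
proof (cases "card I = 0")
  case False
  have "(norm (\<Sum>i\<in>I. a i))\<^sup>2 \<le> (\<Sum>i\<in>I. norm (a i))\<^sup>2"
    by (intro power_mono norm_sum) auto
  also have "\<dots> \<le> (\<Sum>i\<in>I. (norm (a i))\<^sup>2) * real (card I)" by (rule sum_squared_le_sum_of_squares)
  finally show ?thesis using False by (simp add: power_divide power2_eq_square divide_simps)
qed auto

text \<open>On the segment from \<open>x\<close> to \<open>y\<close>, the function minus its quadratic model has a nonpositive derivative.\<close>

lemma descent_lemma:
  fixes g :: "'a::euclidean_space \<Rightarrow> real"
  assumes diff: "\<And>x. GDERIV g x :> G x"
    and lip: "\<And>x y. norm (G x - G y) \<le> L * norm (x - y)"
  shows "g y \<le> g x + G x \<bullet> (y - x) + L / 2 * (norm (y - x))\<^sup>2"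
proof -
  define u where "u = y - x"
  define h where "h t = g (x + t *\<^sub>R u) - t * (G x \<bullet> u) - L / 2 * t\<^sup>2 * (norm u)\<^sup>2" for t
  have dh: "(h has_real_derivative ((G (x + t *\<^sub>R u) - G x) \<bullet> u - L * t * (norm u)\<^sup>2)) (at t)" for t
  proof -
    have "((\<lambda>t. x + t *\<^sub>R u) has_derivative (\<lambda>r. r *\<^sub>R u)) (at t)"
      by (auto intro!: derivative_eq_intros)
    moreover have "(g has_derivative (\<lambda>r. r \<bullet> G (x + t *\<^sub>R u))) (at (x + t *\<^sub>R u))"
      using diff unfolding gderiv_def .
    ultimately have "((\<lambda>t. g (x + t *\<^sub>R u)) has_derivative (\<lambda>r. (r *\<^sub>R u) \<bullet> G (x + t *\<^sub>R u))) (at t)"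
      by (rule has_derivative_compose)
    hence "((\<lambda>t. g (x + t *\<^sub>R u)) has_real_derivative (u \<bullet> G (x + t *\<^sub>R u))) (at t)"
      by (simp add: has_field_derivative_def mult_commute_abs)
    thus ?thesis unfolding h_def
      by (auto intro!: derivative_eq_intros simp: inner_commute inner_diff_right algebra_simps)
  qed
  have "h 1 \<le> h 0"
  proof (rule DERIV_nonpos_imp_nonincreasing[of 0 1])
    fix t :: real assume t: "0 \<le> t" "t \<le> 1"
    have "(G (x + t *\<^sub>R u) - G x) \<bullet> u \<le> norm (G (x + t *\<^sub>R u) - G x) * norm u"
      by (rule norm_cauchy_schwarz)
    also have "\<dots> \<le> (L * norm (t *\<^sub>R u)) * norm u"
      using lip[of "x + t *\<^sub>R u" x] by (intro mult_right_mono) auto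
    also have "\<dots> = L * t * (norm u)\<^sup>2" using t by (simp add: power2_eq_square)
    finally show "\<exists>y. (h has_real_derivative y) (at t) \<and> y \<le> 0"
      using dh[of t] by (intro exI[of _ "(G (x + t *\<^sub>R u) - G x) \<bullet> u - L * t * (norm u)\<^sup>2"]) auto
  qed auto
  thus ?thesis by (simp add: h_def u_def inner_commute)
qed

section \<open>The proximal operator\<close>

lemma closed_proper_convex_finite:
  assumes "closed_proper_convex \<phi>" "\<phi> x \<noteq> \<infinity>"
  shows "\<phi> x = ereal (real_of_ereal (\<phi> x))"
  using assms by (cases "\<phi> x") (auto simp: closed_proper_convex_def)

lemma closed_proper_convex_combination:
  assumes \<phi>: "closed_proper_convex \<phi>" and fin: "\<phi> x \<noteq> \<infinity>" "\<phi> y \<noteq> \<infinity>" and t: "0 \<le> t" "t \<le> 1"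
  defines "z \<equiv> (1 - t) *\<^sub>R x + t *\<^sub>R y"
  shows "\<phi> z \<noteq> \<infinity>"
    and "real_of_ereal (\<phi> z) \<le> (1 - t) * real_of_ereal (\<phi> x) + t * real_of_ereal (\<phi> y)"
proof -
  have "(x, real_of_ereal (\<phi> x)) \<in> epigraph_ereal \<phi>" "(y, real_of_ereal (\<phi> y)) \<in> epigraph_ereal \<phi>"
    using closed_proper_convex_finite[OF \<phi>] fin by (auto simp: epigraph_ereal_def)
  hence "(1 - t) *\<^sub>R (x, real_of_ereal (\<phi> x)) + t *\<^sub>R (y, real_of_ereal (\<phi> y)) \<in> epigraph_ereal \<phi>"
    using \<phi> t unfolding closed_proper_convex_def by (intro convexD) auto
  hence le: "\<phi> z \<le> ereal ((1 - t) * real_of_ereal (\<phi> x) + t * real_of_ereal (\<phi> y))"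
    by (simp add: epigraph_ereal_def z_def)
  thus fin: "\<phi> z \<noteq> \<infinity>" by auto
  show "real_of_ereal (\<phi> z) \<le> (1 - t) * real_of_ereal (\<phi> x) + t * real_of_ereal (\<phi> y)"
    using le closed_proper_convex_finite[OF \<phi> fin] by (metis ereal_less_eq(3))
qed

text \<open>Strict separation of the epigraph from a point one unit below it. The separating hyperplane is not
vertical, because the point above lies on the other side. An affine minorant is what makes
the objective of the proximal operator coercive for every step size.\<close>

lemma closed_proper_convex_affine_minorant:
  fixes \<phi> :: "'a::euclidean_space \<Rightarrow> ereal"
  assumes \<phi>: "closed_proper_convex \<phi>"
  obtains a b where "\<And>u r. \<phi> u \<le> ereal r \<Longrightarrow> a \<bullet> u + b \<le> r"
proof -
  obtain x where x: "\<phi> x \<noteq> \<infinity>" using \<phi> by (auto simp: closed_proper_convex_def)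
  define r0 where "r0 = real_of_ereal (\<phi> x)"
  have r0: "\<phi> x = ereal r0" using closed_proper_convex_finite[OF \<phi> x] by (simp add: r0_def)
  have "(x, r0 - 1) \<notin> epigraph_ereal \<phi>" by (simp add: epigraph_ereal_def r0)
  then obtain p c where pc: "p \<bullet> (x, r0 - 1) < c" "\<forall>z\<in>epigraph_ereal \<phi>. p \<bullet> z > c"
    using separating_hyperplane_closed_point[of "epigraph_ereal \<phi>" "(x, r0 - 1)"] \<phi>
    by (auto simp: closed_proper_convex_def)
  obtain a t where p: "p = (a, t)" by (cases p)
  have "a \<bullet> x + t * r0 > c" using pc(2) r0 by (auto simp: epigraph_ereal_def p inner_prod_def)
  hence t: "t > 0" using pc(1) by (simp add: p inner_prod_def algebra_simps)
  show ?thesis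
  proof (rule that[of "(-1/t) *\<^sub>R a" "c / t"])
    fix u r assume "\<phi> u \<le> ereal r"
    hence "a \<bullet> u + t * r > c" using pc(2) by (auto simp: epigraph_ereal_def p inner_prod_def)
    thus "(-1/t) *\<^sub>R a \<bullet> u + c / t \<le> r" using t by (simp add: field_simps)
  qed
qed

text \<open>Minimising over points of the epigraph replaces the merely lower semicontinuous \<open>\<phi>\<close> by a continuous
objective; its sublevel sets in the closed epigraph are bounded by the affine minorant, hence compact.\<close>

lemma prox_is_arg_min:
  fixes \<phi> :: "'a::euclidean_space \<Rightarrow> ereal"
  assumes \<phi>: "closed_proper_convex \<phi>" and \<eta>: "0 < \<eta>"
  shows "is_arg_min (\<lambda>u. \<phi> u + ereal (1 / (2 * \<eta>) * (norm (u - x))\<^sup>2)) (\<lambda>_. True) (prox \<eta> \<phi> x)"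
proof -
  define E where "E = epigraph_ereal \<phi>"
  define g where "g = (\<lambda>(u::'a, r::real). r + 1 / (2 * \<eta>) * (norm (u - x))\<^sup>2)"
  obtain x0 where x0: "\<phi> x0 \<noteq> \<infinity>" using \<phi> by (auto simp: closed_proper_convex_def)
  define z0 where "z0 = (x0, real_of_ereal (\<phi> x0))"
  have z0: "z0 \<in> E" using closed_proper_convex_finite[OF \<phi> x0] by (simp add: E_def z0_def epigraph_ereal_def)
  obtain a b where ab: "\<And>u r. \<phi> u \<le> ereal r \<Longrightarrow> a \<bullet> u + b \<le> r"
    using closed_proper_convex_affine_minorant[OF \<phi>] by blast
  define K where "K = E \<inter> {z. g z \<le> g z0}"
  have cont: "continuous_on S g" for S
    unfolding g_def case_prod_unfold using \<eta> by (intro continuous_intros) auto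
  have closed: "closed K"
    unfolding K_def using \<phi> cont[of UNIV]
    by (intro closed_Int closed_Collect_le continuous_on_const)
       (auto simp: E_def closed_proper_convex_def)
  have bounded: "bounded K"
  proof -
    define c0 where "c0 = g z0 - a \<bullet> x - b"
    define R where "R = 2 * \<eta> * (\<bar>c0\<bar> + norm a) + 1"
    have R1: "1 \<le> R" using \<eta> by (simp add: R_def)
    have n: "norm (u - x) \<le> R" if "(u, r) \<in> K" for u r
    proof (rule ccontr)
      assume "\<not> norm (u - x) \<le> R"
      hence Rn: "R < norm (u - x)" by simp
      define \<nu> where "\<nu> = norm (u - x)"
      have n1: "1 < \<nu>" using Rn R1 by (simp add: \<nu>_def)
      have "a \<bullet> u + b \<le> r" using that ab by (simp add: K_def E_def epigraph_ereal_def)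
      moreover have "r + 1 / (2 * \<eta>) * \<nu>\<^sup>2 \<le> g z0" using that by (simp add: K_def g_def \<nu>_def)
      moreover have "- (norm a * \<nu>) \<le> a \<bullet> (u - x)"
        using Cauchy_Schwarz_ineq2[of a "u - x"] unfolding \<nu>_def by linarith
      moreover have "a \<bullet> (u - x) = a \<bullet> u - a \<bullet> x" by (rule inner_diff_right)
      ultimately have "1 / (2 * \<eta>) * \<nu>\<^sup>2 \<le> c0 + norm a * \<nu>"
        unfolding c0_def by linarith
      also have "c0 \<le> \<bar>c0\<bar> * \<nu>"
        using mult_left_mono[of 1 \<nu> "\<bar>c0\<bar>"] n1 by linarith
      finally have "1 / (2 * \<eta>) * \<nu>\<^sup>2 \<le> (\<bar>c0\<bar> + norm a) * \<nu>" by (simp add: distrib_right)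
      hence "2 * \<eta> * (1 / (2 * \<eta>) * \<nu>\<^sup>2) \<le> 2 * \<eta> * ((\<bar>c0\<bar> + norm a) * \<nu>)"
        using \<eta> by (intro mult_left_mono) auto
      hence "\<nu> * \<nu> \<le> (2 * \<eta> * (\<bar>c0\<bar> + norm a)) * \<nu>" using \<eta> by (simp add: power2_eq_square)
      hence "\<nu> \<le> 2 * \<eta> * (\<bar>c0\<bar> + norm a)" using n1 mult_le_cancel_right_pos[of \<nu>] by simp
      thus False using Rn by (simp add: R_def \<nu>_def)
    qed
    have "K \<subseteq> cball x R \<times> {- (norm a * R) + a \<bullet> x + b .. g z0}"
    proof (clarify, safe)
      fix u r assume ur: "(u, r) \<in> K"
      show "u \<in> cball x R" using n[OF ur] by (simp add: dist_norm norm_minus_commute)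
      have "r \<le> g z0 - 1 / (2 * \<eta>) * (norm (u - x))\<^sup>2" using ur by (simp add: K_def g_def)
      moreover have "0 \<le> 1 / (2 * \<eta>) * (norm (u - x))\<^sup>2" using \<eta> by simp
      ultimately have 1: "r \<le> g z0" by linarith
      have "- (norm a * R) \<le> - (norm a * norm (u - x))" using n[OF ur] by (simp add: mult_left_mono)
      also have "\<dots> \<le> a \<bullet> (u - x)" using Cauchy_Schwarz_ineq2[of a "u - x"] by linarith
      finally have "- (norm a * R) + a \<bullet> x + b \<le> a \<bullet> u + b" by (simp add: inner_diff_right)
      also have "\<dots> \<le> r" using ur ab by (simp add: K_def E_def epigraph_ereal_def)
      finally show "r \<in> {- (norm a * R) + a \<bullet> x + b .. g z0}" using 1 by simp
    qed
    thus ?thesis by (rule bounded_subset[rotated]) (intro bounded_Times, auto)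
  qed
  have "compact K" using closed bounded by (simp add: compact_eq_bounded_closed)
  moreover have "z0 \<in> K" using z0 by (simp add: K_def)
  ultimately obtain z where z: "z \<in> K" "\<forall>y\<in>K. g z \<le> g y"
    using continuous_attains_inf[of K g] cont by blast
  obtain y r where yr: "z = (y, r)" by (cases z)
  have yE: "\<phi> y \<le> ereal r" using z(1) by (simp add: K_def E_def yr epigraph_ereal_def)
  have min: "g z \<le> g w" if "w \<in> E" for w
  proof (cases "w \<in> K")
    case False
    hence "g z0 \<le> g w" using that by (simp add: K_def)
    moreover have "g z \<le> g z0" using z(1) by (simp add: K_def)
    ultimately show ?thesis by linarith
  qed (use z in auto)
  let ?F = "\<lambda>u. \<phi> u + ereal (1 / (2 * \<eta>) * (norm (u - x))\<^sup>2)"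
  have "is_arg_min ?F (\<lambda>_. True) y"
    unfolding is_arg_min_linorder
  proof (intro conjI allI impI TrueI)
    fix u
    show "\<phi> y + ereal (1 / (2 * \<eta>) * (norm (y - x))\<^sup>2) \<le> \<phi> u + ereal (1 / (2 * \<eta>) * (norm (u - x))\<^sup>2)"
    proof (cases "\<phi> u = \<infinity>")
      case False
      note fu = closed_proper_convex_finite[OF \<phi> False]
      hence "(u, real_of_ereal (\<phi> u)) \<in> E" by (simp add: E_def epigraph_ereal_def)
      from min[OF this] have "r + 1 / (2 * \<eta>) * (norm (y - x))\<^sup>2
          \<le> real_of_ereal (\<phi> u) + 1 / (2 * \<eta>) * (norm (u - x))\<^sup>2"
        by (simp add: g_def yr)
      have "\<phi> y + ereal (1 / (2 * \<eta>) * (norm (y - x))\<^sup>2) \<le> ereal r + ereal (1 / (2 * \<eta>) * (norm (y - x))\<^sup>2)"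
        using yE by (rule add_right_mono)
      also have "\<dots> \<le> ereal (real_of_ereal (\<phi> u)) + ereal (1 / (2 * \<eta>) * (norm (u - x))\<^sup>2)"
        using \<open>r + _ \<le> _\<close> by simp
      finally show ?thesis using fu by simp
    qed auto
  qed
  thus ?thesis unfolding prox_def arg_min_def by (rule someI[of "is_arg_min ?F (\<lambda>_. True)" y])
qed

text \<open>Comparing the minimiser with the point at parameter \<open>t\<close> on the segment towards \<open>u\<close> and dividing by
\<open>t\<close> leaves an error of order \<open>t\<close>.\<close>

lemma prox_variational_inequality:
  fixes \<phi> :: "'a::euclidean_space \<Rightarrow> ereal" and x u y :: 'a
  assumes \<phi>: "closed_proper_convex \<phi>" and \<eta>: "0 < \<eta>"
  defines "y \<equiv> prox \<eta> \<phi> x"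
  shows prox_in_domain: "\<phi> y \<noteq> \<infinity>"
    and "\<phi> u \<noteq> \<infinity> \<Longrightarrow> real_of_ereal (\<phi> y) + (1 / \<eta>) * ((x - y) \<bullet> (u - y)) \<le> real_of_ereal (\<phi> u)"
proof -
  have min: "\<phi> y + ereal (1 / (2 * \<eta>) * (norm (y - x))\<^sup>2) \<le> \<phi> u + ereal (1 / (2 * \<eta>) * (norm (u - x))\<^sup>2)" for u
    using prox_is_arg_min[OF \<phi> \<eta>, of x] unfolding is_arg_min_linorder y_def by blast
  obtain x0 where x0: "\<phi> x0 \<noteq> \<infinity>" using \<phi> by (auto simp: closed_proper_convex_def)
  show fy: "\<phi> y \<noteq> \<infinity>"
  proof
    assume "\<phi> y = \<infinity>"
    hence "\<phi> x0 = \<infinity>" using min[of x0] by (cases "\<phi> x0") auto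
    thus False using x0 by simp
  qed
  assume fu: "\<phi> u \<noteq> \<infinity>"
  let ?r = "\<lambda>z. real_of_ereal (\<phi> z)"
  have minr: "?r y + 1 / (2 * \<eta>) * (norm (y - x))\<^sup>2 \<le> ?r z + 1 / (2 * \<eta>) * (norm (z - x))\<^sup>2" if "\<phi> z \<noteq> \<infinity>" for z
    using min[of z] closed_proper_convex_finite[OF \<phi> fy] closed_proper_convex_finite[OF \<phi> that]
    by (metis ereal_less_eq(3) plus_ereal.simps(1))
  have key: "?r y + (1 / \<eta>) * ((x - y) \<bullet> (u - y)) \<le> ?r u + t * (1 / (2 * \<eta>) * (norm (u - y))\<^sup>2)"
    if t: "0 < t" "t \<le> 1" for t
  proof -
    define z where "z = (1 - t) *\<^sub>R y + t *\<^sub>R u"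
    have zc: "\<phi> z \<noteq> \<infinity>" "?r z \<le> (1 - t) * ?r y + t * ?r u"
      using closed_proper_convex_combination[OF \<phi> fy fu, of t] t by (auto simp: z_def)
    have zx: "z - x = (y - x) + t *\<^sub>R (u - y)" by (simp add: z_def algebra_simps)
    have "(y - x) \<bullet> (u - y) = - ((x - y) \<bullet> (u - y))" by (simp add: inner_diff_left)
    hence "(norm (z - x))\<^sup>2 = (norm (y - x))\<^sup>2 - 2 * t * ((x - y) \<bullet> (u - y)) + t\<^sup>2 * (norm (u - y))\<^sup>2"
      unfolding zx norm_add_scaleR_squared by simp
    hence "?r y + 1 / (2 * \<eta>) * (norm (y - x))\<^sup>2 \<le> (1 - t) * ?r y + t * ?r u + 1 / (2 * \<eta>) *
        ((norm (y - x))\<^sup>2 - 2 * t * ((x - y) \<bullet> (u - y)) + t\<^sup>2 * (norm (u - y))\<^sup>2)"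
      using minr[OF zc(1)] zc(2) by simp
    moreover have "1 / (2 * \<eta>) *
        ((norm (y - x))\<^sup>2 - 2 * t * ((x - y) \<bullet> (u - y)) + t\<^sup>2 * (norm (u - y))\<^sup>2)
        = 1 / (2 * \<eta>) * (norm (y - x))\<^sup>2 - t * ((1 / \<eta>) * ((x - y) \<bullet> (u - y)))
          + t * (t * (1 / (2 * \<eta>) * (norm (u - y))\<^sup>2))"
      using \<eta> by (simp add: distrib_left right_diff_distrib power2_eq_square)
    ultimately have "t * (?r y + (1 / \<eta>) * ((x - y) \<bullet> (u - y))) \<le> t * (?r u + t * (1 / (2 * \<eta>) * (norm (u - y))\<^sup>2))"
      unfolding distrib_left left_diff_distrib by linarith
    thus ?thesis using t by simp
  qed
  show "?r y + (1 / \<eta>) * ((x - y) \<bullet> (u - y)) \<le> ?r u"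
  proof (rule field_le_epsilon)
    fix e :: real assume e: "0 < e"
    define q where "q = 1 / (2 * \<eta>) * (norm (u - y))\<^sup>2"
    have q: "0 \<le> q" using \<eta> by (simp add: q_def)
    define t where "t = min 1 (e / (q + 1))"
    have "t * q \<le> e / (q + 1) * q" using q by (intro mult_right_mono) (auto simp: t_def)
    also have "\<dots> \<le> e" using e q by (simp add: pos_divide_le_eq)
    finally show "?r y + (1 / \<eta>) * ((x - y) \<bullet> (u - y)) \<le> ?r u + e"
      using key[of t] e q by (simp add: t_def q_def)
  qed
qed

lemma prox_nonexpansive:
  fixes \<phi> :: "'a::euclidean_space \<Rightarrow> ereal"
  assumes \<phi>: "closed_proper_convex \<phi>" and \<eta>: "0 < \<eta>"
  shows "norm (prox \<eta> \<phi> x - prox \<eta> \<phi> x') \<le> norm (x - x')"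
proof -
  let ?y = "prox \<eta> \<phi> x" and ?y' = "prox \<eta> \<phi> x'"
  note v = prox_variational_inequality[OF \<phi> \<eta>]
  have "(1 / \<eta>) * ((x - ?y) \<bullet> (?y' - ?y) + (x' - ?y') \<bullet> (?y - ?y')) \<le> 0"
    using v(2)[OF v(1)[of x'], of x] v(2)[OF v(1)[of x], of x'] by (simp add: distrib_left)
  hence "(x - ?y) \<bullet> (?y' - ?y) + (x' - ?y') \<bullet> (?y - ?y') \<le> 0" using \<eta> by (simp add: divide_le_eq)
  hence "(norm (?y - ?y'))\<^sup>2 \<le> (x - x') \<bullet> (?y - ?y')"
    by (simp add: power2_norm_eq_inner inner_simps inner_commute algebra_simps)
  also have "\<dots> \<le> norm (x - x') * norm (?y - ?y')" by (rule norm_cauchy_schwarz)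
  finally have le: "norm (?y - ?y') * norm (?y - ?y') \<le> norm (x - x') * norm (?y - ?y')"
    by (simp add: power2_eq_square)
  show ?thesis
  proof (cases "norm (?y - ?y') = 0")
    case False
    hence "0 < norm (?y - ?y')" by simp
    with le show ?thesis by (simp only: mult_le_cancel_right_pos)
  qed simp
qed

lemma borel_measurable_closed_proper_convex:
  fixes \<phi> :: "'a::euclidean_space \<Rightarrow> ereal"
  assumes \<phi>: "closed_proper_convex \<phi>"
  shows "\<phi> \<in> borel_measurable borel"
  unfolding borel_measurable_iff_Iic_ereal
proof
  fix a :: ereal
  show "\<phi> -` {..a} \<inter> space borel \<in> sets borel"
  proof (cases a)
    case (real r)
    have "closed ((\<lambda>u. (u, r)) -` epigraph_ereal \<phi>)"
      using \<phi> by (intro closed_vimage continuous_intros) (auto simp: closed_proper_convex_def)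
    moreover have "(\<lambda>u. (u, r)) -` epigraph_ereal \<phi> = \<phi> -` {..a}" by (auto simp: epigraph_ereal_def real)
    ultimately show ?thesis by simp
  next
    case MInf
    hence "\<phi> -` {..a} = {}" using \<phi> by (auto simp: closed_proper_convex_def)
    thus ?thesis by simp
  next
    case PInf
    hence "\<phi> -` {..a} = UNIV" by auto
    thus ?thesis by simp
  qed
qed

section \<open>One inexact proximal gradient step\<close>

locale composite_problem =
  fixes f :: "nat \<Rightarrow> 'a::euclidean_space \<Rightarrow> real" and \<phi> :: "'a \<Rightarrow> ereal" and n :: nat and L :: real
  assumes n: "1 \<le> n"
    and smooth: "\<And>i x. i \<in> {1..n} \<Longrightarrow> f i differentiable (at x)"
    and \<phi>: "closed_proper_convex \<phi>"
    and L: "0 < L"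
    and mean_lipschitz: "\<And>x y. (\<Sum>i\<in>{1..n}. (norm (gradient (f i) x - gradient (f i) y))\<^sup>2) / real n
                     \<le> L\<^sup>2 * (norm (x - y))\<^sup>2"
begin

abbreviation grad :: "'a \<Rightarrow> 'a" where "grad \<equiv> gradient (full_fun n f)"

definition cost :: "'a \<Rightarrow> real" where
  "cost x = full_fun n f x + real_of_ereal (\<phi> x)"

lemma objective_eq: "\<phi> x \<noteq> \<infinity> \<Longrightarrow> objective n f \<phi> x = ereal (cost x)"
  unfolding objective_def cost_def by (subst closed_proper_convex_finite[OF \<phi>]) auto

lemma objective_eq_infinity_iff: "objective n f \<phi> x = \<infinity> \<longleftrightarrow> \<phi> x = \<infinity>"
  by (simp add: objective_def)

lemma gradient_batch:
  assumes "I \<subseteq> {1..n}"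
  shows "gradient (batch_fun f I) x = (1 / real (card I)) *\<^sub>R (\<Sum>i\<in>I. gradient (f i) x)"
  using assms smooth by (intro gradient_batch_fun) auto

lemma GDERIV_full: "GDERIV (full_fun n f) x :> grad x"
proof -
  have "GDERIV (full_fun n f) x :> (1 / real (card {1..n})) *\<^sub>R (\<Sum>i\<in>{1..n}. gradient (f i) x)"
    using smooth by (intro GDERIV_batch_fun GDERIV_gradient) auto
  thus ?thesis by (simp add: gradient_batch)
qed

lemma gradient_lipschitz: "norm (grad x - grad y) \<le> L * norm (x - y)"
proof -
  have "(norm (grad x - grad y))\<^sup>2
      = (norm ((1 / real (card {1..n})) *\<^sub>R (\<Sum>i\<in>{1..n}. gradient (f i) x - gradient (f i) y)))\<^sup>2"
    by (simp add: gradient_batch sum_subtractf scaleR_diff_right)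
  also have "\<dots> \<le> (\<Sum>i\<in>{1..n}. (norm (gradient (f i) x - gradient (f i) y))\<^sup>2) / real (card {1..n})"
    by (rule norm_average_squared_le)
  also have "\<dots> \<le> (L * norm (x - y))\<^sup>2" using mean_lipschitz[of x y] by (simp add: power_mult_distrib)
  finally show ?thesis by (rule power2_le_imp_le) (use L in simp)
qed

lemma component_gradient_continuous:
  assumes "i \<in> {1..n}"
  shows "continuous_on UNIV (gradient (f i))"
proof -
  have "norm (gradient (f i) x - gradient (f i) y) \<le> (sqrt (real n) * L) * norm (x - y)" for x y
  proof (rule power2_le_imp_le)
    have "(norm (gradient (f i) x - gradient (f i) y))\<^sup>2
        \<le> (\<Sum>i\<in>{1..n}. (norm (gradient (f i) x - gradient (f i) y))\<^sup>2)"
      using assms by (intro member_le_sum) auto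
    also have "\<dots> \<le> real n * (L\<^sup>2 * (norm (x - y))\<^sup>2)"
      using mean_lipschitz[of x y] n by (simp add: field_simps)
    finally show "(norm (gradient (f i) x - gradient (f i) y))\<^sup>2 \<le> (sqrt (real n) * L * norm (x - y))\<^sup>2"
      by (simp add: power_mult_distrib)
  qed (use L in simp)
  hence "(sqrt (real n) * L)-lipschitz_on UNIV (gradient (f i))"
    using L by (intro lipschitz_onI) (auto simp: dist_norm)
  thus ?thesis by (rule lipschitz_on_continuous_on)
qed

lemma batch_gradient_continuous:
  assumes "I \<subseteq> {1..n}"
  shows "continuous_on UNIV (gradient (batch_fun f I))"
proof -
  have "continuous_on UNIV (\<lambda>x. (1 / real (card I)) *\<^sub>R (\<Sum>i\<in>I. gradient (f i) x))"
    using assms by (intro continuous_intros component_gradient_continuous) auto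
  thus ?thesis using assms by (simp add: gradient_batch)
qed

lemma full_continuous: "continuous_on UNIV (full_fun n f)"
  using GDERIV_full unfolding gderiv_def
  by (intro has_derivative_continuous_on) (auto intro: has_derivative_at_withinI)

lemma full_descent: "full_fun n f y \<le> full_fun n f x + grad x \<bullet> (y - x) + L / 2 * (norm (y - x))\<^sup>2"
  by (rule descent_lemma[OF GDERIV_full gradient_lipschitz])

text \<open>Here \<open>\<epsilon>\<close> is the error of \<open>d\<close> as a negative gradient, \<open>\<delta>\<close> the full proximal step. The second claim
compares the proximal point with the current point directly; it has the strongest penalty on the step
length but keeps an inner product. The third passes through the exact proximal gradient
point \<open>z\<close>, using the variational inequality at both proximal points; this makes the gradient mapping
appear.\<close>

lemma prox_step:
  fixes w d :: 'a
  assumes w: "\<phi> w \<noteq> \<infinity>" and \<eta>: "0 < \<eta>" and \<gamma>: "0 < \<gamma>" "\<gamma> \<le> 1"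
  defines "y \<equiv> prox \<eta> \<phi> (w + \<eta> *\<^sub>R d)"
  defines "w' \<equiv> (1 - \<gamma>) *\<^sub>R w + \<gamma> *\<^sub>R y"
  defines "\<epsilon> \<equiv> grad w + d" and "\<delta> \<equiv> y - w" and "g \<equiv> gradient_mapping n f \<phi> \<eta> w"
  shows prox_step_finite: "\<phi> w' \<noteq> \<infinity>"
    and prox_step_inner: "cost w' \<le> cost w + \<gamma> * (\<epsilon> \<bullet> \<delta>) - \<gamma> * (1 / \<eta> - L * \<gamma> / 2) * (norm \<delta>)\<^sup>2"
    and prox_step_mapping: "cost w' \<le> cost w + \<gamma> * (\<eta> / 2 * (norm \<epsilon>)\<^sup>2 - (norm \<delta>)\<^sup>2 / (2 * \<eta>)
        - \<eta> / 2 * (norm g)\<^sup>2) + L * \<gamma>\<^sup>2 / 2 * (norm \<delta>)\<^sup>2"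
proof -
  let ?r = "\<lambda>z. real_of_ereal (\<phi> z)"
  note var = prox_variational_inequality[OF \<phi> \<eta>]
  have y: "\<phi> y \<noteq> \<infinity>" unfolding y_def by (rule var(1))
  have comb: "\<phi> w' \<noteq> \<infinity>" "?r w' \<le> (1 - \<gamma>) * ?r w + \<gamma> * ?r y"
    using closed_proper_convex_combination[OF \<phi> w y, of \<gamma>] \<gamma> by (auto simp: w'_def)
  show "\<phi> w' \<noteq> \<infinity>" by (rule comb)
  have w'w: "w' - w = \<gamma> *\<^sub>R \<delta>" by (simp add: w'_def \<delta>_def algebra_simps)
  have "full_fun n f w' \<le> full_fun n f w + \<gamma> * (grad w \<bullet> \<delta>) + L / 2 * (\<gamma>\<^sup>2 * (norm \<delta>)\<^sup>2)"
    using full_descent[of w' w] unfolding w'w by (simp add: power_mult_distrib)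
  hence base: "cost w' \<le> cost w + \<gamma> * (grad w \<bullet> \<delta> + ?r y - ?r w) + L * \<gamma>\<^sup>2 / 2 * (norm \<delta>)\<^sup>2"
    using comb(2) by (simp add: cost_def algebra_simps)
  have "?r y + (1 / \<eta>) * ((\<eta> *\<^sub>R d - \<delta>) \<bullet> (- \<delta>)) \<le> ?r w"
    using var(2)[OF w, of "w + \<eta> *\<^sub>R d"] by (simp add: y_def[symmetric] \<delta>_def algebra_simps)
  hence "?r y + ((norm \<delta>)\<^sup>2 / \<eta> - d \<bullet> \<delta>) \<le> ?r w"
    using \<eta> by (simp add: power2_norm_eq_inner inner_diff_left right_diff_distrib diff_divide_distrib)
  hence "grad w \<bullet> \<delta> + ?r y - ?r w \<le> \<epsilon> \<bullet> \<delta> - (norm \<delta>)\<^sup>2 / \<eta>"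
    by (simp add: \<epsilon>_def inner_add_left)
  hence "\<gamma> * (grad w \<bullet> \<delta> + ?r y - ?r w) \<le> \<gamma> * (\<epsilon> \<bullet> \<delta> - (norm \<delta>)\<^sup>2 / \<eta>)"
    using \<gamma> by (intro mult_left_mono) auto
  also have "\<dots> = \<gamma> * (\<epsilon> \<bullet> \<delta>) - \<gamma> * (1 / \<eta> - L * \<gamma> / 2) * (norm \<delta>)\<^sup>2 - L * \<gamma>\<^sup>2 / 2 * (norm \<delta>)\<^sup>2"
    by (simp add: power2_eq_square algebra_simps)
  finally show "cost w' \<le> cost w + \<gamma> * (\<epsilon> \<bullet> \<delta>) - \<gamma> * (1 / \<eta> - L * \<gamma> / 2) * (norm \<delta>)\<^sup>2"
    using base by linarith

  define z u where "z = prox \<eta> \<phi> (w - \<eta> *\<^sub>R grad w)" and "u = y - z"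
  have zg: "w - z = \<eta> *\<^sub>R g" using \<eta> by (simp add: g_def gradient_mapping_def z_def)
  have u: "u = \<delta> + \<eta> *\<^sub>R g" using zg by (simp add: u_def \<delta>_def algebra_simps)
  have z: "\<phi> z \<noteq> \<infinity>" unfolding z_def by (rule var(1))
  have "?r z + (1 / \<eta>) * ((w - \<eta> *\<^sub>R grad w - z) \<bullet> (w - z)) \<le> ?r w"
    unfolding z_def by (rule var(2)[OF w])
  moreover have "w - \<eta> *\<^sub>R grad w - z = \<eta> *\<^sub>R (g - grad w)" using zg by (simp add: algebra_simps)
  ultimately have "?r z + (1 / \<eta>) * ((\<eta> *\<^sub>R (g - grad w)) \<bullet> (\<eta> *\<^sub>R g)) \<le> ?r w"
    by (simp only: zg)
  hence r1: "?r z + \<eta> * ((norm g)\<^sup>2 - grad w \<bullet> g) \<le> ?r w"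
    using \<eta> by (simp add: inner_diff_left power2_norm_eq_inner)
  have "?r y + (1 / \<eta>) * ((w + \<eta> *\<^sub>R d - y) \<bullet> (z - y)) \<le> ?r z"
    using var(2)[OF z, of "w + \<eta> *\<^sub>R d"] by (simp add: y_def[symmetric])
  moreover have "w + \<eta> *\<^sub>R d - y = \<eta> *\<^sub>R d - \<delta>" "z - y = - u" by (auto simp: \<delta>_def u_def)
  ultimately have "?r y + (1 / \<eta>) * ((\<eta> *\<^sub>R d - \<delta>) \<bullet> (- u)) \<le> ?r z" by (simp only:)
  hence r2: "?r y + ((\<delta> \<bullet> u) / \<eta> - d \<bullet> u) \<le> ?r z"
    using \<eta> by (simp add: inner_diff_left right_diff_distrib diff_divide_distrib)
  have young: "\<epsilon> \<bullet> u \<le> \<eta> / 2 * (norm \<epsilon>)\<^sup>2 + (norm u)\<^sup>2 / (2 * \<eta>)"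
  proof -
    have "0 \<le> (norm (u + (- \<eta>) *\<^sub>R \<epsilon>))\<^sup>2" by simp
    also have "\<dots> = (norm u)\<^sup>2 - 2 * \<eta> * (\<epsilon> \<bullet> u) + \<eta>\<^sup>2 * (norm \<epsilon>)\<^sup>2"
      unfolding norm_add_scaleR_squared by (simp add: inner_commute)
    finally have "\<epsilon> \<bullet> u * (2 * \<eta>) \<le> \<eta>\<^sup>2 * (norm \<epsilon>)\<^sup>2 + (norm u)\<^sup>2" by (simp add: algebra_simps)
    hence "\<epsilon> \<bullet> u \<le> (\<eta>\<^sup>2 * (norm \<epsilon>)\<^sup>2 + (norm u)\<^sup>2) / (2 * \<eta>)" using \<eta> by (intro mult_imp_le_div_pos) auto
    also have "\<dots> = \<eta> / 2 * (norm \<epsilon>)\<^sup>2 + (norm u)\<^sup>2 / (2 * \<eta>)"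
      using \<eta> by (simp add: add_divide_distrib power2_eq_square)
    finally show ?thesis .
  qed
  have nu: "(norm u)\<^sup>2 / (2 * \<eta>) = (norm \<delta>)\<^sup>2 / (2 * \<eta>) + \<delta> \<bullet> g + \<eta> / 2 * (norm g)\<^sup>2"
    unfolding u norm_add_scaleR_squared using \<eta> by (simp add: add_divide_distrib power2_eq_square)
  have du: "(\<delta> \<bullet> u) / \<eta> = (norm \<delta>)\<^sup>2 / \<eta> + \<delta> \<bullet> g"
    unfolding u using \<eta> by (simp add: inner_add_right power2_norm_eq_inner add_divide_distrib)
  have half: "(norm \<delta>)\<^sup>2 / \<eta> = 2 * ((norm \<delta>)\<^sup>2 / (2 * \<eta>))" by simp
  have e1: "grad w \<bullet> \<delta> = grad w \<bullet> u - \<eta> * (grad w \<bullet> g)" by (simp add: u inner_add_right)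
  have e2: "\<epsilon> \<bullet> u = grad w \<bullet> u + d \<bullet> u" by (simp add: \<epsilon>_def inner_add_left)
  have "grad w \<bullet> \<delta> + ?r y - ?r w
      \<le> \<eta> / 2 * (norm \<epsilon>)\<^sup>2 - (norm \<delta>)\<^sup>2 / (2 * \<eta>) - \<eta> / 2 * (norm g)\<^sup>2"
    using r1 r2 young nu du e1 e2 half unfolding right_diff_distrib by linarith
  hence "\<gamma> * (grad w \<bullet> \<delta> + ?r y - ?r w)
      \<le> \<gamma> * (\<eta> / 2 * (norm \<epsilon>)\<^sup>2 - (norm \<delta>)\<^sup>2 / (2 * \<eta>) - \<eta> / 2 * (norm g)\<^sup>2)"
    using \<gamma> by (intro mult_left_mono) auto
  thus "cost w' \<le> cost w + \<gamma> * (\<eta> / 2 * (norm \<epsilon>)\<^sup>2 - (norm \<delta>)\<^sup>2 / (2 * \<eta>)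
        - \<eta> / 2 * (norm g)\<^sup>2) + L * \<gamma>\<^sup>2 / 2 * (norm \<delta>)\<^sup>2"
    using base by linarith
qed

text \<open>The two bounds of the previous lemma with weights \<open>\<eta>\<close> and \<open>1 - \<eta>\<close>. The weight \<open>\<eta>\<close> gives the gradient
mapping the coefficient \<open>\<gamma> \<eta>\<^sup>2 / 2\<close>, and the step length keeps at least \<open>2 / \<eta> - L \<gamma> - 3\<close>, while the error costs
at most half of \<open>\<gamma> / 2 * (1 + 2 \<eta>\<^sup>2)\<close>. This factor of one half is what the last-iterate bound
consumes.\<close>

lemma prox_step_mixed:
  fixes w d :: 'a
  assumes w: "\<phi> w \<noteq> \<infinity>" and \<eta>: "0 < \<eta>" "\<eta> \<le> 1" and \<gamma>: "0 < \<gamma>" "\<gamma> \<le> 1"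
  defines "y \<equiv> prox \<eta> \<phi> (w + \<eta> *\<^sub>R d)"
  shows "cost ((1 - \<gamma>) *\<^sub>R w + \<gamma> *\<^sub>R y) \<le> cost w
      - \<gamma> * \<eta>\<^sup>2 / 2 * (norm (gradient_mapping n f \<phi> \<eta> w))\<^sup>2
      + \<gamma> / 4 * (1 - \<eta> + 2 * \<eta>\<^sup>2) * (norm (grad w + d))\<^sup>2
      - \<gamma> / 2 * (2 / \<eta> - L * \<gamma> - 3 + 2 * \<eta>) * (norm (y - w))\<^sup>2"
proof -
  define V V' E D g where "V = cost w" and "V' = cost ((1 - \<gamma>) *\<^sub>R w + \<gamma> *\<^sub>R y)"
    and "E = (norm (grad w + d))\<^sup>2" and "D = (norm (y - w))\<^sup>2"
    and "g = (norm (gradient_mapping n f \<phi> \<eta> w))\<^sup>2"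
  define ip where "ip = (grad w + d) \<bullet> (y - w)"
  have 1: "V' \<le> V + \<gamma> * ip - \<gamma> * (1 / \<eta> - L * \<gamma> / 2) * D"
    using prox_step_inner[OF w \<eta>(1) \<gamma>, of d] by (simp add: V_def V'_def D_def ip_def y_def)
  have 2: "V' \<le> V + \<gamma> * (\<eta> / 2 * E - D / (2 * \<eta>) - \<eta> / 2 * g) + L * \<gamma>\<^sup>2 / 2 * D"
    using prox_step_mapping[OF w \<eta>(1) \<gamma>, of d] by (simp add: V_def V'_def E_def D_def g_def y_def)
  have ip: "ip \<le> D + E / 4"
  proof -
    have "0 \<le> (norm ((y - w) + (- 1/2) *\<^sub>R (grad w + d)))\<^sup>2" by simp
    also have "\<dots> = D - ip + E / 4"
      unfolding norm_add_scaleR_squared by (simp add: D_def E_def ip_def inner_commute power2_eq_square)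
    finally show ?thesis by simp
  qed
  have "V' = \<eta> * V' + (1 - \<eta>) * V'" by (simp add: algebra_simps)
  also have "\<dots> \<le> \<eta> * (V + \<gamma> * (\<eta> / 2 * E - D / (2 * \<eta>) - \<eta> / 2 * g) + L * \<gamma>\<^sup>2 / 2 * D)
      + (1 - \<eta>) * (V + \<gamma> * (D + E / 4) - \<gamma> * (1 / \<eta> - L * \<gamma> / 2) * D)"
  proof (intro add_mono mult_left_mono)
    show "V' \<le> V + \<gamma> * (D + E / 4) - \<gamma> * (1 / \<eta> - L * \<gamma> / 2) * D"
      using 1 mult_left_mono[OF ip, of \<gamma>] \<gamma> by linarith
  qed (use \<eta> 2 in auto)
  also have "\<dots> = V - \<gamma> * \<eta>\<^sup>2 / 2 * g + \<gamma> / 4 * (1 - \<eta> + 2 * \<eta>\<^sup>2) * E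
      - \<gamma> / 2 * (2 / \<eta> - L * \<gamma> - 3 + 2 * \<eta>) * D"
    using \<eta>(1) by (simp add: power2_eq_square field_simps)
  finally show ?thesis by (simp only: V_def V'_def E_def D_def g_def)
qed

end

text \<open>The condition \<open>step_bound\<close> follows from the parameter condition of the method, whose remaining
summand is nonnegative.\<close>

locale dominant_problem = composite_problem +
  fixes wstar :: 'a and \<tau>\<^sub>o \<gamma> \<eta>\<^sub>1 \<eta>\<^sub>2 :: real
  assumes minimizer: "\<And>x. objective n f \<phi> wstar \<le> objective n f \<phi> x"
    and \<tau>\<^sub>o: "0 < \<tau>\<^sub>o" and dominant: "gradient_dominant \<tau>\<^sub>o n f \<phi> wstar"
    and \<gamma>: "0 < \<gamma>" "\<gamma> \<le> 1" and \<eta>\<^sub>1: "0 < \<eta>\<^sub>1" "\<eta>\<^sub>1 \<le> \<eta>\<^sub>2"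
    and step_bound: "0 \<le> 2 / \<eta>\<^sub>2 - L * \<gamma> - 3"
begin

definition gap :: "'a \<Rightarrow> real" where "gap x = cost x - cost wstar"

definition bounded_start :: "real \<Rightarrow> 'a \<Rightarrow> 'a \<Rightarrow> bool" where
  "bounded_start K x e \<longleftrightarrow> \<phi> x \<noteq> \<infinity> \<and> norm x \<le> K \<and> norm e \<le> K \<and> gap x \<le> K"

definition rate :: real where "rate = \<gamma> * \<eta>\<^sub>1\<^sup>2 / \<tau>\<^sub>o"

lemma wstar_finite: "\<phi> wstar \<noteq> \<infinity>"
proof -
  obtain x where "\<phi> x \<noteq> \<infinity>" using \<phi> by (auto simp: closed_proper_convex_def)
  hence "objective n f \<phi> x < \<infinity>" by (simp add: objective_eq)
  hence "objective n f \<phi> wstar < \<infinity>" using minimizer le_less_trans by blast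
  thus ?thesis by (auto simp: objective_def)
qed

lemma gap_nonneg: "\<phi> x \<noteq> \<infinity> \<Longrightarrow> 0 \<le> gap x"
  using minimizer[of x] by (simp add: objective_eq wstar_finite gap_def)

lemma gap_dominated:
  assumes "\<phi> x \<noteq> \<infinity>" "0 < \<eta>"
  shows "gap x \<le> \<tau>\<^sub>o / 2 * (norm (gradient_mapping n f \<phi> \<eta> x))\<^sup>2"
  using dominant assms unfolding gradient_dominant_def
  by (auto simp: objective_eq_infinity_iff objective_eq wstar_finite gap_def)

lemma step_size_le: "\<eta>\<^sub>2 \<le> 2/3" and curvature_le: "L * \<gamma> \<le> 2 / \<eta>\<^sub>2 - 3"
proof -
  show le: "L * \<gamma> \<le> 2 / \<eta>\<^sub>2 - 3" using step_bound by linarith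
  have "0 < L * \<gamma>" using L \<gamma> by simp
  hence "3 \<le> 2 / \<eta>\<^sub>2" using le by linarith
  thus "\<eta>\<^sub>2 \<le> 2/3" using \<eta>\<^sub>1 by (simp add: field_simps)
qed

text \<open>An exact proximal gradient step of length \<open>1 / L\<close> from \<open>x\<close> decreases the objective by the squared
gradient mapping divided by \<open>2 L\<close>, so the gap is at least that; gradient dominance bounds
it by \<open>\<tau>\<^sub>o / 2\<close> times the same square.\<close>

lemma gap_zero_or_condition_number:
  assumes x: "\<phi> x \<noteq> \<infinity>" and "gap x \<noteq> 0"
  shows "1 \<le> \<tau>\<^sub>o * L"
proof -
  define \<eta> where "\<eta> = 1 / L"
  have \<eta>: "0 < \<eta>" using L by (simp add: \<eta>_def)
  define g D where "g = (norm (gradient_mapping n f \<phi> \<eta> x))\<^sup>2"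
    and "D = (norm (prox \<eta> \<phi> (x + \<eta> *\<^sub>R - grad x) - x))\<^sup>2"
  let ?y = "prox \<eta> \<phi> (x + \<eta> *\<^sub>R - grad x)"
  have fin: "\<phi> ?y \<noteq> \<infinity>" by (rule prox_in_domain[OF \<phi> \<eta>])
  have "cost ?y \<le> cost x + (- D / (2 * \<eta>) - \<eta> / 2 * g) + L / 2 * D"
    using prox_step_mapping[OF x \<eta>, of 1 "- grad x"] by (simp add: g_def D_def)
  also have "\<dots> = cost x - g / (2 * L)" by (simp add: \<eta>_def algebra_simps)
  finally have "g / (2 * L) \<le> gap x" using gap_nonneg[OF fin] by (simp add: gap_def)
  hence "g \<le> 2 * L * gap x" using L by (simp add: field_simps)
  hence "\<tau>\<^sub>o / 2 * g \<le> \<tau>\<^sub>o / 2 * (2 * L * gap x)" using \<tau>\<^sub>o by (intro mult_left_mono) auto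
  hence "1 * gap x \<le> (\<tau>\<^sub>o * L) * gap x" using gap_dominated[OF x \<eta>] by (simp add: g_def)
  moreover have "0 < gap x" using gap_nonneg[OF x] assms by simp
  ultimately show ?thesis by (simp only: mult_le_cancel_right_pos)
qed

lemma rate_pos: "0 < rate" using \<gamma> \<eta>\<^sub>1 \<tau>\<^sub>o by (simp add: rate_def)

text \<open>Positivity of the step coefficient bounds \<open>L \<gamma>\<close> by \<open>2 / \<eta>\<^sub>2 - 3\<close>, and \<open>2 \<eta> - 3 \<eta>\<^sup>2\<close> has its maximum
\<open>1/3\<close> at \<open>\<eta> = 1/3\<close>.\<close>

lemma rate_le_third:
  assumes "1 \<le> \<tau>\<^sub>o * L"
  shows "rate \<le> 1/3"
proof -
  have \<eta>\<^sub>2: "0 < \<eta>\<^sub>2" using \<eta>\<^sub>1 by simp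
  have "1 / \<tau>\<^sub>o \<le> L" using assms \<tau>\<^sub>o by (simp add: field_simps)
  hence "rate \<le> (\<gamma> * \<eta>\<^sub>1\<^sup>2) * L" using \<gamma> mult_left_mono[of "1 / \<tau>\<^sub>o" L "\<gamma> * \<eta>\<^sub>1\<^sup>2"] by (simp add: rate_def)
  also have "\<dots> = (L * \<gamma>) * \<eta>\<^sub>1\<^sup>2" by simp
  also have "\<dots> \<le> (2 / \<eta>\<^sub>2 - 3) * \<eta>\<^sub>2\<^sup>2"
  proof (intro mult_mono power_mono)
    have "0 < L * \<gamma>" using L \<gamma> by simp
    thus "0 \<le> 2 / \<eta>\<^sub>2 - 3" using curvature_le by linarith
  qed (use curvature_le \<eta>\<^sub>1 in auto)
  also have "\<dots> = 2 * \<eta>\<^sub>2 - 3 * \<eta>\<^sub>2\<^sup>2" using \<eta>\<^sub>2 by (simp add: power2_eq_square field_simps)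
  also have "\<dots> = 1/3 - 3 * (\<eta>\<^sub>2 - 1/3)\<^sup>2" by (simp add: power2_eq_square field_simps)
  also have "\<dots> \<le> 1/3" by simp
  finally show ?thesis .
qed

lemma gap_step:
  fixes w d :: 'a
  assumes w: "\<phi> w \<noteq> \<infinity>" and \<eta>: "\<eta>\<^sub>1 \<le> \<eta>" "\<eta> \<le> \<eta>\<^sub>2"
  defines "y \<equiv> prox \<eta> \<phi> (w + \<eta> *\<^sub>R d)"
  shows "gap ((1 - \<gamma>) *\<^sub>R w + \<gamma> *\<^sub>R y) \<le> (1 - rate) * gap w
      + \<gamma> / 4 * (1 + 2 * \<eta>\<^sub>2\<^sup>2) * (norm (grad w + d))\<^sup>2
      - \<gamma> / 2 * (2 / \<eta>\<^sub>2 - L * \<gamma> - 3) * (norm (y - w))\<^sup>2"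
proof -
  have \<eta>0: "0 < \<eta>" "\<eta> \<le> 1" using \<eta> \<eta>\<^sub>1 step_size_le by auto
  define g where "g = (norm (gradient_mapping n f \<phi> \<eta> w))\<^sup>2"
  have "rate * gap w = \<gamma> * \<eta>\<^sub>1\<^sup>2 * (gap w / \<tau>\<^sub>o)" by (simp add: rate_def)
  also have "\<dots> \<le> \<gamma> * \<eta>\<^sup>2 * (g / 2)"
  proof (intro mult_mono power_mono)
    show "gap w / \<tau>\<^sub>o \<le> g / 2" using gap_dominated[OF w \<eta>0(1)] \<tau>\<^sub>o by (simp add: g_def field_simps)
    show "0 \<le> gap w / \<tau>\<^sub>o" using gap_nonneg[OF w] \<tau>\<^sub>o by simp
  qed (use \<gamma> \<eta> \<eta>\<^sub>1 in auto)
  finally have r: "rate * gap w \<le> \<gamma> * \<eta>\<^sup>2 / 2 * g" by simp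
  have "\<eta>\<^sup>2 \<le> \<eta>\<^sub>2\<^sup>2" using \<eta> \<eta>0 by (intro power_mono) auto
  hence e: "\<gamma> / 4 * (1 - \<eta> + 2 * \<eta>\<^sup>2) * (norm (grad w + d))\<^sup>2
      \<le> \<gamma> / 4 * (1 + 2 * \<eta>\<^sub>2\<^sup>2) * (norm (grad w + d))\<^sup>2"
    using \<gamma> \<eta>0 by (intro mult_right_mono mult_left_mono) auto
  have "2 / \<eta>\<^sub>2 \<le> 2 / \<eta>" using \<eta> \<eta>0 by (intro divide_left_mono) auto
  hence s: "\<gamma> / 2 * (2 / \<eta>\<^sub>2 - L * \<gamma> - 3) * (norm (y - w))\<^sup>2
      \<le> \<gamma> / 2 * (2 / \<eta> - L * \<gamma> - 3 + 2 * \<eta>) * (norm (y - w))\<^sup>2"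
    using \<gamma> \<eta>0 by (intro mult_right_mono mult_left_mono) auto
  have "cost ((1 - \<gamma>) *\<^sub>R w + \<gamma> *\<^sub>R y) \<le> cost w - \<gamma> * \<eta>\<^sup>2 / 2 * g
      + \<gamma> / 4 * (1 - \<eta> + 2 * \<eta>\<^sup>2) * (norm (grad w + d))\<^sup>2
      - \<gamma> / 2 * (2 / \<eta> - L * \<gamma> - 3 + 2 * \<eta>) * (norm (y - w))\<^sup>2"
    unfolding y_def g_def by (rule prox_step_mixed[OF w \<eta>0 \<gamma>])
  moreover have "(1 - rate) * gap w = gap w - rate * gap w" by (simp add: algebra_simps)
  ultimately show ?thesis using r e s unfolding gap_def by linarith
qed

lemma gap_measurable: "gap \<in> borel_measurable borel"
proof -
  have [measurable]: "full_fun n f \<in> borel_measurable borel"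
    using full_continuous by (rule borel_measurable_continuous_onI)
  have [measurable]: "\<phi> \<in> borel_measurable borel" by (rule borel_measurable_closed_proper_convex[OF \<phi>])
  show ?thesis unfolding gap_def cost_def by measurable
qed

end

section \<open>Last-iterate bound for a recursion with memory\<close>

lemma bernoulli_reciprocal:
  fixes x :: real
  assumes "0 \<le> x" "x \<le> 1"
  shows "(1 + real j * x) * (1 - x) ^ j \<le> 1"
proof -
  have "(1 + real j * x) * (1 - x) ^ j \<le> (1 + x) ^ j * (1 - x) ^ j"
    using assms Bernoulli_inequality[of x j] by (intro mult_right_mono) auto
  also have "\<dots> = (1 - x\<^sup>2) ^ j"
    by (simp add: power_mult_distrib[symmetric] algebra_simps power2_eq_square)
  also have "\<dots> \<le> 1"
    using assms by (intro power_le_one) (auto simp: power2_eq_square mult_le_one)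
  finally show ?thesis .
qed

text \<open>Think of an adversary who maximises \<open>D m\<close>. A decrease \<open>T (Suc k) - T k\<close> of the gap is stored and feeds
back \<open>1 / (2 m)\<close> of itself into every later step; it is limited by \<open>D (Suc k) \<ge> 0\<close>. With \<open>i\<close> steps to go
the optimal value is linear, \<open>p D + s T\<close>. One step earlier the mass is worth \<open>max p s\<close>, as it can be kept
or stored, so \<open>p\<close> becomes \<open>(1 - x) max p s\<close> and \<open>s\<close> grows by \<open>max p s / (2 m)\<close>. Hence \<open>p\<close> decays like
\<open>(1 - x) ^ i\<close> until the stored price takes over, and that price stays below
\<open>(1 + 1 / (2 m)) ^ i / (2 m x)\<close>, which is at most \<open>1 / ((m + 1) x)\<close> for \<open>i < m\<close>.\<close>

lemma recursion_with_memory_last_bound: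
  fixes D T h :: "nat \<Rightarrow> real" and x c :: real and m :: nat
  assumes x: "0 < x" "x \<le> 1" and m: "1 \<le> m"
    and D: "\<And>k. k \<le> m \<Longrightarrow> 0 \<le> D k" and h: "\<And>k. k < m \<Longrightarrow> 0 \<le> h k"
    and T0: "T 0 = 0" and T: "\<And>k. k < m \<Longrightarrow> T k \<le> T (Suc k)"
    and step: "\<And>k. k < m \<Longrightarrow>
      D (Suc k) \<le> (1 - x) * D k + h k + T k / (2 * real m) - (T (Suc k) - T k)"
  defines "c \<equiv> 1 / ((real m + 1) * x)"
  shows "D m \<le> c * D 0 + (\<Sum>k<m. max ((1 - x) ^ (m - 1 - k)) c * h k)"
proof -
  define q l where "q = 1 - x" and "l = 1 + 1 / (2 * real m)"
  have q: "0 \<le> q" "q < 1" using x by (auto simp: q_def)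
  have l: "1 \<le> l" by (simp add: l_def)
  have c: "0 < c" using x by (simp add: c_def)
  have Tnn: "0 \<le> T k" if "k \<le> m" for k
    using that by (induction k) (use T0 T in \<open>auto intro: order_trans\<close>)
  have qm: "q ^ m \<le> c"
  proof -
    have "(real m + 1) * x * q ^ m \<le> (1 + real m * x) * q ^ m"
      using x q by (intro mult_right_mono) (auto simp: algebra_simps)
    also have "\<dots> \<le> 1" unfolding q_def by (rule bernoulli_reciprocal) (use x in auto)
    finally show ?thesis using x by (simp add: c_def pos_le_divide_eq mult.commute)
  qed
  \<comment> \<open>the factor \<open>2\<close> in \<open>2 m\<close> is needed here: \<open>1 / l = 1 - y\<close>, and \<open>(1 - y) ^ (m - 1)\<close> is bounded below by Bernoulli\<close>
  have lpow: "l ^ i / (2 * real m * x) \<le> c" if "i < m" for i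
  proof -
    define y where "y = 1 / (2 * real m + 1)"
    have "0 < real m" using m by simp
    hence ly: "l * (1 - y) = 1" by (simp add: l_def y_def divide_simps)
    have "1 - real (m - 1) * y \<le> (1 - y) ^ (m - 1)"
      using Bernoulli_inequality[of "-y" "m - 1"] by (auto simp: y_def field_simps)
    moreover have "(real m + 1) / (2 * real m) \<le> 1 - real (m - 1) * y"
      using m by (simp add: y_def of_nat_diff field_simps)
    ultimately have "(real m + 1) / (2 * real m) \<le> (1 - y) ^ (m - 1)" by linarith
    hence "l ^ (m - 1) * ((real m + 1) / (2 * real m)) \<le> l ^ (m - 1) * (1 - y) ^ (m - 1)"
      using l by (intro mult_left_mono) auto
    also have "\<dots> = 1" by (simp add: power_mult_distrib[symmetric] ly)
    finally have "l ^ (m - 1) * (real m + 1) \<le> 2 * real m" using m by (simp add: field_simps)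
    moreover have "l ^ i \<le> l ^ (m - 1)" using l that by (intro power_increasing) auto
    ultimately have "l ^ i * (real m + 1) \<le> 2 * real m"
      by (meson mult_right_mono of_nat_0_le_iff add_nonneg_nonneg zero_le_one order_trans)
    hence "l ^ i / (2 * real m) \<le> 1 / (real m + 1)" using m by (simp add: divide_simps)
    hence "l ^ i / (2 * real m) / x \<le> 1 / (real m + 1) / x" using x by (intro divide_right_mono) auto
    thus ?thesis by (simp add: c_def)
  qed
  \<comment> \<open>two bounds on \<open>p\<close>: one keeps the induction going, the other survives at \<open>i = m\<close>, where \<open>s\<close> may exceed \<open>c\<close>\<close>
  have inv: "\<exists>p s. 0 \<le> p \<and> 0 \<le> s \<and> p \<le> max (q ^ i) s \<and> p \<le> max (q ^ i) c
      \<and> s \<le> l ^ i * (1 - q ^ i) / (2 * real m * x)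
      \<and> D m \<le> p * D (m - i) + s * T (m - i)
          + (\<Sum>k\<in>{m-i..<m}. max (q ^ (m - 1 - k)) c * h k)"
    if "i \<le> m" for i
    using that
  proof (induction i)
    case 0
    show ?case by (rule exI[of _ 1], rule exI[of _ 0]) auto
  next
    case (Suc i)
    then obtain p s where ps: "0 \<le> p" "0 \<le> s" "p \<le> max (q ^ i) s" "p \<le> max (q ^ i) c"
      and s: "s \<le> l ^ i * (1 - q ^ i) / (2 * real m * x)"
      and Dm: "D m \<le> p * D (m - i) + s * T (m - i)
          + (\<Sum>k\<in>{m-i..<m}. max (q ^ (m - 1 - k)) c * h k)" by auto
    define k where "k = m - Suc i"
    have k: "k < m" "m - i = Suc k" "m - 1 - k = i" using Suc.prems by (auto simp: k_def)
    define M where "M = max p s"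
    have qi: "0 \<le> q ^ i" "q ^ i \<le> 1" using q by (auto intro: power_le_one)
    have "l ^ i * (1 - q ^ i) / (2 * real m * x) \<le> l ^ i / (2 * real m * x)"
      using qi l x by (intro divide_right_mono) (auto simp: mult_left_le)
    hence sc: "s \<le> c" using s lpow[of i] Suc.prems by linarith
    have M: "0 \<le> M" "M \<le> max (q ^ i) s" "M \<le> max (q ^ i) c"
      using ps sc by (auto simp: M_def)
    have "p * D (Suc k) + s * T (Suc k) = p * D (Suc k) + s * (T (Suc k) - T k) + s * T k"
      by (simp add: algebra_simps)
    also have "\<dots> \<le> M * D (Suc k) + M * (T (Suc k) - T k) + s * T k"
      using D[of "Suc k"] T[OF k(1)] k(1) by (intro add_mono mult_right_mono order_refl) (auto simp: M_def)
    also have "\<dots> \<le> M * (q * D k + h k + T k / (2 * real m)) + s * T k"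
    proof -
      have "D (Suc k) + (T (Suc k) - T k) \<le> q * D k + h k + T k / (2 * real m)"
        using step[OF k(1)] by (simp add: q_def)
      hence "M * (D (Suc k) + (T (Suc k) - T k)) \<le> M * (q * D k + h k + T k / (2 * real m))"
        using M(1) by (rule mult_left_mono)
      thus ?thesis by (simp add: distrib_left)
    qed
    also have "\<dots> = q * M * D k + (s + M / (2 * real m)) * T k + M * h k"
      by (simp add: algebra_simps)
    also have "\<dots> \<le> q * M * D k + (s + M / (2 * real m)) * T k + max (q ^ i) c * h k"
      using M(3) h[OF k(1)] by (intro add_left_mono mult_right_mono) auto
    finally have "D m \<le> q * M * D k + (s + M / (2 * real m)) * T k + max (q ^ i) c * h k
        + (\<Sum>k\<in>{m-i..<m}. max (q ^ (m - 1 - k)) c * h k)"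
      using Dm k(2) by simp
    moreover have "(\<Sum>k\<in>{m-Suc i..<m}. max (q ^ (m - 1 - k)) c * h k)
        = max (q ^ i) c * h k + (\<Sum>k\<in>{m-i..<m}. max (q ^ (m - 1 - k)) c * h k)"
      using k by (subst sum.atLeast_Suc_lessThan) (auto simp: k_def[symmetric])
    ultimately have main: "D m \<le> q * M * D (m - Suc i) + (s + M / (2 * real m)) * T (m - Suc i)
        + (\<Sum>k\<in>{m-Suc i..<m}. max (q ^ (m - 1 - k)) c * h k)"
      by (simp add: k_def)
    have qM: "q * M \<le> max (q ^ Suc i) z" if "M \<le> max (q ^ i) z" "0 \<le> z" for z
    proof -
      have "q * M \<le> q * max (q ^ i) z" using that q by (intro mult_left_mono) auto
      also have "\<dots> \<le> max (q ^ Suc i) z"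
        using q that mult_right_mono[of q 1 z] by (auto simp: max_def)
      finally show ?thesis .
    qed
    have s': "s \<le> s + M / (2 * real m)" using M by simp
    have "q * M \<le> max (q ^ Suc i) s" using qM[of s] M ps by auto
    hence a1: "q * M \<le> max (q ^ Suc i) (s + M / (2 * real m))" using s' by linarith
    have a2: "q * M \<le> max (q ^ Suc i) c" using qM[of c] M c by auto
    have a3: "s + M / (2 * real m) \<le> l ^ Suc i * (1 - q ^ Suc i) / (2 * real m * x)"
    proof -
      have li: "1 \<le> l ^ i" using l by simp
      define b where "b = l ^ i * (1 - q ^ i) / (2 * real m * x)"
      have b0: "0 \<le> b" using qi li x by (simp add: b_def)
      have e: "l ^ Suc i * (1 - q ^ Suc i) / (2 * real m * x) = l * (b + l ^ i * q ^ i / (2 * real m))"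
        using x m by (simp add: b_def q_def field_simps)
      have z: "0 \<le> l ^ i * q ^ i / (2 * real m)" using qi li by simp
      have "s + M / (2 * real m) \<le> b + max (q ^ i) b / (2 * real m)"
        using s M(2) by (intro add_mono divide_right_mono) (auto simp: b_def)
      also have "\<dots> \<le> l * (b + l ^ i * q ^ i / (2 * real m))"
      proof (cases "q ^ i \<le> b")
        case True
        have "b + max (q ^ i) b / (2 * real m) = l * b" using True by (simp add: l_def field_simps max_def)
        also have "\<dots> \<le> l * (b + l ^ i * q ^ i / (2 * real m))" using l z by (intro mult_left_mono) auto
        finally show ?thesis .
      next
        case False
        have "b + max (q ^ i) b / (2 * real m) = b + q ^ i / (2 * real m)" using False by (simp add: max_def)
        also have "\<dots> \<le> b + l ^ i * q ^ i / (2 * real m)"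
          using mult_right_mono[OF li qi(1)] by (intro add_left_mono divide_right_mono) auto
        also have "\<dots> \<le> l * (b + l ^ i * q ^ i / (2 * real m))"
          using mult_right_mono[OF l, of "b + l ^ i * q ^ i / (2 * real m)"] b0 z by simp
        finally show ?thesis .
      qed
      finally show ?thesis using e by simp
    qed
    show ?case
      by (rule exI[of _ "q * M"], rule exI[of _ "s + M / (2 * real m)"])
         (use main a1 a2 a3 q M ps in auto)
  qed
  obtain p s where p: "p \<le> max (q ^ m) c"
    and Dm: "D m \<le> p * D 0 + s * T 0 + (\<Sum>k\<in>{0..<m}. max (q ^ (m - 1 - k)) c * h k)"
    using inv[of m] by auto
  have "p * D 0 \<le> c * D 0" using p qm D by (intro mult_right_mono) auto
  thus ?thesis using Dm T0 by (simp add: q_def atLeast0LessThan)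
qed

text \<open>The weight that the last-iterate bound gives to the noise of step \<open>k\<close>, in units of \<open>1 / ((m + 1) x)\<close>.\<close>

definition late_weight :: "nat \<Rightarrow> real \<Rightarrow> nat \<Rightarrow> real" where
  "late_weight m x k = max ((real m + 1) * x * (1 - x) ^ (m - 1 - k)) 1"

text \<open>With \<open>j = m - 1 - k\<close> remaining steps, \<open>m + 1 = j + k + 2\<close>; the part \<open>j + 3\<close> contributes at most \<open>1\<close> by
the Bernoulli bound because \<open>3 x \<le> 1\<close>.\<close>

lemma late_weight_le:
  assumes "0 < x" "x \<le> 1/3" "k < m"
  shows "late_weight m x k \<le> max 1 (1 + x * (1 - x) ^ (m - 1 - k) * (real k - 1))"
proof -
  define j where "j = m - 1 - k"
  have jm: "real m + 1 = real j + real k + 2" using assms by (simp add: j_def of_nat_diff)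
  have q: "0 \<le> (1 - x) ^ j" using assms by simp
  have "(real j * x + 3 * x) * (1 - x) ^ j \<le> (1 + real j * x) * (1 - x) ^ j"
    using q assms by (intro mult_right_mono) auto
  also have "\<dots> \<le> 1" by (rule bernoulli_reciprocal) (use assms in auto)
  finally have "(real m + 1) * x * (1 - x) ^ j \<le> 1 + x * (1 - x) ^ j * (real k - 1)"
    unfolding jm by (simp add: algebra_simps)
  thus ?thesis by (auto simp: late_weight_def j_def)
qed

lemma late_weight_zero:
  assumes "0 < x" "x \<le> 1/3" "1 \<le> m"
  shows "late_weight m x 0 = 1"
proof -
  have "late_weight m x 0 \<le> max 1 (1 - x * (1 - x) ^ (m - 1))"
    using late_weight_le[OF assms(1,2), of 0 m] assms(3) by simp
  also have "\<dots> \<le> 1" using assms by simp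
  finally show ?thesis by (simp add: late_weight_def)
qed

text \<open>The excess of the weights over \<open>1\<close> is \<open>k - 1\<close> times a geometric kernel of total mass at most \<open>1\<close>.\<close>

lemma weighted_sum_le:
  assumes x: "0 < x" "x \<le> 1/3"
    and h: "\<And>k. k \<in> {1..<m} \<Longrightarrow> 0 \<le> h k"
    and \<mu>: "\<And>k. k \<in> {1..<m} \<Longrightarrow> (real k - 1) * h k \<le> \<mu>" and "0 \<le> \<mu>"
  shows "(\<Sum>k\<in>{1..<m}. late_weight m x k * h k) \<le> (\<Sum>k\<in>{1..<m}. h k) + \<mu>"
proof -
  have "(\<Sum>k\<in>{1..<m}. late_weight m x k * h k)
      \<le> (\<Sum>k\<in>{1..<m}. h k + x * (1 - x) ^ (m - 1 - k) * \<mu>)"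
  proof (rule sum_mono)
    fix k assume k: "k \<in> {1..<m}"
    have q: "0 \<le> x * (1 - x) ^ (m - 1 - k)" using x by simp
    have "1 \<le> 1 + x * (1 - x) ^ (m - 1 - k) * (real k - 1)" using q k by simp
    hence "late_weight m x k \<le> 1 + x * (1 - x) ^ (m - 1 - k) * (real k - 1)"
      using late_weight_le[OF x, of k m] k by auto
    hence "late_weight m x k * h k \<le> (1 + x * (1 - x) ^ (m - 1 - k) * (real k - 1)) * h k"
      using h[OF k] by (rule mult_right_mono)
    also have "\<dots> = h k + x * (1 - x) ^ (m - 1 - k) * ((real k - 1) * h k)"
      by (simp add: algebra_simps)
    also have "\<dots> \<le> h k + x * (1 - x) ^ (m - 1 - k) * \<mu>"
      using \<mu>[OF k] q by (intro add_left_mono mult_left_mono) auto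
    finally show "late_weight m x k * h k \<le> h k + x * (1 - x) ^ (m - 1 - k) * \<mu>" .
  qed
  also have "\<dots> = (\<Sum>k\<in>{1..<m}. h k) + (\<Sum>k\<in>{1..<m}. x * (1 - x) ^ (m - 1 - k)) * \<mu>"
    by (simp add: sum.distrib sum_distrib_right)
  also have "(\<Sum>k\<in>{1..<m}. x * (1 - x) ^ (m - 1 - k)) \<le> 1"
  proof -
    have "(\<Sum>k\<in>{1..<m}. x * (1 - x) ^ (m - 1 - k)) \<le> (\<Sum>k<m. x * (1 - x) ^ (m - 1 - k))"
      using x by (intro sum_mono2) auto
    also have "\<dots> = (\<Sum>k<m. x * (1 - x) ^ k)"
      using sum.nat_diff_reindex[of "\<lambda>k. x * (1 - x) ^ k" m] by simp
    also have "\<dots> = 1 - (1 - x) ^ m"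
      using x by (simp add: sum_distrib_left[symmetric] sum_gp_strict)
    also have "\<dots> \<le> 1" using x by simp
    finally show ?thesis .
  qed
  finally show ?thesis using \<open>0 \<le> \<mu>\<close> by (simp add: mult_right_mono)
qed

lemma sum_of_damped_recursion_le:
  fixes h r :: "nat \<Rightarrow> real"
  assumes a: "a < 1" and "\<And>k. 1 \<le> k \<Longrightarrow> h (Suc k) \<le> a * h k + r k" and "\<And>k. 0 \<le> h k" "1 \<le> m"
  shows "(1 - a) * (\<Sum>k\<in>{1..<m}. h k) \<le> h 1 + (\<Sum>k\<in>{1..<m}. r k)"
proof -
  have "(1 - a) * (\<Sum>k\<in>{1..<m}. h k) + h m \<le> h 1 + (\<Sum>k\<in>{1..<m}. r k)"
    using \<open>1 \<le> m\<close>
  proof (induction m rule: dec_induct)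
    case (step n)
    have "h (Suc n) \<le> a * h n + r n" using assms(2) step.hyps by simp
    moreover have "(1 - a) * (\<Sum>k\<in>{1..<Suc n}. h k) = (1 - a) * (\<Sum>k\<in>{1..<n}. h k) + (1 - a) * h n"
      using step.hyps by (simp add: algebra_simps)
    moreover have "(\<Sum>k\<in>{1..<Suc n}. r k) = (\<Sum>k\<in>{1..<n}. r k) + r n"
      using step.hyps by simp
    ultimately show ?case using step.IH by (simp add: algebra_simps)
  qed auto
  thus ?thesis using assms(3)[of m] by linarith
qed

text \<open>With \<open>y = n (1 - z)\<close> the left side is at most \<open>y exp (- y) \<le> exp (- 1)\<close>. The constant \<open>3/8\<close>
is the largest for which the first case of \<open>budget_quadratic\<close> closes, as \<open>16/5 (1/4 + 3/8) = 2\<close>.\<close>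

lemma mult_power_times_one_minus_le:
  fixes z :: real
  assumes "0 \<le> z" "z \<le> 1"
  shows "real n * z ^ n * (1 - z) \<le> 3/8"
proof -
  define y where "y = real n * (1 - z)"
  have "z ^ n \<le> exp (-(1 - z)) ^ n"
    using assms exp_ge_add_one_self[of "-(1-z)"] by (intro power_mono) auto
  also have "\<dots> = exp (- y)" by (simp add: y_def exp_of_nat_mult[symmetric] algebra_simps)
  finally have "real n * z ^ n * (1 - z) \<le> y * exp (- y)"
    using assms mult_left_mono[of "z ^ n" "exp (- y)" y] by (simp add: y_def ac_simps)
  also have "\<dots> \<le> exp (y - 1) * exp (- y)"
    using exp_ge_add_one_self[of "y - 1"] by (intro mult_right_mono) auto
  also have "\<dots> = exp (-1)" by (simp add: exp_add[symmetric])
  also have "\<dots> \<le> 3/8"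
  proof -
    have "(8/3::real) \<le> (1 + 1/4 + (1/4)\<^sup>2 / 2) ^ 4" by (simp add: field_simps)
    also have "\<dots> \<le> exp (1/4) ^ 4"
      using exp_lower_Taylor_quadratic[of "1/4"] by (intro power_mono) auto
    also have "\<dots> = exp 1" by (simp add: exp_of_nat_mult[symmetric])
    finally have "(8/3::real) \<le> exp 1" .
    thus ?thesis by (simp add: exp_minus field_simps)
  qed
  finally show ?thesis .
qed

section \<open>Accumulated direction errors\<close>

text \<open>The direction recursion multiplies squared errors by \<open>\<beta>\<^sup>2\<close> and adds, at step \<open>j\<close>, a term of order
\<open>\<beta> ^ j\<close> for the newest estimator; \<open>damped_sum 1\<close> is the resulting sum. A slope present at the start
decays by a factor \<open>c\<close> per step, so its contribution is \<open>damped_sum c\<close>.\<close>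

definition damped_sum :: "real \<Rightarrow> real \<Rightarrow> nat \<Rightarrow> real" where
  "damped_sum c \<beta> k = (\<Sum>j\<in>{1..<k}. c ^ j * \<beta> ^ (2 * k - j))"

lemma damped_sum_1 [simp]: "damped_sum c \<beta> (Suc 0) = 0"
  by (simp add: damped_sum_def)

lemma damped_sum_Suc:
  assumes "1 \<le> k"
  shows "damped_sum c \<beta> (Suc k) = \<beta>\<^sup>2 * damped_sum c \<beta> k + c ^ k * \<beta> ^ (k + 2)"
proof -
  have "c ^ j * \<beta> ^ (2 * Suc k - j) = \<beta>\<^sup>2 * (c ^ j * \<beta> ^ (2 * k - j))" if "j \<in> {1..<k}" for j
  proof -
    have "2 * Suc k - j = 2 + (2 * k - j)" using that by auto
    thus ?thesis by (simp only: power_add) simp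
  qed
  moreover have "2 * Suc k - k = k + 2" by simp
  ultimately have "(\<Sum>j\<in>{1..<k}. c ^ j * \<beta> ^ (2 * Suc k - j)) + c ^ k * \<beta> ^ (2 * Suc k - k)
      = (\<Sum>j\<in>{1..<k}. \<beta>\<^sup>2 * (c ^ j * \<beta> ^ (2 * k - j))) + c ^ k * \<beta> ^ (k + 2)"
    by (simp only: cong: sum.cong)
  thus ?thesis
    using assms unfolding damped_sum_def sum_distrib_left by (simp only: sum.atLeastLessThan_Suc)
qed

lemma damped_sum_nonneg: "0 \<le> c \<Longrightarrow> 0 \<le> \<beta> \<Longrightarrow> 0 \<le> damped_sum c \<beta> k"
  by (simp add: damped_sum_def sum_nonneg)

lemma power_sum_le:
  assumes "0 \<le> z" "z < (1::real)"
  shows "(\<Sum>j\<in>{1..<n}. z ^ j) \<le> z / (1 - z)"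
proof (cases n)
  case (Suc k)
  have "(\<Sum>j\<in>{1..<n}. z ^ j) = (\<Sum>j<k. z ^ Suc j)"
    unfolding Suc by (simp only: One_nat_def sum.shift_bounds_Suc_ivl atLeast0LessThan)
  also have "\<dots> = z * ((1 - z ^ k) / (1 - z))"
    using assms by (simp add: sum_distrib_left[symmetric] sum_gp_strict)
  also have "\<dots> \<le> z * (1 / (1 - z))"
    using assms by (intro mult_left_mono divide_right_mono) auto
  finally show ?thesis by simp
qed (use assms in auto)

text \<open>Written with \<open>p = c / (1 - c)\<close> and \<open>Q = 1 / (1 - \<beta>)\<close> because both the plain sum, of order
\<open>p Q / (p + Q)\<close>, and the excess of the late weights, of order \<open>min p Q\<close>, are homogeneous in \<open>(p, Q)\<close>.
The excess uses that the inner convolution of two geometric sequences is bounded by each of the two sums.\<close>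

lemma damped_sum_weighted_le:
  assumes \<beta>: "0 < \<beta>" "\<beta> < 1" and c: "0 < c" "c < 1" and x: "0 < x" "x \<le> 1/3" and m: "1 \<le> m"
  defines "p \<equiv> c / (1 - c)" and "Q \<equiv> 1 / (1 - \<beta>)"
  shows "(\<Sum>k\<in>{1..<m}. late_weight m x k * (damped_sum c \<beta> k / 2))
    \<le> \<beta>\<^sup>2 / (1 - \<beta>\<^sup>2) * (p * Q / (2 * (p + Q)) + 3/8 * min p Q)"
proof -
  have b2: "0 < 1 - \<beta>\<^sup>2" using \<beta> by (simp add: power_less_one_iff abs_square_less_1)
  have pQ: "0 < p" "0 < Q" using c \<beta> by (auto simp: p_def Q_def)
  have "(1 - \<beta>\<^sup>2) * (\<Sum>k\<in>{1..<m}. damped_sum c \<beta> k / 2)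
      \<le> damped_sum c \<beta> 1 / 2 + (\<Sum>k\<in>{1..<m}. c ^ k * \<beta> ^ (k + 2) / 2)"
    by (rule sum_of_damped_recursion_le) (use \<beta> c b2 m in \<open>auto simp: damped_sum_Suc damped_sum_nonneg\<close>)
  also have "\<dots> = \<beta>\<^sup>2 / 2 * (\<Sum>k\<in>{1..<m}. (c * \<beta>) ^ k)"
    by (simp add: sum_distrib_left power_mult_distrib power_add power2_eq_square algebra_simps)
  also have "(\<Sum>k\<in>{1..<m}. (c * \<beta>) ^ k) \<le> c * \<beta> / (1 - c * \<beta>)"
    using \<beta> c mult_strict_mono[of c 1 \<beta> 1] by (intro power_sum_le) auto
  also have "c * \<beta> / (1 - c * \<beta>) \<le> c / (1 - c * \<beta>)"
    using \<beta> c mult_strict_mono[of c 1 \<beta> 1] by (intro divide_right_mono) auto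
  also have "c / (1 - c * \<beta>) = p * Q / (p + Q)"
  proof -
    have "p + Q = (1 - c * \<beta>) / ((1 - c) * (1 - \<beta>))"
      using \<beta> c by (simp add: p_def Q_def divide_simps) (simp add: algebra_simps)
    moreover have "p * Q = c / ((1 - c) * (1 - \<beta>))" by (simp add: p_def Q_def)
    ultimately show ?thesis using \<beta> c by simp
  qed
  finally have "(1 - \<beta>\<^sup>2) * (\<Sum>k\<in>{1..<m}. damped_sum c \<beta> k / 2) \<le> \<beta>\<^sup>2 / 2 * (p * Q / (p + Q))"
    by (simp add: mult_left_mono)
  hence sum: "(\<Sum>k\<in>{1..<m}. damped_sum c \<beta> k / 2) \<le> \<beta>\<^sup>2 / (1 - \<beta>\<^sup>2) * (p * Q / (2 * (p + Q)))"
    using mult_imp_le_div_pos[OF b2, of "\<Sum>k\<in>{1..<m}. damped_sum c \<beta> k / 2"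
        "\<beta>\<^sup>2 / 2 * (p * Q / (p + Q))"] by (simp add: mult.commute)
  have sup: "(real k - 1) * (damped_sum c \<beta> k / 2) \<le> \<beta>\<^sup>2 / (1 - \<beta>\<^sup>2) * (3/8 * min p Q)"
    if "k \<in> {1..<m}" for k
  proof -
    have k: "1 \<le> k" using that by simp
    have fac: "damped_sum c \<beta> k = \<beta> ^ (k + 1) * (\<Sum>j\<in>{1..<k}. c ^ j * \<beta> ^ (k - 1 - j))"
      unfolding damped_sum_def sum_distrib_left
    proof (rule sum.cong[OF refl])
      fix j assume "j \<in> {1..<k}"
      hence "2 * k - j = (k + 1) + (k - 1 - j)" by auto
      thus "c ^ j * \<beta> ^ (2 * k - j) = \<beta> ^ (k + 1) * (c ^ j * \<beta> ^ (k - 1 - j))"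
        by (simp only: power_add) simp
    qed
    have "(\<Sum>j\<in>{1..<k}. c ^ j * \<beta> ^ (k - 1 - j)) \<le> (\<Sum>j\<in>{1..<k}. c ^ j)"
      using \<beta> c by (intro sum_mono) (auto simp: mult_left_le power_le_one)
    also have "\<dots> \<le> p" unfolding p_def using c by (intro power_sum_le) auto
    finally have 1: "(\<Sum>j\<in>{1..<k}. c ^ j * \<beta> ^ (k - 1 - j)) \<le> p" .
    have "(\<Sum>j\<in>{1..<k}. c ^ j * \<beta> ^ (k - 1 - j)) \<le> (\<Sum>j\<in>{1..<k}. \<beta> ^ (k - 1 - j))"
      using \<beta> c by (intro sum_mono) (auto simp: mult_left_le_one_le power_le_one)
    also have "\<dots> \<le> (\<Sum>j<k. \<beta> ^ (k - 1 - j))" using \<beta> by (intro sum_mono2) auto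
    also have "\<dots> = (\<Sum>j<k. \<beta> ^ j)" using sum.nat_diff_reindex[of "\<lambda>j. \<beta> ^ j" k] by simp
    also have "\<dots> = (1 - \<beta> ^ k) / (1 - \<beta>)" using \<beta> by (simp add: sum_gp_strict)
    also have "\<dots> \<le> Q" unfolding Q_def using \<beta> by (intro divide_right_mono) auto
    finally have 2: "(\<Sum>j\<in>{1..<k}. c ^ j * \<beta> ^ (k - 1 - j)) \<le> Q" .
    have "(real k - 1) * (damped_sum c \<beta> k / 2) \<le> (real k - 1) * (\<beta> ^ (k + 1) * min p Q / 2)"
      unfolding fac using 1 2 k \<beta> by (intro mult_left_mono divide_right_mono) auto
    also have "\<dots> = (real (k - 1) * \<beta> ^ (k - 1) * (1 - \<beta>)) * (\<beta>\<^sup>2 * min p Q / (2 * (1 - \<beta>)))"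
    proof -
      have "\<beta> ^ (k + 1) = \<beta> ^ (k - 1) * \<beta>\<^sup>2" using k by (simp flip: power_add)
      thus ?thesis using \<beta> k by (simp add: of_nat_diff divide_simps)
    qed
    also have "\<dots> \<le> 3/8 * (\<beta>\<^sup>2 * min p Q / (2 * (1 - \<beta>)))"
      using \<beta> pQ by (intro mult_right_mono mult_power_times_one_minus_le) auto
    also have "\<dots> \<le> \<beta>\<^sup>2 / (1 - \<beta>\<^sup>2) * (3/8 * min p Q)"
    proof -
      have "1 - \<beta>\<^sup>2 \<le> 2 * (1 - \<beta>)" using \<beta> sum_power2_ge_zero[of "1-\<beta>" 0] by (simp add: power2_eq_square algebra_simps)
      hence "(3/8 * (\<beta>\<^sup>2 * min p Q)) / (2 * (1 - \<beta>)) \<le> (3/8 * (\<beta>\<^sup>2 * min p Q)) / (1 - \<beta>\<^sup>2)"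
        using b2 pQ \<beta> by (intro divide_left_mono) auto
      thus ?thesis by (simp add: mult.commute mult.left_commute)
    qed
    finally show ?thesis .
  qed
  have "(\<Sum>k\<in>{1..<m}. late_weight m x k * (damped_sum c \<beta> k / 2))
      \<le> (\<Sum>k\<in>{1..<m}. damped_sum c \<beta> k / 2) + \<beta>\<^sup>2 / (1 - \<beta>\<^sup>2) * (3/8 * min p Q)"
    by (rule weighted_sum_le[OF x]) (use sup \<beta> c b2 pQ in \<open>auto simp: damped_sum_nonneg\<close>)
  with sum show ?thesis unfolding distrib_left by linarith
qed

lemma power_weighted_le:
  assumes \<beta>: "0 < \<beta>" "\<beta> < 1" and x: "0 < x" "x \<le> 1/3" and m: "1 \<le> m"
  shows "(\<Sum>k\<in>{1..<m}. late_weight m x k * (\<beta> ^ (2 * k) / 2)) \<le> 11/16 * (\<beta>\<^sup>2 / (1 - \<beta>\<^sup>2))"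
proof -
  have b2: "0 < 1 - \<beta>\<^sup>2" using \<beta> by (simp add: power_less_one_iff abs_square_less_1)
  have "(\<Sum>k\<in>{1..<m}. \<beta> ^ (2 * k) / 2) = (\<Sum>k\<in>{1..<m}. (\<beta>\<^sup>2) ^ k) / 2"
    by (simp add: power_mult sum_divide_distrib)
  also have "\<dots> \<le> \<beta>\<^sup>2 / (1 - \<beta>\<^sup>2) / 2"
    using b2 by (intro divide_right_mono power_sum_le) auto
  finally have sum: "(\<Sum>k\<in>{1..<m}. \<beta> ^ (2 * k) / 2) \<le> 1/2 * (\<beta>\<^sup>2 / (1 - \<beta>\<^sup>2))"
    by (simp add: mult.commute)
  have sup: "(real k - 1) * (\<beta> ^ (2 * k) / 2) \<le> 3/16 * (\<beta>\<^sup>2 / (1 - \<beta>\<^sup>2))" if "k \<in> {1..<m}" for k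
  proof -
    have "2 * k = 2 * (k - 1) + 2" using that by auto
    hence "\<beta> ^ (2 * k) = (\<beta>\<^sup>2) ^ (k - 1) * \<beta>\<^sup>2"
      by (metis power_mult power_add)
    hence "(real k - 1) * (\<beta> ^ (2 * k) / 2)
        = (real (k - 1) * (\<beta>\<^sup>2) ^ (k - 1) * (1 - \<beta>\<^sup>2)) * (\<beta>\<^sup>2 / (1 - \<beta>\<^sup>2) / 2)"
      using b2 that by (simp add: of_nat_diff divide_simps)
    also have "\<dots> \<le> 3/8 * (\<beta>\<^sup>2 / (1 - \<beta>\<^sup>2) / 2)"
      using b2 by (intro mult_right_mono mult_power_times_one_minus_le) auto
    finally show ?thesis by simp
  qed
  have "(\<Sum>k\<in>{1..<m}. late_weight m x k * (\<beta> ^ (2 * k) / 2))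
      \<le> (\<Sum>k\<in>{1..<m}. \<beta> ^ (2 * k) / 2) + 3/16 * (\<beta>\<^sup>2 / (1 - \<beta>\<^sup>2))"
    by (rule weighted_sum_le[OF x]) (use sup \<beta> b2 in auto)
  with sum show ?thesis by linarith
qed

text \<open>The summand is \<open>\<beta> ^ (k + 1) (1 - \<beta> ^ k) / (2 (1 - \<beta>))\<close> in closed form. The margin \<open>1/8\<close> left by the
factor \<open>7/8\<close> pays for the initial slope in \<open>direction_error_budget\<close>.\<close>

lemma geometric_weighted_le:
  assumes \<beta>: "0 < \<beta>" "\<beta> < 1" and x: "0 < x" "x \<le> 1/3" and m: "1 \<le> m"
  shows "(\<Sum>k\<in>{1..<m}. late_weight m x k * ((\<beta> ^ (2 * k) + damped_sum 1 \<beta> k) / 2))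
    \<le> 7/8 * (\<beta>\<^sup>2 / (1 - \<beta>\<^sup>2) / (1 - \<beta>))"
proof -
  define h where "h = (\<lambda>k. (\<beta> ^ (2 * k) + damped_sum 1 \<beta> k) / 2)"
  have b2: "0 < 1 - \<beta>\<^sup>2" using \<beta> by (simp add: power_less_one_iff abs_square_less_1)
  have hnn: "0 \<le> h k" for k using \<beta> by (auto simp: h_def damped_sum_nonneg)
  have hS: "h (Suc k) = \<beta>\<^sup>2 * h k + \<beta> ^ (k + 2) / 2" if "1 \<le> k" for k
    using that by (simp add: h_def damped_sum_Suc power2_eq_square algebra_simps)
  have h1: "h 1 = \<beta>\<^sup>2 / 2" by (simp add: h_def)
  have "(1 - \<beta>\<^sup>2) * (\<Sum>k\<in>{1..<m}. h k) \<le> h 1 + (\<Sum>k\<in>{1..<m}. \<beta> ^ (k + 2) / 2)"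
    by (rule sum_of_damped_recursion_le) (use b2 m hS hnn in auto)
  also have "\<dots> = \<beta>\<^sup>2 / 2 * (1 + (\<Sum>k\<in>{1..<m}. \<beta> ^ k))"
    unfolding h1 by (simp add: sum_distrib_left power_add power2_eq_square algebra_simps)
  also have "\<dots> \<le> \<beta>\<^sup>2 / 2 * (1 + \<beta> / (1 - \<beta>))"
    using \<beta> by (intro mult_left_mono add_left_mono power_sum_le) auto
  also have "\<dots> = \<beta>\<^sup>2 / 2 * (1 / (1 - \<beta>))" using \<beta> by (simp add: field_simps)
  finally have sum: "(\<Sum>k\<in>{1..<m}. h k) \<le> 1/2 * (\<beta>\<^sup>2 / (1 - \<beta>\<^sup>2) / (1 - \<beta>))"
    using mult_imp_le_div_pos[OF b2, of "\<Sum>k\<in>{1..<m}. h k" "\<beta>\<^sup>2 / 2 * (1 / (1 - \<beta>))"]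
    by (simp add: algebra_simps)
  have closed: "h k \<le> \<beta> ^ (k + 1) / (2 * (1 - \<beta>))" if "1 \<le> k" for k
  proof -
    have "h k = \<beta> ^ (k + 1) * (1 - \<beta> ^ k) / (2 * (1 - \<beta>))"
      using that
    proof (induction k rule: dec_induct)
      case base
      show ?case using \<beta> unfolding h1 by (simp add: power2_eq_square divide_simps)
    next
      case (step k)
      show ?case unfolding hS[OF step.hyps(1)] step.IH
        using \<beta> by (simp add: power2_eq_square divide_simps) (simp add: algebra_simps)
    qed
    also have "\<dots> \<le> \<beta> ^ (k + 1) * 1 / (2 * (1 - \<beta>))"
      using \<beta> by (intro divide_right_mono mult_left_mono) auto
    finally show ?thesis by simp
  qed
  have sup: "(real k - 1) * h k \<le> 3/8 * (\<beta>\<^sup>2 / (1 - \<beta>\<^sup>2) / (1 - \<beta>))" if "k \<in> {1..<m}" for k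
  proof -
    have k: "1 \<le> k" using that by simp
    have "(real k - 1) * h k \<le> (real k - 1) * (\<beta> ^ (k + 1) / (2 * (1 - \<beta>)))"
      using closed[OF k] k by (intro mult_left_mono) auto
    also have "\<dots> = (real (k - 1) * \<beta> ^ (k - 1) * (1 - \<beta>)) * (\<beta>\<^sup>2 / (2 * (1 - \<beta>)) / (1 - \<beta>))"
    proof -
      have "\<beta> ^ (k + 1) = \<beta> ^ (k - 1) * \<beta>\<^sup>2" using k by (simp flip: power_add)
      thus ?thesis using \<beta> k by (simp add: of_nat_diff divide_simps)
    qed
    also have "\<dots> \<le> 3/8 * (\<beta>\<^sup>2 / (2 * (1 - \<beta>)) / (1 - \<beta>))"
      using \<beta> by (intro mult_right_mono mult_power_times_one_minus_le) auto
    also have "\<dots> \<le> 3/8 * (\<beta>\<^sup>2 / (1 - \<beta>\<^sup>2) / (1 - \<beta>))"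
    proof -
      have "1 - \<beta>\<^sup>2 \<le> 2 * (1 - \<beta>)" using \<beta> sum_power2_ge_zero[of "1-\<beta>" 0] by (simp add: power2_eq_square algebra_simps)
      thus ?thesis using b2 \<beta> by (intro mult_left_mono divide_right_mono divide_left_mono) auto
    qed
    finally show ?thesis .
  qed
  define B where "B = \<beta>\<^sup>2 / (1 - \<beta>\<^sup>2) / (1 - \<beta>)"
  have "(\<Sum>k\<in>{1..<m}. late_weight m x k * h k)
      \<le> (\<Sum>k\<in>{1..<m}. h k) + 3/8 * (\<beta>\<^sup>2 / (1 - \<beta>\<^sup>2) / (1 - \<beta>))"
    by (rule weighted_sum_le[OF x]) (use sup hnn \<beta> b2 in auto)
  hence "(\<Sum>k\<in>{1..<m}. late_weight m x k * h k) \<le> 7/8 * (\<beta>\<^sup>2 / (1 - \<beta>\<^sup>2) / (1 - \<beta>))"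
    using sum unfolding B_def[symmetric] by linarith
  thus ?thesis by (simp add: h_def)
qed

text \<open>Without the summand \<open>1\<close> in \<open>1 + 2 p\<close> the claim is stronger and homogeneous. For \<open>Q \<le> p\<close> one has \<open>E \<le> 5/8 p\<close>, so
the left side is nonpositive; for \<open>p < Q\<close> one has \<open>E \<le> 7/8 p\<close>, and a quadratic in \<open>Q / p\<close> without real
roots remains.\<close>

lemma budget_quadratic:
  fixes p Q :: real
  assumes "0 < p" "0 < Q"
  defines "E \<equiv> p * Q / (2 * (p + Q)) + 3/8 * min p Q"
  shows "(16/5 * E - (1 + 2 * p)) * E \<le> (1 + 2 * p) * Q / 8"
proof (cases "Q \<le> p")
  case True
  have "p * Q / (2 * (p + Q)) \<le> p / 4"
    using assms True by (simp add: divide_simps)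
  hence "E \<le> 5/8 * p" using True unfolding E_def by linarith
  moreover have "0 \<le> E" using assms by (simp add: E_def)
  ultimately have "(16/5 * E - (1 + 2 * p)) * E \<le> 0"
    by (intro mult_nonpos_nonneg) auto
  thus ?thesis using assms by (smt (verit) mult_nonneg_nonneg divide_nonneg_pos)
next
  case False
  hence Q: "p < Q" by simp
  have E: "E = p * Q / (2 * (p + Q)) + 3/8 * p" using Q by (simp add: E_def)
  have E0: "0 \<le> E" using assms by (simp add: E_def)
  have "p * Q / (2 * (p + Q)) \<le> p / 2"
    using assms by (simp add: divide_simps)
  hence E1: "E \<le> 7/8 * p" using E by simp
  have e: "16/5 * E - 2 * p = 4/5 * p * (Q - p) / (p + Q)"
    using assms(1,2) by (simp add: E divide_simps) (simp add: algebra_simps)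
  have "(16/5 * E - (1 + 2 * p)) * E \<le> (16/5 * E - 2 * p) * E"
    using E0 by (intro mult_right_mono) auto
  also have "\<dots> \<le> 4/5 * p * (Q - p) / (p + Q) * (7/8 * p)"
    using E1 unfolding e using Q assms by (intro mult_left_mono) auto
  also have "\<dots> = 7/10 * p\<^sup>2 * (Q - p) / (p + Q)"
  proof -
    have "4/5 * p * (Q - p) * (7/8 * p) = 7/10 * p\<^sup>2 * (Q - p)" by (simp add: power2_eq_square)
    thus ?thesis by (simp only: times_divide_eq_left)
  qed
  also have "\<dots> \<le> 2 * p * Q / 8"
  proof -
    have "7/10 * p\<^sup>2 * (Q - p) \<le> 2 * p * Q / 8 * (p + Q)"
    proof -
      have "1/4 * Q\<^sup>2 - 9/20 * (p * Q) + 7/10 * p\<^sup>2 = (1/2 * Q - 9/20 * p)\<^sup>2 + 199/400 * p\<^sup>2"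
        by (simp add: power2_eq_square algebra_simps)
      hence "0 \<le> 1/4 * Q\<^sup>2 - 9/20 * (p * Q) + 7/10 * p\<^sup>2" by simp
      hence "0 \<le> p * (1/4 * Q\<^sup>2 - 9/20 * (p * Q) + 7/10 * p\<^sup>2)" using assms by simp
      thus ?thesis by (simp add: power2_eq_square algebra_simps)
    qed
    thus ?thesis using assms(1,2) by (intro mult_imp_div_pos_le) auto
  qed
  also have "\<dots> \<le> (1 + 2 * p) * Q / 8" using assms by (simp add: algebra_simps)
  finally show ?thesis .
qed

text \<open>The parameter \<open>s\<close> trades the two bounds against each other: the initial slope \<open>r\<close> is split as
\<open>2 r \<le> s N + H / s\<close> between the squared norms of the gradient and of the initial direction. The
second norm may use what the pure powers leave, \<open>5/16\<close> of its budget, which forces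
\<open>s \<ge> 16/5 E\<close>; the first may use \<open>1/8\<close> of its own, and \<open>budget_quadratic\<close> says that this suffices for
the smallest such \<open>s\<close>.\<close>

lemma direction_error_budget:
  assumes \<beta>: "0 < \<beta>" "\<beta> < 1" and c: "0 < c" "c < 1" and x: "0 < x" "x \<le> 1/3" and m: "1 \<le> m"
  defines "\<Phi> \<equiv> (1 + c) / (1 - c)"
  obtains s where "1 \<le> s"
    and "(\<Sum>k\<in>{1..<m}. late_weight m x k * ((\<beta> ^ (2 * k) + damped_sum c \<beta> k / s) / 2))
      \<le> \<beta>\<^sup>2 / (1 - \<beta>\<^sup>2)"
    and "(\<Sum>k\<in>{1..<m}. late_weight m x k * ((\<beta> ^ (2 * k) + \<Phi> * damped_sum 1 \<beta> k
        + (s - \<Phi>) * damped_sum c \<beta> k) / 2))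
      \<le> \<Phi> * \<beta>\<^sup>2 / ((1 - \<beta>)\<^sup>2 * (1 + \<beta>))"
proof -
  define p Q where "p = c / (1 - c)" and "Q = 1 / (1 - \<beta>)"
  define E where "E = p * Q / (2 * (p + Q)) + 3/8 * min p Q"
  define \<kappa> where "\<kappa> = \<beta>\<^sup>2 / (1 - \<beta>\<^sup>2)"
  \<comment> \<open>at least \<open>1\<close> so that \<open>s + 1 / s \<le> s + 1\<close> in the application\<close>
  define s where "s = max 1 (16/5 * E)"
  define W where "W = (\<lambda>h. \<Sum>k\<in>{1..<m}. late_weight m x k * (h k / 2))"
  have Wadd: "W (\<lambda>k. g k + h k) = W g + W h" for g h
    by (simp add: W_def sum.distrib[symmetric] algebra_simps add_divide_distrib)
  have Wmult: "W (\<lambda>k. a * h k) = a * W h" for a h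
    by (simp add: W_def sum_distrib_left algebra_simps)
  have pQ: "0 < p" "0 < Q" using c \<beta> by (auto simp: p_def Q_def)
  have \<Phi>: "\<Phi> = 1 + 2 * p" using c by (simp add: \<Phi>_def p_def field_simps)
  have b2: "0 < 1 - \<beta>\<^sup>2" using \<beta> by (simp add: power_less_one_iff abs_square_less_1)
  have \<kappa>: "0 < \<kappa>" using \<beta> b2 by (simp add: \<kappa>_def)
  have E0: "0 \<le> E" using pQ by (simp add: E_def)
  have Wc: "W (damped_sum c \<beta>) \<le> \<kappa> * E"
    using damped_sum_weighted_le[OF \<beta> c x m] by (simp add: W_def \<kappa>_def E_def p_def Q_def)
  have Wp: "W (\<lambda>k. \<beta> ^ (2 * k)) \<le> 11/16 * \<kappa>"
    using power_weighted_le[OF \<beta> x m] by (simp add: W_def \<kappa>_def)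
  have "late_weight m x k \<ge> 1" for k by (simp add: late_weight_def)
  hence lw: "late_weight m x k \<ge> 0" for k by (smt (verit))
  have Wp0: "0 \<le> W (\<lambda>k. \<beta> ^ (2 * k))" "0 \<le> W (damped_sum c \<beta>)" unfolding W_def
    using \<beta> c lw by (auto intro!: sum_nonneg mult_nonneg_nonneg simp: damped_sum_nonneg)
  have W1: "W (\<lambda>k. \<beta> ^ (2 * k)) + W (damped_sum 1 \<beta>) \<le> 7/8 * (\<kappa> * Q)"
    using geometric_weighted_le[OF \<beta> x m] Wadd[of "\<lambda>k. \<beta> ^ (2 * k)" "damped_sum 1 \<beta>"]
    by (simp add: W_def \<kappa>_def Q_def)
  have "W (\<lambda>k. \<beta> ^ (2 * k) + 1 / s * damped_sum c \<beta> k)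
      = W (\<lambda>k. \<beta> ^ (2 * k)) + 1 / s * W (damped_sum c \<beta>)"
    by (simp only: Wadd Wmult)
  also have "\<dots> \<le> 11/16 * \<kappa> + 1 / s * (\<kappa> * E)"
    using Wp Wc by (intro add_mono mult_left_mono) (auto simp: s_def)
  also have "1 / s * (\<kappa> * E) \<le> 5/16 * \<kappa>"
  proof -
    have "E \<le> 5/16 * s" by (simp add: s_def)
    hence "\<kappa> * E \<le> \<kappa> * (5/16 * s)" using \<kappa> by (intro mult_left_mono) auto
    moreover have "0 < s" by (simp add: s_def)
    ultimately show ?thesis by (simp add: divide_simps ac_simps)
  qed
  finally have A: "W (\<lambda>k. \<beta> ^ (2 * k) + 1 / s * damped_sum c \<beta> k) \<le> \<kappa>" by simp
  have "W (\<lambda>k. \<beta> ^ (2 * k) + \<Phi> * damped_sum 1 \<beta> k + (s - \<Phi>) * damped_sum c \<beta> k)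
      = W (\<lambda>k. \<beta> ^ (2 * k)) + \<Phi> * W (damped_sum 1 \<beta>) + (s - \<Phi>) * W (damped_sum c \<beta>)"
    by (simp only: Wadd Wmult)
  also have "\<dots> \<le> \<Phi> * (7/8 * (\<kappa> * Q)) + \<kappa> * (\<Phi> * Q / 8)"
  proof (rule add_mono)
    have "W (\<lambda>k. \<beta> ^ (2 * k)) + \<Phi> * W (damped_sum 1 \<beta>)
        \<le> \<Phi> * (W (\<lambda>k. \<beta> ^ (2 * k)) + W (damped_sum 1 \<beta>))"
      using Wp0 pQ by (simp add: \<Phi> algebra_simps)
    also have "\<dots> \<le> \<Phi> * (7/8 * (\<kappa> * Q))"
      using W1 pQ by (intro mult_left_mono) (auto simp: \<Phi>)
    finally show "W (\<lambda>k. \<beta> ^ (2 * k)) + \<Phi> * W (damped_sum 1 \<beta>) \<le> \<Phi> * (7/8 * (\<kappa> * Q))" .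
    show "(s - \<Phi>) * W (damped_sum c \<beta>) \<le> \<kappa> * (\<Phi> * Q / 8)"
    proof (cases "s \<le> \<Phi>")
      case True
      hence "(s - \<Phi>) * W (damped_sum c \<beta>) \<le> 0" using Wp0 by (intro mult_nonpos_nonneg) auto
      also have "0 \<le> \<kappa> * (\<Phi> * Q / 8)" using \<kappa> pQ by (simp add: \<Phi>)
      finally show ?thesis .
    next
      case False
      hence s: "s = 16/5 * E" using pQ by (auto simp: s_def \<Phi> max_def split: if_splits)
      have "(s - \<Phi>) * W (damped_sum c \<beta>) \<le> (s - \<Phi>) * (\<kappa> * E)"
        using Wc False by (intro mult_left_mono) auto
      also have "\<dots> = \<kappa> * ((16/5 * E - (1 + 2 * p)) * E)" by (simp add: s \<Phi>)
      also have "\<dots> \<le> \<kappa> * ((1 + 2 * p) * Q / 8)"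
        unfolding E_def using \<kappa> pQ by (intro mult_left_mono budget_quadratic) auto
      finally show ?thesis by (simp add: \<Phi>)
    qed
  qed
  also have "\<dots> = \<Phi> * (\<kappa> * Q)" by (simp add: algebra_simps)
  also have "\<dots> = \<Phi> * \<beta>\<^sup>2 / ((1 - \<beta>)\<^sup>2 * (1 + \<beta>))"
  proof -
    have "1 - \<beta>\<^sup>2 = (1 - \<beta>) * (1 + \<beta>)" by (simp add: power2_eq_square algebra_simps)
    hence "\<kappa> * Q = \<beta>\<^sup>2 / ((1 - \<beta>)\<^sup>2 * (1 + \<beta>))"
      by (simp add: \<kappa>_def Q_def power2_eq_square mult.commute mult.left_commute)
    thus ?thesis by simp
  qed
  finally have B: "W (\<lambda>k. \<beta> ^ (2 * k) + \<Phi> * damped_sum 1 \<beta> k + (s - \<Phi>) * damped_sum c \<beta> k)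
      \<le> \<Phi> * \<beta>\<^sup>2 / ((1 - \<beta>)\<^sup>2 * (1 + \<beta>))" .
  show ?thesis
    by (rule that[of s]) (use A B in \<open>auto simp: s_def W_def \<kappa>_def\<close>)
qed

section \<open>Conjugate directions\<close>

text \<open>The negative slope \<open>- v k \<bullet> d k\<close> is at most the squared norm of \<open>v k\<close> times a number \<open>z k / N\<close> that obeys
\<open>z (k+1) = N + c z k\<close>, by the curvature condition and the bound on the conjugate parameter. With
it, expanding the square of \<open>d (k+1) = - v (k+1) + \<beta> (k+1) d k\<close> gives a linear recursion for the quantity
on the left, whose solution is expressed by \<open>damped_sum\<close>.\<close>

lemma conjugate_direction_error_le:
  fixes v d :: "nat \<Rightarrow> 'a::real_inner" and \<beta> :: "nat \<Rightarrow> real"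
  assumes b: "0 < b" "b < 1" and c: "0 < c" "c < 1"
    and dec: "\<And>k. k \<le> m \<Longrightarrow> (norm (v (Suc k)))\<^sup>2 \<le> b * (norm (v k))\<^sup>2"
    and beta: "\<And>k. k \<in> {1..m+1} \<Longrightarrow> \<bar>\<beta> k\<bar> \<le> (norm (v k))\<^sup>2 / (norm (v (k - 1)))\<^sup>2"
    and d: "\<And>k. k \<in> {1..m+1} \<Longrightarrow> d k = - v k + \<beta> k *\<^sub>R d (k - 1)"
    and wolfe: "\<And>k. k \<le> m \<Longrightarrow> \<bar>v (Suc k) \<bullet> d k\<bar> \<le> - c * (v k \<bullet> d k)"
    and s: "1 \<le> s" and k: "k \<in> {1..<m}"
  defines "\<Phi> \<equiv> (1 + c) / (1 - c)"
  shows "(\<beta> k)\<^sup>2 * (norm (d (k - 1)))\<^sup>2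
    \<le> (b ^ (2 * k) + \<Phi> * damped_sum 1 b k + (s - \<Phi>) * damped_sum c b k) * (norm (v 0))\<^sup>2
      + (b ^ (2 * k) + damped_sum c b k / s) * \<bar>(norm (d 0))\<^sup>2 - (norm (v 0))\<^sup>2\<bar>"
proof -
  define N H r where "N = (norm (v 0))\<^sup>2" and "H = (norm (d 0))\<^sup>2" and "r = - (v 0 \<bullet> d 0)"
  define P where "P = 1 / (1 - c)"
  define z where "z j = (N * (1 - c ^ j) * P) + c ^ j * r" for j
  have N: "0 \<le> N" "0 \<le> H" by (auto simp: N_def H_def)
  have P: "0 < P" using c by (simp add: P_def)
  have r0: "0 \<le> r"
  proof -
    have "0 \<le> \<bar>v 1 \<bullet> d 0\<bar>" by simp
    also have "\<dots> \<le> c * r" using wolfe[of 0] by (simp add: r_def)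
    finally show ?thesis using c by (simp add: zero_le_mult_iff)
  qed
  have z: "z (Suc j) = N + c * z j" for j
  proof -
    have "P - c * P = 1" using c by (simp add: P_def field_simps)
    moreover have "z (Suc j) - c * z j = N * (P - c * P)" by (simp add: z_def algebra_simps)
    ultimately show ?thesis by simp
  qed
  have znn: "0 \<le> z j" for j
    using N r0 P c by (auto simp: z_def intro!: add_nonneg_nonneg mult_nonneg_nonneg power_le_one)
  have vk: "(norm (v k))\<^sup>2 \<le> b ^ k * N" if "k \<le> m + 1" for k
    using that
  proof (induction k)
    case (Suc k)
    have "(norm (v (Suc k)))\<^sup>2 \<le> b * (norm (v k))\<^sup>2" using dec Suc.prems by simp
    also have "\<dots> \<le> b * (b ^ k * N)" using Suc b by (intro mult_left_mono) auto
    finally show ?case by simp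
  qed (simp add: N_def)
  have beta_v: "\<bar>\<beta> (Suc k)\<bar> * (norm (v k))\<^sup>2 \<le> (norm (v (Suc k)))\<^sup>2" if "k \<le> m" for k
  proof (cases "v k = 0")
    case False
    thus ?thesis using beta[of "Suc k"] that by (simp add: pos_le_divide_eq)
  qed (use dec[OF that] in auto)
  have beta_b: "\<bar>\<beta> (Suc k)\<bar> \<le> b" if "k \<le> m" for k
  proof (cases "v k = 0")
    case False
    have "\<bar>\<beta> (Suc k)\<bar> \<le> (norm (v (Suc k)))\<^sup>2 / (norm (v k))\<^sup>2" using beta[of "Suc k"] that by simp
    also have "\<dots> \<le> b" using dec[OF that] False by (simp add: pos_divide_le_eq)
    finally show ?thesis .
  qed (use beta[of "Suc k"] that b in auto)
  have beta_b2: "(\<beta> (Suc k))\<^sup>2 \<le> b\<^sup>2" if "k \<le> m" for k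
    using beta_b[OF that] power_mono[of "\<bar>\<beta> (Suc k)\<bar>" b 2] by simp
  \<comment> \<open>\<open>z j / N\<close> bounds the normalised slope; multiplying by \<open>N\<close> avoids dividing by a vanishing gradient\<close>
  have slope: "N * (- (v k \<bullet> d k)) \<le> (norm (v k))\<^sup>2 * z k" if "k \<le> m" for k
    using that
  proof (induction k)
    case 0
    show ?case by (simp add: z_def r_def N_def)
  next
    case (Suc k)
    have "- (v (Suc k) \<bullet> d (Suc k)) = (norm (v (Suc k)))\<^sup>2 - \<beta> (Suc k) * (v (Suc k) \<bullet> d k)"
      using d[of "Suc k"] Suc.prems by (simp add: inner_simps power2_norm_eq_inner)
    also have "\<dots> \<le> (norm (v (Suc k)))\<^sup>2 + \<bar>\<beta> (Suc k)\<bar> * \<bar>v (Suc k) \<bullet> d k\<bar>"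
      by (simp add: abs_mult[symmetric])
    also have "\<dots> \<le> (norm (v (Suc k)))\<^sup>2 + \<bar>\<beta> (Suc k)\<bar> * (- c * (v k \<bullet> d k))"
      using wolfe[of k] Suc.prems by (intro add_left_mono mult_left_mono) auto
    finally have "N * (- (v (Suc k) \<bullet> d (Suc k)))
        \<le> N * ((norm (v (Suc k)))\<^sup>2 + \<bar>\<beta> (Suc k)\<bar> * (- c * (v k \<bullet> d k)))"
      using N by (intro mult_left_mono) auto
    also have "\<dots> = N * (norm (v (Suc k)))\<^sup>2 + c * (\<bar>\<beta> (Suc k)\<bar> * (N * (- (v k \<bullet> d k))))"
      by (simp add: algebra_simps)
    also have "\<dots> \<le> N * (norm (v (Suc k)))\<^sup>2 + c * (\<bar>\<beta> (Suc k)\<bar> * ((norm (v k))\<^sup>2 * z k))"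
      using Suc c by (intro add_left_mono mult_left_mono) auto
    also have "\<dots> = N * (norm (v (Suc k)))\<^sup>2 + c * ((\<bar>\<beta> (Suc k)\<bar> * (norm (v k))\<^sup>2) * z k)"
      by (simp add: algebra_simps)
    also have "\<dots> \<le> N * (norm (v (Suc k)))\<^sup>2 + c * ((norm (v (Suc k)))\<^sup>2 * z k)"
      using beta_v[of k] Suc.prems c znn by (intro add_left_mono mult_left_mono mult_right_mono) auto
    also have "\<dots> = (norm (v (Suc k)))\<^sup>2 * z (Suc k)" by (simp add: z algebra_simps)
    finally show ?case .
  qed
  define A where "A k = (\<beta> k)\<^sup>2 * (norm (d (k - 1)))\<^sup>2" for k
  have A_Suc: "A (Suc (Suc k)) \<le> b\<^sup>2 * (b ^ Suc k * (N + 2 * c * z k) + A (Suc k))" if "Suc k \<le> m" for k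
  proof (cases "N = 0")
    case True
    hence "v (Suc k) = 0" using vk[of "Suc k"] that by simp
    hence "\<beta> (Suc (Suc k)) = 0" using beta[of "Suc (Suc k)"] that by simp
    thus ?thesis using b c N znn[of k] by (simp add: A_def)
  next
    case False
    hence Npos: "0 < N" using N by simp
    have "(norm (d (Suc k)))\<^sup>2 = (norm (v (Suc k)))\<^sup>2 - 2 * (\<beta> (Suc k) * (v (Suc k) \<bullet> d k)) + A (Suc k)"
    proof -
      have "d (Suc k) = \<beta> (Suc k) *\<^sub>R d k - v (Suc k)" using d[of "Suc k"] that by simp
      thus ?thesis
        unfolding A_def by (simp add: power2_norm_eq_inner inner_diff_left inner_diff_right inner_commute)
          (simp add: power2_eq_square)
    qed
    also have "\<dots> \<le> (norm (v (Suc k)))\<^sup>2 + 2 * (\<bar>\<beta> (Suc k)\<bar> * \<bar>v (Suc k) \<bullet> d k\<bar>) + A (Suc k)"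
      by (simp add: abs_mult[symmetric])
    also have "\<dots> \<le> (norm (v (Suc k)))\<^sup>2 + 2 * (\<bar>\<beta> (Suc k)\<bar> * (- c * (v k \<bullet> d k))) + A (Suc k)"
      using wolfe[of k] that by (intro add_mono mult_left_mono) auto
    finally have "N * (norm (d (Suc k)))\<^sup>2
        \<le> N * ((norm (v (Suc k)))\<^sup>2 + 2 * (\<bar>\<beta> (Suc k)\<bar> * (- c * (v k \<bullet> d k))) + A (Suc k))"
      using N by (intro mult_left_mono) auto
    also have "\<dots> = N * ((norm (v (Suc k)))\<^sup>2 + A (Suc k)) + 2 * c * (\<bar>\<beta> (Suc k)\<bar> * (N * (- (v k \<bullet> d k))))"
      by (simp add: algebra_simps)
    also have "\<dots> \<le> N * ((norm (v (Suc k)))\<^sup>2 + A (Suc k)) + 2 * c * (\<bar>\<beta> (Suc k)\<bar> * ((norm (v k))\<^sup>2 * z k))"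
      using slope[of k] that c by (intro add_left_mono mult_left_mono) auto
    also have "\<dots> = N * ((norm (v (Suc k)))\<^sup>2 + A (Suc k)) + 2 * c * ((\<bar>\<beta> (Suc k)\<bar> * (norm (v k))\<^sup>2) * z k)"
      by (simp add: algebra_simps)
    also have "\<dots> \<le> N * ((norm (v (Suc k)))\<^sup>2 + A (Suc k)) + 2 * c * ((norm (v (Suc k)))\<^sup>2 * z k)"
      using beta_v[of k] that c znn by (intro add_left_mono mult_left_mono mult_right_mono) auto
    also have "\<dots> = (norm (v (Suc k)))\<^sup>2 * (N + 2 * c * z k) + N * A (Suc k)"
      by (simp add: algebra_simps)
    also have "\<dots> \<le> (b ^ Suc k * N) * (N + 2 * c * z k) + N * A (Suc k)"
      using vk[of "Suc k"] that N c znn[of k] by (intro add_right_mono mult_right_mono) auto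
    also have "\<dots> = N * (b ^ Suc k * (N + 2 * c * z k) + A (Suc k))" by (simp add: algebra_simps)
    finally have "(norm (d (Suc k)))\<^sup>2 \<le> b ^ Suc k * (N + 2 * c * z k) + A (Suc k)"
      using Npos by (simp only: mult_le_cancel_left_pos)
    hence "(\<beta> (Suc (Suc k)))\<^sup>2 * (norm (d (Suc k)))\<^sup>2
        \<le> b\<^sup>2 * (b ^ Suc k * (N + 2 * c * z k) + A (Suc k))"
      using beta_b2[of "Suc k"] that by (intro mult_mono) auto
    thus ?thesis by (simp add: A_def)
  qed
  have \<Phi>: "\<Phi> = 1 + 2 * c * P" "\<Phi> = 2 * P - 1" using c by (auto simp: \<Phi>_def P_def field_simps)
  have g: "N + 2 * c * z k = \<Phi> * N + c ^ Suc k * (2 * r - 2 * P * N)" for k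
    unfolding z_def by (simp add: \<Phi>(1) algebra_simps)
  have A_le: "A k \<le> b ^ (2 * k) * H + \<Phi> * N * damped_sum 1 b k + (2 * r - 2 * P * N) * damped_sum c b k"
    if "1 \<le> k" "k \<le> m" for k
    using that
  proof (induction k rule: dec_induct)
    case base
    show ?case using beta_b2[of 0] by (simp add: A_def H_def mult_right_mono)
  next
    case (step k)
    obtain i where i: "k = Suc i" using step.hyps by (cases k) auto
    have "A (Suc k) \<le> b\<^sup>2 * (b ^ k * (N + 2 * c * z i) + A k)" using A_Suc[of i] step.prems by (simp add: i)
    also have "\<dots> \<le> b\<^sup>2 * (b ^ k * (N + 2 * c * z i) + (b ^ (2 * k) * H + \<Phi> * N * damped_sum 1 b k
        + (2 * r - 2 * P * N) * damped_sum c b k))"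
      using step by (intro mult_left_mono add_left_mono) auto
    also have "\<dots> = b ^ (2 * Suc k) * H + \<Phi> * N * damped_sum 1 b (Suc k)
        + (2 * r - 2 * P * N) * damped_sum c b (Suc k)"
      unfolding g damped_sum_Suc[OF step.hyps(1)] i[symmetric]
      by (simp add: power2_eq_square algebra_simps)
    finally show ?case .
  qed
  \<comment> \<open>the parameter \<open>s\<close> splits the initial slope between the two norms\<close>
  have rs: "2 * r \<le> s * N + H / s"
  proof -
    have "0 \<le> (norm (d 0 + s *\<^sub>R v 0))\<^sup>2" by simp
    also have "\<dots> = s\<^sup>2 * N - 2 * (s * r) + H"
      unfolding norm_add_scaleR_squared by (simp add: N_def H_def r_def inner_commute)
    finally have "s * (2 * r) \<le> s * (s * N + H / s)"
      using s by (simp add: power2_eq_square algebra_simps)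
    thus ?thesis using s by (simp only: mult_le_cancel_left_pos)
  qed
  define \<Delta> where "\<Delta> = \<bar>H - N\<bar>"
  have H: "H \<le> N + \<Delta>" "0 \<le> \<Delta>" by (auto simp: \<Delta>_def)
  have Hs: "H / s \<le> N + \<Delta> / s"
  proof -
    have "H / s \<le> (N + \<Delta>) / s" using H s by (intro divide_right_mono) auto
    also have "\<dots> = N / s + \<Delta> / s" by (rule add_divide_distrib)
    also have "N / s \<le> N" using s N mult_left_mono[of 1 s N] by (simp add: pos_divide_le_eq)
    finally show ?thesis by simp
  qed
  have "2 * r - 2 * P * N \<le> (s - \<Phi>) * N + \<Delta> / s"
    using rs Hs by (simp add: \<Phi>(2) algebra_simps)
  hence "(2 * r - 2 * P * N) * damped_sum c b k \<le> ((s - \<Phi>) * N + \<Delta> / s) * damped_sum c b k"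
    using b c by (intro mult_right_mono damped_sum_nonneg) auto
  moreover have "b ^ (2 * k) * H \<le> b ^ (2 * k) * (N + \<Delta>)" using H b by (intro mult_left_mono) auto
  ultimately have "A k \<le> b ^ (2 * k) * (N + \<Delta>) + \<Phi> * N * damped_sum 1 b k
      + ((s - \<Phi>) * N + \<Delta> / s) * damped_sum c b k"
    using A_le[of k] k by simp
  also have "\<dots> = (b ^ (2 * k) + \<Phi> * damped_sum 1 b k + (s - \<Phi>) * damped_sum c b k) * N
      + (b ^ (2 * k) + damped_sum c b k / s) * \<Delta>"
    by (simp add: algebra_simps)
  finally show ?thesis by (simp add: A_def N_def H_def \<Delta>_def)
qed

section \<open>Sampling batches without replacement\<close>

definition batches :: "nat \<Rightarrow> nat \<Rightarrow> nat set set" where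
  "batches n b = {J. J \<subseteq> {1..n} \<and> card J = b}"

lemma finite_batches: "finite (batches n b)"
  by (simp add: batches_def)

lemma card_batches: "card (batches n b) = n choose b"
  by (simp add: batches_def n_subsets)

lemma card_batches_containing:
  assumes T: "T \<subseteq> {1..n}" and b: "card T \<le> b"
  shows "card {J \<in> batches n b. T \<subseteq> J} = (n - card T) choose (b - card T)"
proof -
  have fT: "finite T" using T finite_subset by blast
  have "bij_betw (\<lambda>J. J - T) {J \<in> batches n b. T \<subseteq> J} {K. K \<subseteq> {1..n} - T \<and> card K = b - card T}"
  proof (rule bij_betwI[where g = "\<lambda>K. K \<union> T"])
    show "(\<lambda>J. J - T) \<in> {J \<in> batches n b. T \<subseteq> J} \<rightarrow> {K. K \<subseteq> {1..n} - T \<and> card K = b - card T}"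
      using fT by (auto simp: batches_def card_Diff_subset)
    show "(\<lambda>K. K \<union> T) \<in> {K. K \<subseteq> {1..n} - T \<and> card K = b - card T} \<rightarrow> {J \<in> batches n b. T \<subseteq> J}"
    proof
      fix K assume K: "K \<in> {K. K \<subseteq> {1..n} - T \<and> card K = b - card T}"
      hence "finite K" using finite_subset[of K "{1..n}"] by auto
      moreover have "K \<inter> T = {}" using K by auto
      ultimately have "card (K \<union> T) = b" using K fT b by (simp add: card_Un_disjoint)
      thus "K \<union> T \<in> {J \<in> batches n b. T \<subseteq> J}" using K T by (auto simp: batches_def)
    qed
  qed auto
  hence "card {J \<in> batches n b. T \<subseteq> J} = card {K. K \<subseteq> {1..n} - T \<and> card K = b - card T}"
    by (rule bij_betw_same_card)
  also have "\<dots> = (n - card T) choose (b - card T)"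
    using fT T by (simp add: n_subsets card_Diff_subset)
  finally show ?thesis .
qed

lemma card_batches_one:
  assumes "i \<in> {1..n}" "1 \<le> b"
  shows "real n * real (card {J \<in> batches n b. i \<in> J}) = real b * real (card (batches n b))"
proof -
  have "card {J \<in> batches n b. i \<in> J} = (n - 1) choose (b - 1)"
    using card_batches_containing[of "{i}" n b] assms by simp
  thus ?thesis using times_binomial_minus1_eq[of b n] assms
    by (simp add: card_batches flip: of_nat_mult)
qed

lemma card_batches_two:
  assumes "i \<in> {1..n}" "j \<in> {1..n}" "i \<noteq> j" "1 \<le> b"
  shows "(real n - 1) * real (card {J \<in> batches n b. i \<in> J \<and> j \<in> J})
    = (real b - 1) * real (card {J \<in> batches n b. i \<in> J})"
proof (cases "b = 1")
  case True
  have "\<not> (i \<in> J \<and> j \<in> J)" if "J \<in> batches n b" for J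
  proof
    assume "i \<in> J \<and> j \<in> J"
    hence "{i, j} \<subseteq> J" by simp
    moreover have "finite J" using that finite_subset[of J "{1..n}"] by (auto simp: batches_def)
    ultimately have "card {i, j} \<le> card J" by (intro card_mono) auto
    thus False using that True assms(3) by (simp add: batches_def)
  qed
  hence e: "{J \<in> batches n b. i \<in> J \<and> j \<in> J} = {}" by blast
  show ?thesis unfolding e using True by simp
next
  case False
  have 1: "card {J \<in> batches n b. i \<in> J} = (n - 1) choose (b - 1)"
    using card_batches_containing[of "{i}" n b] assms by simp
  have "card {J \<in> batches n b. {i, j} \<subseteq> J} = (n - 2) choose (b - 2)"
    using card_batches_containing[of "{i, j}" n b] assms False by (simp add: numeral_2_eq_2)
  moreover have "n - 2 = n - 1 - 1" "b - 2 = b - 1 - 1" by auto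
  ultimately have 2: "card {J \<in> batches n b. i \<in> J \<and> j \<in> J} = (n - 1 - 1) choose (b - 1 - 1)"
    by simp
  have "(b - 1) * ((n - 1) choose (b - 1)) = (n - 1) * ((n - 1 - 1) choose (b - 1 - 1))"
    using times_binomial_minus1_eq[of "b - 1" "n - 1"] assms False by simp
  hence "real (b - 1) * real ((n - 1) choose (b - 1)) = real (n - 1) * real ((n - 1 - 1) choose (b - 1 - 1))"
    by (metis of_nat_mult)
  thus ?thesis unfolding 1 2 using assms by (simp add: of_nat_diff)
qed

lemma sum_batches_members:
  fixes a :: "nat \<Rightarrow> 'a::real_vector"
  assumes "1 \<le> b"
  shows "(\<Sum>J\<in>batches n b. \<Sum>i\<in>J. a i)
    = (real b * real (card (batches n b)) / real n) *\<^sub>R (\<Sum>i\<in>{1..n}. a i)"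
proof -
  have "(\<Sum>J\<in>batches n b. \<Sum>i\<in>J. a i) = (\<Sum>J\<in>batches n b. \<Sum>i\<in>{i\<in>{1..n}. i \<in> J}. a i)"
    by (intro sum.cong refl) (auto simp: batches_def)
  also have "\<dots> = (\<Sum>i\<in>{1..n}. \<Sum>J\<in>{J\<in>batches n b. i \<in> J}. a i)"
    by (rule sum.swap_restrict) (auto simp: finite_batches)
  also have "\<dots> = (\<Sum>i\<in>{1..n}. real (card {J\<in>batches n b. i \<in> J}) *\<^sub>R a i)"
    by (simp add: sum_constant_scaleR)
  also have "\<dots> = (\<Sum>i\<in>{1..n}. (real b * real (card (batches n b)) / real n) *\<^sub>R a i)"
  proof (intro sum.cong refl)
    fix i assume i: "i \<in> {1..n}"
    have "real (card {J\<in>batches n b. i \<in> J}) = real b * real (card (batches n b)) / real n"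
      using card_batches_one[OF i assms] i by (simp add: field_simps)
    thus "real (card {J\<in>batches n b. i \<in> J}) *\<^sub>R a i = (real b * real (card (batches n b)) / real n) *\<^sub>R a i"
      by simp
  qed
  finally show ?thesis by (simp add: scaleR_sum_right)
qed

text \<open>Every pair of distinct indices lies in the same number of batches, so the cross terms are a multiple of the
squared norm of the total sum, which vanishes, minus the diagonal part of that square.\<close>

lemma sum_batches_norm_squared_centred:
  fixes c :: "nat \<Rightarrow> 'a::real_inner"
  assumes b: "1 \<le> b" "b \<le> n" and c: "(\<Sum>i\<in>{1..n}. c i) = 0"
  shows "(\<Sum>J\<in>batches n b. (norm (\<Sum>i\<in>J. c i))\<^sup>2)
    = real (card (batches n b)) * (real b * (real n - real b) / (real n * (real n - 1)))
      * (\<Sum>i\<in>{1..n}. (norm (c i))\<^sup>2)"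
proof (cases "n = 1")
  case True
  hence "batches n b = {{1}}" using b by (auto simp: batches_def card_1_singleton_iff)
  thus ?thesis using c True by simp
next
  case False
  hence n: "2 \<le> n" using b by simp
  let ?A = "{1..n}"
  define N1 where "N1 = real b * real (card (batches n b)) / real n"
  define N2 where "N2 = (real b - 1) * N1 / (real n - 1)"
  have count: "real (card {J\<in>batches n b. i \<in> J \<and> j \<in> J}) = (if i = j then N1 else N2)"
    if "i \<in> ?A" "j \<in> ?A" for i j
  proof -
    have 1: "real (card {J\<in>batches n b. i \<in> J}) = N1"
      using card_batches_one[OF that(1) b(1)] n by (simp add: N1_def field_simps)
    show ?thesis
    proof (cases "i = j")
      case False
      have "(real n - 1) * real (card {J \<in> batches n b. i \<in> J \<and> j \<in> J}) = (real b - 1) * N1"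
        using card_batches_two[OF that False b(1)] unfolding 1 .
      moreover have "real n - 1 \<noteq> 0" using n by simp
      ultimately have "real (card {J\<in>batches n b. i \<in> J \<and> j \<in> J}) = N2"
        unfolding N2_def by (metis nonzero_mult_div_cancel_left)
      thus ?thesis using False by simp
    qed (use 1 in simp)
  qed
  have "(\<Sum>J\<in>batches n b. (norm (\<Sum>i\<in>J. c i))\<^sup>2) = (\<Sum>J\<in>batches n b. \<Sum>(i, j)\<in>J \<times> J. c i \<bullet> c j)"
    by (simp add: power2_norm_eq_inner inner_sum_left inner_sum_right sum.cartesian_product inner_commute)
  also have "\<dots> = (\<Sum>J\<in>batches n b. \<Sum>z\<in>{z\<in>?A \<times> ?A. fst z \<in> J \<and> snd z \<in> J}. c (fst z) \<bullet> c (snd z))"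
    by (intro sum.cong refl) (auto simp: batches_def split: prod.splits)
  also have "\<dots> = (\<Sum>z\<in>?A \<times> ?A. \<Sum>J\<in>{J\<in>batches n b. fst z \<in> J \<and> snd z \<in> J}. c (fst z) \<bullet> c (snd z))"
    by (rule sum.swap_restrict) (auto simp: finite_batches)
  also have "\<dots> = (\<Sum>z\<in>?A \<times> ?A. (if fst z = snd z then N1 else N2) * (c (fst z) \<bullet> c (snd z)))"
  proof (intro sum.cong refl)
    fix z assume "z \<in> ?A \<times> ?A"
    hence z: "fst z \<in> ?A" "snd z \<in> ?A" by auto
    show "(\<Sum>J\<in>{J\<in>batches n b. fst z \<in> J \<and> snd z \<in> J}. c (fst z) \<bullet> c (snd z))
        = (if fst z = snd z then N1 else N2) * (c (fst z) \<bullet> c (snd z))"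
      unfolding sum_constant count[OF z] ..
  qed
  also have "\<dots> = (\<Sum>i\<in>?A. \<Sum>j\<in>?A. N2 * (c i \<bullet> c j) + (if i = j then (N1 - N2) * (c i \<bullet> c j) else 0))"
    unfolding sum.cartesian_product by (intro sum.cong refl) (auto simp: algebra_simps)
  also have "\<dots> = (\<Sum>i\<in>?A. \<Sum>j\<in>?A. N2 * (c i \<bullet> c j)) + (\<Sum>i\<in>?A. (N1 - N2) * (c i \<bullet> c i))"
    by (simp add: sum.distrib)
  also have "(\<Sum>i\<in>?A. \<Sum>j\<in>?A. N2 * (c i \<bullet> c j)) = N2 * ((\<Sum>i\<in>?A. c i) \<bullet> (\<Sum>j\<in>?A. c j))"
    by (subst sum.swap) (simp only: inner_sum_left inner_sum_right sum_distrib_left)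
  also have "\<dots> = 0" by (simp only: c inner_zero_left mult_zero_right)
  finally have "(\<Sum>J\<in>batches n b. (norm (\<Sum>i\<in>J. c i))\<^sup>2) = (N1 - N2) * (\<Sum>i\<in>?A. (norm (c i))\<^sup>2)"
    by (simp add: sum_distrib_left power2_norm_eq_inner)
  also have "N1 - N2 = real (card (batches n b)) * (real b * (real n - real b) / (real n * (real n - 1)))"
  proof -
    have "real n \<noteq> 0" "real n - 1 \<noteq> 0" using n by auto
    thus ?thesis unfolding N2_def N1_def by (simp add: divide_simps) (simp add: algebra_simps)
  qed
  finally show ?thesis .
qed

text \<open>The variance of sampling without replacement. The offset \<open>e\<close> stands for the error inherited from the
past: the deviation of the batch mean is centred, hence orthogonal to it on average.\<close>

lemma batch_deviation_le:
  fixes a :: "nat \<Rightarrow> 'a::real_inner"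
  assumes b: "1 \<le> b" "b \<le> n"
  defines "mean \<equiv> (1 / real n) *\<^sub>R (\<Sum>i\<in>{1..n}. a i)"
  shows "(\<Sum>J\<in>batches n b. (norm (e + ((1 / real b) *\<^sub>R (\<Sum>i\<in>J. a i) - mean)))\<^sup>2)
    \<le> real (card (batches n b)) * ((norm e)\<^sup>2 + (real n - real b) / (real b * (real n - 1))
        * ((\<Sum>i\<in>{1..n}. (norm (a i))\<^sup>2) / real n))"
proof -
  let ?A = "{1..n}"
  define c where "c i = a i - mean" for i
  define N where "N = real (card (batches n b))"
  have n: "0 < real n" using b by simp
  have c0: "(\<Sum>i\<in>?A. c i) = 0"
    using n by (simp add: c_def sum_subtractf mean_def sum_constant_scaleR)
  have dev: "(1 / real b) *\<^sub>R (\<Sum>i\<in>J. a i) - mean = (1 / real b) *\<^sub>R (\<Sum>i\<in>J. c i)" if "J \<in> batches n b" for J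
  proof -
    have "card J = b" using that by (simp add: batches_def)
    thus ?thesis using b by (simp add: c_def sum_subtractf sum_constant_scaleR scaleR_diff_right)
  qed
  have zero: "(\<Sum>J\<in>batches n b. e \<bullet> (\<Sum>i\<in>J. c i)) = 0"
    using sum_batches_members[OF b(1), of c n] c0 by (simp flip: inner_sum_right)
  have "(\<Sum>J\<in>batches n b. (norm (e + ((1 / real b) *\<^sub>R (\<Sum>i\<in>J. a i) - mean)))\<^sup>2)
      = (\<Sum>J\<in>batches n b. (norm e)\<^sup>2 + 2 / real b * (e \<bullet> (\<Sum>i\<in>J. c i)) + (1 / real b)\<^sup>2 * (norm (\<Sum>i\<in>J. c i))\<^sup>2)"
  proof (intro sum.cong refl)
    fix J assume J: "J \<in> batches n b"
    have "(norm (e + (1 / real b) *\<^sub>R s))\<^sup>2 = (norm e)\<^sup>2 + 2 / real b * (e \<bullet> s) + (1 / real b)\<^sup>2 * (norm s)\<^sup>2" for s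
      unfolding norm_add_scaleR_squared by simp
    thus "(norm (e + ((1 / real b) *\<^sub>R (\<Sum>i\<in>J. a i) - mean)))\<^sup>2
        = (norm e)\<^sup>2 + 2 / real b * (e \<bullet> (\<Sum>i\<in>J. c i)) + (1 / real b)\<^sup>2 * (norm (\<Sum>i\<in>J. c i))\<^sup>2"
      unfolding dev[OF J] .
  qed
  also have "\<dots> = N * (norm e)\<^sup>2 + 2 / real b * (\<Sum>J\<in>batches n b. e \<bullet> (\<Sum>i\<in>J. c i))
      + (1 / real b)\<^sup>2 * (\<Sum>J\<in>batches n b. (norm (\<Sum>i\<in>J. c i))\<^sup>2)"
    by (simp add: sum.distrib sum_distrib_left N_def)
  also have "\<dots> = N * (norm e)\<^sup>2 + (1 / real b)\<^sup>2 * (N * (real b * (real n - real b) / (real n * (real n - 1)))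
      * (\<Sum>i\<in>?A. (norm (c i))\<^sup>2))"
    unfolding zero sum_batches_norm_squared_centred[OF b c0] N_def by simp
  also have "\<dots> = N * ((norm e)\<^sup>2 + (real n - real b) / (real b * (real n - 1))
        * ((\<Sum>i\<in>?A. (norm (c i))\<^sup>2) / real n))"
    using b by (simp add: distrib_left power2_eq_square)
  also have "\<dots> \<le> N * ((norm e)\<^sup>2 + (real n - real b) / (real b * (real n - 1))
        * ((\<Sum>i\<in>?A. (norm (a i))\<^sup>2) / real n))"
  proof -
    have "(\<Sum>i\<in>?A. (norm (c i))\<^sup>2) = (\<Sum>i\<in>?A. (norm (a i))\<^sup>2 - 2 * (mean \<bullet> a i) + (norm mean)\<^sup>2)"
      by (intro sum.cong refl)
         (simp add: c_def power2_norm_eq_inner inner_diff_left inner_diff_right inner_commute)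
    also have "\<dots> = (\<Sum>i\<in>?A. (norm (a i))\<^sup>2) - 2 * (mean \<bullet> (\<Sum>i\<in>?A. a i)) + real n * (norm mean)\<^sup>2"
      by (simp add: sum.distrib sum_subtractf inner_sum_right sum_distrib_left)
    also have "(\<Sum>i\<in>?A. a i) = real n *\<^sub>R mean" using n by (simp add: mean_def)
    also have "(\<Sum>i\<in>?A. (norm (a i))\<^sup>2) - 2 * (mean \<bullet> (real n *\<^sub>R mean)) + real n * (norm mean)\<^sup>2
        \<le> (\<Sum>i\<in>?A. (norm (a i))\<^sup>2)"
      using n by (simp add: power2_norm_eq_inner)
    finally have "(\<Sum>i\<in>?A. (norm (c i))\<^sup>2) / real n \<le> (\<Sum>i\<in>?A. (norm (a i))\<^sup>2) / real n"
      by (intro divide_right_mono) auto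
    moreover have "0 \<le> (real n - real b) / (real b * (real n - 1))" using b by simp
    ultimately show ?thesis by (intro mult_left_mono add_left_mono) (auto simp: N_def)
  qed
  finally show ?thesis by (simp add: N_def)
qed

text \<open>The two densities \<open>indicator S\<close> and \<open>p\<close> define measures that agree on \<open>F\<close>, hence have the same
integrals of \<open>F\<close>-measurable functions.\<close>

lemma nn_integral_independent_event:
  assumes M: "finite_measure M" and F: "subalgebra M F" and S: "S \<in> sets M" and p: "0 \<le> p"
    and ind: "\<And>A. A \<in> sets F \<Longrightarrow> measure M (S \<inter> A) = p * measure M A"
    and g[measurable]: "g \<in> borel_measurable F"
  shows "(\<integral>\<^sup>+\<omega>. indicator S \<omega> * g \<omega> \<partial>M) = ennreal p * (\<integral>\<^sup>+\<omega>. g \<omega> \<partial>M)"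
proof -
  interpret finite_measure M by fact
  define M1 where "M1 = density M (indicator S)"
  define M2 where "M2 = density M (\<lambda>_. ennreal p)"
  have gM[measurable]: "g \<in> borel_measurable M" using F g by (rule measurable_from_subalg)
  have sub: "subalgebra M1 F" "subalgebra M2 F"
    using F by (auto simp: M1_def M2_def subalgebra_def)
  have "restr_to_subalg M1 F = restr_to_subalg M2 F"
  proof (rule measure_eqI)
    fix A assume "A \<in> sets (restr_to_subalg M1 F)"
    hence A: "A \<in> sets F" using sub by (simp add: sets_restr_to_subalg)
    hence AM: "A \<in> sets M" using F by (auto simp: subalgebra_def)
    have "emeasure M1 A = emeasure M (S \<inter> A)"
      unfolding M1_def using S AM
      by (subst emeasure_density) (auto simp: nn_integral_indicator[symmetric] indicator_inter_arith simp del: nn_integral_indicator)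
    also have "\<dots> = ennreal p * emeasure M A"
      using ind[OF A] p by (simp add: emeasure_eq_measure ennreal_mult)
    also have "\<dots> = emeasure M2 A"
      unfolding M2_def using AM by (subst emeasure_density) (auto simp: nn_integral_cmult)
    finally show "emeasure (restr_to_subalg M1 F) A = emeasure (restr_to_subalg M2 F) A"
      using A sub by (simp add: emeasure_restr_to_subalg)
  qed (use sub in \<open>simp add: sets_restr_to_subalg\<close>)
  hence "(\<integral>\<^sup>+\<omega>. g \<omega> \<partial>M1) = (\<integral>\<^sup>+\<omega>. g \<omega> \<partial>M2)"
    using nn_integral_subalgebra2[OF sub(1) g] nn_integral_subalgebra2[OF sub(2) g] by simp
  moreover have "(\<integral>\<^sup>+\<omega>. g \<omega> \<partial>M1) = (\<integral>\<^sup>+\<omega>. indicator S \<omega> * g \<omega> \<partial>M)"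
    unfolding M1_def using S by (intro nn_integral_density) auto
  moreover have "(\<integral>\<^sup>+\<omega>. g \<omega> \<partial>M2) = ennreal p * (\<integral>\<^sup>+\<omega>. g \<omega> \<partial>M)"
    unfolding M2_def by (subst nn_integral_density) (auto simp: nn_integral_cmult)
  ultimately show ?thesis by simp
qed

lemma nn_integral_uniform_batch:
  assumes M: "prob_space M" and F: "subalgebra M F" and b: "1 \<le> b" "b \<le> n"
    and B: "B \<in> measurable M (count_space (Pow {1..n}))"
    and unif: "\<And>A I. A \<in> sets F \<Longrightarrow> measure M ({\<omega>\<in>space M. B \<omega> = I} \<inter> A)
          = pmf (pmf_of_set {J. J \<subseteq> {1..n} \<and> card J = b}) I * measure M A"
    and g: "\<And>I. I \<subseteq> {1..n} \<Longrightarrow> g I \<in> borel_measurable F"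
  shows "(\<integral>\<^sup>+\<omega>. g (B \<omega>) \<omega> \<partial>M)
    = (\<integral>\<^sup>+\<omega>. (\<Sum>I\<in>batches n b. ennreal (1 / real (card (batches n b))) * g I \<omega>) \<partial>M)"
proof -
  interpret prob_space M by fact
  have ne: "batches n b \<noteq> {}"
  proof -
    have "card (batches n b) > 0" using b by (simp add: card_batches)
    thus ?thesis by auto
  qed
  define S where "S I = {\<omega>\<in>space M. B \<omega> = I}" for I
  have S: "S I \<in> sets M" if "I \<subseteq> {1..n}" for I
  proof -
    have "S I = B -` {I} \<inter> space M" by (auto simp: S_def)
    thus ?thesis using measurable_sets[OF B, of "{I}"] that by simp
  qed
  have gM: "g I \<in> borel_measurable M" if "I \<subseteq> {1..n}" for I
    using F g[OF that] by (rule measurable_from_subalg)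
  have p: "pmf (pmf_of_set {J. J \<subseteq> {1..n} \<and> card J = b}) I = indicator (batches n b) I / real (card (batches n b))" for I
    using ne finite_batches unfolding batches_def by (subst pmf_of_set) auto
  have "(\<integral>\<^sup>+\<omega>. g (B \<omega>) \<omega> \<partial>M) = (\<integral>\<^sup>+\<omega>. (\<Sum>I\<in>Pow {1..n}. indicator (S I) \<omega> * g I \<omega>) \<partial>M)"
  proof (rule nn_integral_cong)
    fix \<omega> assume \<omega>: "\<omega> \<in> space M"
    hence "B \<omega> \<in> Pow {1..n}" using measurable_space[OF B] by simp
    hence "(\<Sum>I\<in>Pow {1..n}. indicator (S I) \<omega> * g I \<omega>) = (\<Sum>I\<in>{B \<omega>}. indicator (S I) \<omega> * g I \<omega>)"
      by (intro sum.mono_neutral_right) (auto simp: S_def indicator_def)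
    thus "g (B \<omega>) \<omega> = (\<Sum>I\<in>Pow {1..n}. indicator (S I) \<omega> * g I \<omega>)" using \<omega> by (simp add: S_def)
  qed
  also have "\<dots> = (\<Sum>I\<in>Pow {1..n}. \<integral>\<^sup>+\<omega>. indicator (S I) \<omega> * g I \<omega> \<partial>M)"
    using gM S by (intro nn_integral_sum borel_measurable_times borel_measurable_indicator) auto
  also have "\<dots> = (\<Sum>I\<in>Pow {1..n}. ennreal (indicator (batches n b) I / real (card (batches n b))) * (\<integral>\<^sup>+\<omega>. g I \<omega> \<partial>M))"
  proof (intro sum.cong refl)
    fix I assume I: "I \<in> Pow {1..n}"
    show "(\<integral>\<^sup>+\<omega>. indicator (S I) \<omega> * g I \<omega> \<partial>M)
        = ennreal (indicator (batches n b) I / real (card (batches n b))) * (\<integral>\<^sup>+\<omega>. g I \<omega> \<partial>M)"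
      by (rule nn_integral_independent_event[OF finite_measure_axioms F])
         (use I S g unif[unfolded p] in \<open>auto simp: S_def\<close>)
  qed
  also have "\<dots> = (\<Sum>I\<in>batches n b. ennreal (1 / real (card (batches n b))) * (\<integral>\<^sup>+\<omega>. g I \<omega> \<partial>M))"
    by (rule sum.mono_neutral_cong_right) (auto simp: batches_def)
  also have "\<dots> = (\<integral>\<^sup>+\<omega>. (\<Sum>I\<in>batches n b. ennreal (1 / real (card (batches n b))) * g I \<omega>) \<partial>M)"
    using gM by (subst nn_integral_sum) (auto simp: batches_def nn_integral_cmult intro!: borel_measurable_times)
  finally show ?thesis .
qed

section \<open>One epoch along a sample path\<close>

text \<open>The bound on the weighted sum of the direction errors of an epoch, up to a common factor. The
arguments \<open>N\<close>, \<open>\<Delta>\<close>, \<open>E\<close> stand for the expectations of the squared gradient at the start, of the absolute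
difference between the squared norms of the initial direction and that gradient, and of the squared norm of
their sum.\<close>

definition epoch_error :: "real \<Rightarrow> real \<Rightarrow> real \<Rightarrow> real \<Rightarrow> real \<Rightarrow> real" where
  "epoch_error \<Phi> \<beta> N \<Delta> E = \<Phi> * \<beta>\<^sup>2 / ((1 - \<beta>)\<^sup>2 * (1 + \<beta>)) * N + \<beta>\<^sup>2 / (1 - \<beta>\<^sup>2) * \<Delta> + 1/2 * E"

text \<open>One epoch of either algorithm. The initial direction is arbitrary; \<open>K\<close> bounds the data of the epoch at
its start, which the preceding epoch provides.\<close>

locale stochastic_epoch = dominant_problem f \<phi> n L wstar \<tau>\<^sub>o \<gamma> \<eta>\<^sub>1 \<eta>\<^sub>2 + prob_space M
  for f :: "nat \<Rightarrow> 'a::euclidean_space \<Rightarrow> real" and \<phi> n L wstar \<tau>\<^sub>o \<gamma> \<eta>\<^sub>1 \<eta>\<^sub>2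
    and M :: "'w measure" +
  fixes F :: "nat \<Rightarrow> 'w measure" and m b :: nat and c\<^sub>1 c\<^sub>2 \<beta>hat K :: real
    and B :: "nat \<Rightarrow> 'w \<Rightarrow> nat set" and \<beta> t :: "nat \<Rightarrow> 'w \<Rightarrow> real"
    and w v d :: "nat \<Rightarrow> 'w \<Rightarrow> 'a"
  assumes m: "1 \<le> m" and b: "1 \<le> b" "b \<le> n"
    and c\<^sub>2: "0 < c\<^sub>2" "c\<^sub>2 < 1" and \<beta>hat: "0 < \<beta>hat" "\<beta>hat < 1"
    and F: "\<And>k. k \<le> m + 2 \<Longrightarrow> subalgebra M (F k)"
    and F_mono: "\<And>k. k \<le> m + 1 \<Longrightarrow> sets (F k) \<subseteq> sets (F (k + 1))"
    and w_meas: "\<And>k. k \<le> m + 1 \<Longrightarrow> w k \<in> borel_measurable (F k)"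
    and B_meas: "\<And>k. k \<le> m + 1 \<Longrightarrow> B k \<in> measurable (F (k + 1)) (count_space (Pow {1..n}))"
    and v_meas: "\<And>k. k \<le> m + 1 \<Longrightarrow> v k \<in> borel_measurable (F (k + 1))"
    and d_meas: "\<And>k. k \<le> m + 1 \<Longrightarrow> d k \<in> borel_measurable (F (k + 1))"
    and \<beta>_meas: "\<And>k. k \<le> m + 1 \<Longrightarrow> \<beta> k \<in> borel_measurable (F (k + 1))"
    and uniform: "\<And>k A I. k \<in> {1..m+1} \<Longrightarrow> A \<in> sets (F k) \<Longrightarrow>
      measure M ({\<omega>\<in>space M. B k \<omega> = I} \<inter> A)
        = pmf (pmf_of_set {J. J \<subseteq> {1..n} \<and> card J = b}) I * measure M A"
    and epoch: "AE \<omega> in M. cg_epoch n f \<phi> m \<gamma> \<eta>\<^sub>2 c\<^sub>1 c\<^sub>2 (\<lambda>k. B k \<omega>) (\<lambda>k. \<beta> k \<omega>) (\<lambda>k. t k \<omega>)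
          (\<lambda>k. w k \<omega>) (\<lambda>k. v k \<omega>) (\<lambda>k. d k \<omega>)"
    and decrease: "AE \<omega> in M. \<forall>k\<le>m. (norm (v (k+1) \<omega>))\<^sup>2 \<le> \<beta>hat * (norm (v k \<omega>))\<^sup>2"
    and steps: "AE \<omega> in M. \<forall>k\<le>m. t k \<omega> \<in> {\<eta>\<^sub>1, \<eta>\<^sub>2}"
    and start: "AE \<omega> in M. bounded_start K (w 0 \<omega>) (d 0 \<omega>)"
    and params: "(2 + 4 * \<eta>\<^sub>2\<^sup>2) * ((real n - real b) / (real b * (real n - 1))) * L\<^sup>2 * \<gamma>\<^sup>2 * real m
                   \<le> 2 / \<eta>\<^sub>2 - L * \<gamma> - 3"
begin

text \<open>The sample paths on which all almost sure properties hold; estimates below are proved for each such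
path.\<close>

definition regular :: "'w \<Rightarrow> bool" where
  "regular \<omega> \<longleftrightarrow> cg_epoch n f \<phi> m \<gamma> \<eta>\<^sub>2 c\<^sub>1 c\<^sub>2 (\<lambda>k. B k \<omega>) (\<lambda>k. \<beta> k \<omega>) (\<lambda>k. t k \<omega>)
          (\<lambda>k. w k \<omega>) (\<lambda>k. v k \<omega>) (\<lambda>k. d k \<omega>) \<and>
     (\<forall>k\<le>m. (norm (v (k+1) \<omega>))\<^sup>2 \<le> \<beta>hat * (norm (v k \<omega>))\<^sup>2) \<and>
     (\<forall>k\<le>m. t k \<omega> \<in> {\<eta>\<^sub>1, \<eta>\<^sub>2}) \<and>
     bounded_start K (w 0 \<omega>) (d 0 \<omega>)"

lemma AE_regular: "AE \<omega> in M. regular \<omega>"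
  using epoch decrease steps start unfolding regular_def by eventually_elim auto

lemma regularD:
  assumes "regular \<omega>"
  shows "v 0 \<omega> = grad (w 0 \<omega>)"
    and "\<forall>k\<in>{1..m+1}. v k \<omega> = gradient (batch_fun f (B k \<omega>)) (w k \<omega>)
        - gradient (batch_fun f (B k \<omega>)) (w (k-1) \<omega>) + v (k-1) \<omega> \<and>
       \<bar>\<beta> k \<omega>\<bar> \<le> (norm (v k \<omega>))\<^sup>2 / (norm (v (k-1) \<omega>))\<^sup>2 \<and>
       d k \<omega> = - v k \<omega> + \<beta> k \<omega> *\<^sub>R d (k-1) \<omega>"
    and "\<forall>k\<le>m. line_search f c\<^sub>1 c\<^sub>2 (B k \<omega>) (t k \<omega>) (w k \<omega>) (d k \<omega>) (v k \<omega>) (v (k+1) \<omega>) \<and>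
       (let \<eta> = min (t k \<omega>) \<eta>\<^sub>2; y = prox \<eta> \<phi> (w k \<omega> + \<eta> *\<^sub>R d k \<omega>)
         in w (k+1) \<omega> = (1 - \<gamma>) *\<^sub>R w k \<omega> + \<gamma> *\<^sub>R y)"
    and "\<forall>k\<le>m. (norm (v (k+1) \<omega>))\<^sup>2 \<le> \<beta>hat * (norm (v k \<omega>))\<^sup>2"
    and "\<forall>k\<le>m. t k \<omega> \<in> {\<eta>\<^sub>1, \<eta>\<^sub>2}"
    and "\<phi> (w 0 \<omega>) \<noteq> \<infinity>" "norm (w 0 \<omega>) \<le> K" "norm (d 0 \<omega>) \<le> K" "gap (w 0 \<omega>) \<le> K"
  by (insert assms, unfold regular_def cg_epoch_def bounded_start_def) (elim conjE, assumption)+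

lemmas estimator_start = regularD(1)

lemma epoch_recursion:
  assumes "regular \<omega>" "k \<le> m"
  shows estimator_Suc: "v (Suc k) \<omega> = gradient (batch_fun f (B (Suc k) \<omega>)) (w (Suc k) \<omega>)
      - gradient (batch_fun f (B (Suc k) \<omega>)) (w k \<omega>) + v k \<omega>"
    and parameter_Suc: "\<bar>\<beta> (Suc k) \<omega>\<bar> \<le> (norm (v (Suc k) \<omega>))\<^sup>2 / (norm (v k \<omega>))\<^sup>2"
    and direction_Suc: "d (Suc k) \<omega> = - v (Suc k) \<omega> + \<beta> (Suc k) \<omega> *\<^sub>R d k \<omega>"
proof -
  have k: "Suc k \<in> {1..m+1}" using assms(2) by simp
  note r = bspec[OF regularD(2)[OF assms(1)] k, unfolded diff_Suc_1]
  show "v (Suc k) \<omega> = gradient (batch_fun f (B (Suc k) \<omega>)) (w (Suc k) \<omega>)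
      - gradient (batch_fun f (B (Suc k) \<omega>)) (w k \<omega>) + v k \<omega>"
    and "\<bar>\<beta> (Suc k) \<omega>\<bar> \<le> (norm (v (Suc k) \<omega>))\<^sup>2 / (norm (v k \<omega>))\<^sup>2"
    and "d (Suc k) \<omega> = - v (Suc k) \<omega> + \<beta> (Suc k) \<omega> *\<^sub>R d k \<omega>"
    by (insert r) (elim conjE, assumption)+
qed

lemma estimator_decrease:
  assumes "regular \<omega>" "k \<le> m"
  shows "(norm (v (Suc k) \<omega>))\<^sup>2 \<le> \<beta>hat * (norm (v k \<omega>))\<^sup>2"
  using regularD(4)[OF assms(1)] assms(2) by simp

lemma curvature_condition:
  assumes "regular \<omega>" "k \<le> m"
  shows "\<bar>v (Suc k) \<omega> \<bullet> d k \<omega>\<bar> \<le> - c\<^sub>2 * (v k \<omega> \<bullet> d k \<omega>)"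
  using regularD(3)[OF assms(1), rule_format, OF assms(2)] by (simp add: line_search_def)

lemma iterate_Suc:
  assumes "regular \<omega>" "k \<le> m"
  obtains \<eta> where "\<eta> \<in> {\<eta>\<^sub>1, \<eta>\<^sub>2}"
    "w (Suc k) \<omega> = (1 - \<gamma>) *\<^sub>R w k \<omega> + \<gamma> *\<^sub>R prox \<eta> \<phi> (w k \<omega> + \<eta> *\<^sub>R d k \<omega>)"
proof -
  have "t k \<omega> \<in> {\<eta>\<^sub>1, \<eta>\<^sub>2}" using regularD(5)[OF assms(1)] assms(2) by simp
  hence "min (t k \<omega>) \<eta>\<^sub>2 \<in> {\<eta>\<^sub>1, \<eta>\<^sub>2}" using \<eta>\<^sub>1 by auto
  moreover have "w (Suc k) \<omega> = (1 - \<gamma>) *\<^sub>R w k \<omega>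
      + \<gamma> *\<^sub>R prox (min (t k \<omega>) \<eta>\<^sub>2) \<phi> (w k \<omega> + min (t k \<omega>) \<eta>\<^sub>2 *\<^sub>R d k \<omega>)"
    using regularD(3)[OF assms(1), rule_format, OF assms(2)] by (simp add: Let_def)
  ultimately show thesis by (rule that)
qed

lemma iterate_finite:
  assumes "regular \<omega>" "k \<le> m + 1"
  shows "\<phi> (w k \<omega>) \<noteq> \<infinity>"
  using assms(2)
proof (induction k)
  case 0
  show ?case using assms(1) by (rule regularD)
next
  case (Suc k)
  then obtain \<eta> where "\<eta> \<in> {\<eta>\<^sub>1, \<eta>\<^sub>2}"
    "w (Suc k) \<omega> = (1 - \<gamma>) *\<^sub>R w k \<omega> + \<gamma> *\<^sub>R prox \<eta> \<phi> (w k \<omega> + \<eta> *\<^sub>R d k \<omega>)"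
    using iterate_Suc[OF assms(1), of k] by auto
  thus ?case using prox_step_finite[of "w k \<omega>" \<eta> \<gamma> "d k \<omega>"] Suc \<gamma> \<eta>\<^sub>1 by auto
qed

lemma gap_iterate_Suc:
  assumes "regular \<omega>" "k \<le> m"
  shows "gap (w (Suc k) \<omega>) \<le> (1 - rate) * gap (w k \<omega>)
      + \<gamma> / 4 * (1 + 2 * \<eta>\<^sub>2\<^sup>2) * (norm (grad (w k \<omega>) + d k \<omega>))\<^sup>2
      - \<gamma> / 2 * (2 / \<eta>\<^sub>2 - L * \<gamma> - 3) * ((norm (w (Suc k) \<omega> - w k \<omega>))\<^sup>2 / \<gamma>\<^sup>2)"
proof -
  obtain \<eta> where \<eta>: "\<eta> \<in> {\<eta>\<^sub>1, \<eta>\<^sub>2}"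
    and w: "w (Suc k) \<omega> = (1 - \<gamma>) *\<^sub>R w k \<omega> + \<gamma> *\<^sub>R prox \<eta> \<phi> (w k \<omega> + \<eta> *\<^sub>R d k \<omega>)"
    using iterate_Suc[OF assms] .
  have "w (Suc k) \<omega> - w k \<omega> = \<gamma> *\<^sub>R (prox \<eta> \<phi> (w k \<omega> + \<eta> *\<^sub>R d k \<omega>) - w k \<omega>)"
    unfolding w by (simp add: algebra_simps)
  hence "(norm (w (Suc k) \<omega> - w k \<omega>))\<^sup>2 / \<gamma>\<^sup>2 = (norm (prox \<eta> \<phi> (w k \<omega> + \<eta> *\<^sub>R d k \<omega>) - w k \<omega>))\<^sup>2"
    using \<gamma> by (simp add: power_mult_distrib)
  thus ?thesis
    using gap_step[OF iterate_finite[OF assms(1)], of k \<eta> "d k \<omega>"] assms(2) \<eta> \<eta>\<^sub>1 w by auto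
qed

lemma direction_error:
  assumes "regular \<omega>" "1 \<le> s" "k \<in> {1..<m}"
  defines "\<Phi> \<equiv> (1 + c\<^sub>2) / (1 - c\<^sub>2)"
  shows "(\<beta> k \<omega>)\<^sup>2 * (norm (d (k - 1) \<omega>))\<^sup>2
    \<le> (\<beta>hat ^ (2 * k) + \<Phi> * damped_sum 1 \<beta>hat k + (s - \<Phi>) * damped_sum c\<^sub>2 \<beta>hat k) * (norm (v 0 \<omega>))\<^sup>2
      + (\<beta>hat ^ (2 * k) + damped_sum c\<^sub>2 \<beta>hat k / s) * \<bar>(norm (d 0 \<omega>))\<^sup>2 - (norm (v 0 \<omega>))\<^sup>2\<bar>"
  unfolding \<Phi>_def
proof (rule conjugate_direction_error_le[OF \<beta>hat c\<^sub>2 _ _ _ _ assms(2,3)])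
  fix j assume j: "j \<in> {1..m+1}"
  then obtain i where i: "j = Suc i" "i \<le> m" by (cases j) auto
  show "\<bar>\<beta> j \<omega>\<bar> \<le> (norm (v j \<omega>))\<^sup>2 / (norm (v (j - 1) \<omega>))\<^sup>2"
    using parameter_Suc[OF assms(1) i(2)] i by simp
  show "d j \<omega> = - v j \<omega> + \<beta> j \<omega> *\<^sub>R d (j - 1) \<omega>"
    using direction_Suc[OF assms(1) i(2)] i by simp
qed (use assms(1) estimator_decrease curvature_condition in auto)

subsection \<open>Boundedness\<close>

definition Kv :: real where "Kv = norm (grad 0) + L * K"

lemma estimator_bounded:
  assumes "regular \<omega>" "k \<le> m + 1"
  shows "norm (v k \<omega>) \<le> Kv"
  using assms(2)
proof (induction k)
  case 0
  have "norm (grad (w 0 \<omega>)) \<le> norm (grad 0) + norm (grad (w 0 \<omega>) - grad 0)"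
    using norm_triangle_ineq[of "grad 0" "grad (w 0 \<omega>) - grad 0"] by simp
  also have "\<dots> \<le> norm (grad 0) + L * norm (w 0 \<omega>)"
    using gradient_lipschitz[of "w 0 \<omega>" 0] by simp
  also have "\<dots> \<le> Kv" using regularD(7)[OF assms(1)] L by (simp add: Kv_def)
  finally show ?case by (simp add: estimator_start[OF assms(1)])
next
  case (Suc k)
  have "(norm (v (Suc k) \<omega>))\<^sup>2 \<le> \<beta>hat * (norm (v k \<omega>))\<^sup>2"
    using estimator_decrease[OF assms(1), of k] Suc.prems by simp
  also have "\<dots> \<le> (norm (v k \<omega>))\<^sup>2" using \<beta>hat by (simp add: mult_left_le_one_le)
  finally have "norm (v (Suc k) \<omega>) \<le> norm (v k \<omega>)" by (rule power2_le_imp_le) simp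
  thus ?case using Suc by simp
qed

lemma parameter_bounded:
  assumes "regular \<omega>" "k \<le> m"
  shows "\<bar>\<beta> (Suc k) \<omega>\<bar> \<le> 1"
proof (cases "v k \<omega> = 0")
  case False
  have "\<bar>\<beta> (Suc k) \<omega>\<bar> \<le> (norm (v (Suc k) \<omega>))\<^sup>2 / (norm (v k \<omega>))\<^sup>2" by (rule parameter_Suc[OF assms])
  also have "\<dots> \<le> \<beta>hat" using estimator_decrease[OF assms] False by (simp add: pos_divide_le_eq)
  finally show ?thesis using \<beta>hat by simp
qed (use parameter_Suc[OF assms] in simp)

lemma direction_bounded:
  assumes "regular \<omega>" "k \<le> m + 1"
  shows "norm (d k \<omega>) \<le> K + real k * Kv"
  using assms(2)
proof (induction k)
  case 0
  show ?case using regularD(8)[OF assms(1)] by simp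
next
  case (Suc k)
  have "norm (d (Suc k) \<omega>) \<le> norm (v (Suc k) \<omega>) + \<bar>\<beta> (Suc k) \<omega>\<bar> * norm (d k \<omega>)"
    using norm_triangle_ineq[of "- v (Suc k) \<omega>" "\<beta> (Suc k) \<omega> *\<^sub>R d k \<omega>"]
      direction_Suc[OF assms(1), of k] Suc.prems by simp
  also have "\<dots> \<le> Kv + 1 * norm (d k \<omega>)"
    using estimator_bounded[OF assms(1), of "Suc k"] parameter_bounded[OF assms(1), of k] Suc.prems
    by (intro add_mono mult_right_mono) auto
  finally show ?case using Suc by (simp add: algebra_simps)
qed

text \<open>The proximal operator is nonexpansive and only two step sizes occur, so a step moves the iterate by a
bounded amount.\<close>

lemma iterate_bounded:
  assumes "k \<le> m + 1"
  shows "\<exists>C. \<forall>\<omega>. regular \<omega> \<longrightarrow> norm (w k \<omega>) \<le> C"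
  using assms
proof (induction k)
  case 0
  show ?case using regularD by blast
next
  case (Suc k)
  then obtain C where C: "\<And>\<omega>. regular \<omega> \<Longrightarrow> norm (w k \<omega>) \<le> C" by auto
  define P where "P = norm (prox \<eta>\<^sub>1 \<phi> 0) + norm (prox \<eta>\<^sub>2 \<phi> 0)"
  have "norm (w (Suc k) \<omega>) \<le> C + (P + C + \<eta>\<^sub>2 * (K + real k * Kv))" if reg: "regular \<omega>" for \<omega>
  proof -
    obtain \<eta> where \<eta>: "\<eta> \<in> {\<eta>\<^sub>1, \<eta>\<^sub>2}"
      and w: "w (Suc k) \<omega> = (1 - \<gamma>) *\<^sub>R w k \<omega> + \<gamma> *\<^sub>R prox \<eta> \<phi> (w k \<omega> + \<eta> *\<^sub>R d k \<omega>)"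
      using iterate_Suc[OF reg, of k] Suc.prems by auto
    let ?x = "w k \<omega> + \<eta> *\<^sub>R d k \<omega>"
    have \<eta>0: "0 < \<eta>" "\<eta> \<le> \<eta>\<^sub>2" using \<eta> \<eta>\<^sub>1 by auto
    have "norm (prox \<eta> \<phi> ?x) \<le> norm (prox \<eta> \<phi> 0) + norm (prox \<eta> \<phi> ?x - prox \<eta> \<phi> 0)"
      using norm_triangle_ineq[of "prox \<eta> \<phi> 0" "prox \<eta> \<phi> ?x - prox \<eta> \<phi> 0"] by simp
    also have "\<dots> \<le> P + norm ?x"
    proof (rule add_mono)
      show "norm (prox \<eta> \<phi> 0) \<le> P" using \<eta> by (auto simp: P_def)
      show "norm (prox \<eta> \<phi> ?x - prox \<eta> \<phi> 0) \<le> norm ?x"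
        using prox_nonexpansive[OF \<phi> \<eta>0(1), of ?x 0] by simp
    qed
    also have "norm ?x \<le> norm (w k \<omega>) + \<eta> * norm (d k \<omega>)"
      using norm_triangle_ineq[of "w k \<omega>" "\<eta> *\<^sub>R d k \<omega>"] \<eta>0 by simp
    also have "\<dots> \<le> C + \<eta>\<^sub>2 * (K + real k * Kv)"
      using C[OF reg] direction_bounded[OF reg, of k] Suc.prems \<eta>0 by (intro add_mono mult_mono) auto
    finally have p: "norm (prox \<eta> \<phi> ?x) \<le> P + C + \<eta>\<^sub>2 * (K + real k * Kv)" by simp
    have "norm (w (Suc k) \<omega>) \<le> (1 - \<gamma>) * norm (w k \<omega>) + \<gamma> * norm (prox \<eta> \<phi> ?x)"
      unfolding w using norm_triangle_ineq[of "(1 - \<gamma>) *\<^sub>R w k \<omega>" "\<gamma> *\<^sub>R prox \<eta> \<phi> ?x"] \<gamma> by simp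
    also have "\<dots> \<le> norm (w k \<omega>) + norm (prox \<eta> \<phi> ?x)"
      using \<gamma> by (intro add_mono) (auto simp: mult_left_le_one_le)
    finally show ?thesis using p C[OF reg] by linarith
  qed
  thus ?case by blast
qed

lemma gradient_bounded:
  assumes "k \<le> m + 1"
  shows "\<exists>C. \<forall>\<omega>. regular \<omega> \<longrightarrow> norm (grad (w k \<omega>)) \<le> C"
proof -
  obtain C where C: "\<And>\<omega>. regular \<omega> \<Longrightarrow> norm (w k \<omega>) \<le> C" using iterate_bounded[OF assms] by auto
  have "norm (grad (w k \<omega>)) \<le> norm (grad 0) + L * C" if "regular \<omega>" for \<omega>
  proof -
    have "norm (grad (w k \<omega>)) \<le> norm (grad 0) + norm (grad (w k \<omega>) - grad 0)"
      using norm_triangle_ineq[of "grad 0" "grad (w k \<omega>) - grad 0"] by simp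
    also have "\<dots> \<le> norm (grad 0) + L * norm (w k \<omega>)" using gradient_lipschitz[of "w k \<omega>" 0] by simp
    also have "\<dots> \<le> norm (grad 0) + L * C"
      using C[OF that] L by (intro add_left_mono mult_left_mono) auto
    finally show ?thesis .
  qed
  thus ?thesis by blast
qed

lemma gap_bounded:
  assumes "k \<le> m + 1"
  shows "\<exists>C. \<forall>\<omega>. regular \<omega> \<longrightarrow> gap (w k \<omega>) \<le> C"
  using assms
proof (induction k)
  case 0
  show ?case using regularD by blast
next
  case (Suc k)
  then obtain C where C: "\<And>\<omega>. regular \<omega> \<Longrightarrow> gap (w k \<omega>) \<le> C" by auto
  obtain G where G: "\<And>\<omega>. regular \<omega> \<Longrightarrow> norm (grad (w k \<omega>)) \<le> G" using gradient_bounded[of k] Suc.prems by auto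
  have "gap (w (Suc k) \<omega>) \<le> C + \<gamma> / 4 * (1 + 2 * \<eta>\<^sub>2\<^sup>2) * (G + (K + real k * Kv))\<^sup>2" if reg: "regular \<omega>" for \<omega>
  proof -
    have "norm (grad (w k \<omega>) + d k \<omega>) \<le> G + (K + real k * Kv)"
      using norm_triangle_ineq[of "grad (w k \<omega>)" "d k \<omega>"] G[OF reg] direction_bounded[OF reg, of k] Suc.prems by simp
    hence e: "\<gamma> / 4 * (1 + 2 * \<eta>\<^sub>2\<^sup>2) * (norm (grad (w k \<omega>) + d k \<omega>))\<^sup>2
        \<le> \<gamma> / 4 * (1 + 2 * \<eta>\<^sub>2\<^sup>2) * (G + (K + real k * Kv))\<^sup>2"
      using \<gamma> by (intro mult_left_mono power_mono) auto
    have g: "(1 - rate) * gap (w k \<omega>) \<le> C"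
    proof -
      have "0 \<le> gap (w k \<omega>)" using gap_nonneg[OF iterate_finite[OF reg, of k]] Suc.prems by simp
      hence "0 \<le> rate * gap (w k \<omega>)" using rate_pos by simp
      thus ?thesis using C[OF reg] unfolding left_diff_distrib by linarith
    qed
    have "0 \<le> \<gamma> / 2 * (2 / \<eta>\<^sub>2 - L * \<gamma> - 3) * ((norm (w (Suc k) \<omega> - w k \<omega>))\<^sup>2 / \<gamma>\<^sup>2)"
      using step_bound \<gamma> by (intro mult_nonneg_nonneg) auto
    thus ?thesis using gap_iterate_Suc[OF reg, of k] Suc.prems e g by simp
  qed
  thus ?case by blast
qed

subsection \<open>Integrability\<close>

lemma sub_measurable:
  assumes "k \<le> m + 2" "X \<in> measurable (F k) N"
  shows "X \<in> measurable M N"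
  using F[OF assms(1)] assms(2) by (rule measurable_from_subalg)

lemma measurable_processes:
  assumes "k \<le> m + 1"
  shows "w k \<in> borel_measurable M" "v k \<in> borel_measurable M" "d k \<in> borel_measurable M"
    "\<beta> k \<in> borel_measurable M" "B k \<in> measurable M (count_space (Pow {1..n}))"
proof -
  have k: "k \<le> m + 2" "k + 1 \<le> m + 2" using assms by auto
  show "w k \<in> borel_measurable M" by (rule sub_measurable[OF k(1) w_meas[OF assms]])
  note sub = sub_measurable[OF k(2)]
  show "v k \<in> borel_measurable M" by (rule sub[OF v_meas[OF assms]])
  show "d k \<in> borel_measurable M" by (rule sub[OF d_meas[OF assms]])
  show "\<beta> k \<in> borel_measurable M" by (rule sub[OF \<beta>_meas[OF assms]])
  show "B k \<in> measurable M (count_space (Pow {1..n}))" by (rule sub[OF B_meas[OF assms]])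
qed

lemma grad_measurable[measurable]: "grad \<in> borel_measurable borel"
  by (rule borel_measurable_continuous_onI) (rule batch_gradient_continuous, simp)

lemma integrable_if_bounded:
  fixes X :: "'w \<Rightarrow> real"
  assumes "X \<in> borel_measurable M" "\<And>\<omega>. regular \<omega> \<Longrightarrow> \<bar>X \<omega>\<bar> \<le> C"
  shows "integrable M X"
proof (rule integrable_const_bound[where B = C])
  show "AE \<omega> in M. norm (X \<omega>) \<le> C" using AE_regular by eventually_elim (use assms(2) in auto)
qed (rule assms(1))

lemma integrable_norm_squared:
  fixes X :: "'w \<Rightarrow> 'a"
  assumes "X \<in> borel_measurable M" "\<exists>C. \<forall>\<omega>. regular \<omega> \<longrightarrow> norm (X \<omega>) \<le> C"
  shows "integrable M (\<lambda>\<omega>. (norm (X \<omega>))\<^sup>2)"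
proof -
  obtain C where C: "\<And>\<omega>. regular \<omega> \<Longrightarrow> norm (X \<omega>) \<le> C" using assms(2) by auto
  show ?thesis
  proof (rule integrable_if_bounded)
    show "(\<lambda>\<omega>. (norm (X \<omega>))\<^sup>2) \<in> borel_measurable M" using assms(1) by measurable
    show "\<bar>(norm (X \<omega>))\<^sup>2\<bar> \<le> C\<^sup>2" if "regular \<omega>" for \<omega>
      using C[OF that] by (simp add: power_mono)
  qed
qed

lemma bounded_add:
  fixes X Y :: "'w \<Rightarrow> 'a"
  assumes "\<exists>C. \<forall>\<omega>. regular \<omega> \<longrightarrow> norm (X \<omega>) \<le> C" "\<exists>C. \<forall>\<omega>. regular \<omega> \<longrightarrow> norm (Y \<omega>) \<le> C"
  shows "\<exists>C. \<forall>\<omega>. regular \<omega> \<longrightarrow> norm (X \<omega> + Y \<omega>) \<le> C" "\<exists>C. \<forall>\<omega>. regular \<omega> \<longrightarrow> norm (X \<omega> - Y \<omega>) \<le> C"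
proof -
  obtain C D where C: "\<And>\<omega>. regular \<omega> \<Longrightarrow> norm (X \<omega>) \<le> C"
    and D: "\<And>\<omega>. regular \<omega> \<Longrightarrow> norm (Y \<omega>) \<le> D" using assms by auto
  have "norm (X \<omega> + Y \<omega>) \<le> C + D" if "regular \<omega>" for \<omega>
    using C[OF that] D[OF that] norm_triangle_ineq[of "X \<omega>" "Y \<omega>"] by linarith
  thus "\<exists>C. \<forall>\<omega>. regular \<omega> \<longrightarrow> norm (X \<omega> + Y \<omega>) \<le> C" by blast
  have "norm (X \<omega> - Y \<omega>) \<le> C + D" if "regular \<omega>" for \<omega>
    using C[OF that] D[OF that] norm_triangle_ineq4[of "X \<omega>" "Y \<omega>"] by linarith
  thus "\<exists>C. \<forall>\<omega>. regular \<omega> \<longrightarrow> norm (X \<omega> - Y \<omega>) \<le> C" by blast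
qed

lemma processes_bounded:
  assumes "k \<le> m + 1"
  shows "\<exists>C. \<forall>\<omega>. regular \<omega> \<longrightarrow> norm (v k \<omega>) \<le> C" "\<exists>C. \<forall>\<omega>. regular \<omega> \<longrightarrow> norm (d k \<omega>) \<le> C"
proof -
  show "\<exists>C. \<forall>\<omega>. regular \<omega> \<longrightarrow> norm (v k \<omega>) \<le> C"
    by (rule exI[of _ Kv]) (use estimator_bounded assms in simp)
  show "\<exists>C. \<forall>\<omega>. regular \<omega> \<longrightarrow> norm (d k \<omega>) \<le> C"
    by (rule exI[of _ "K + real k * Kv"]) (use direction_bounded assms in simp)
qed

lemma integrable_gap:
  assumes "k \<le> m + 1"
  shows "integrable M (\<lambda>\<omega>. gap (w k \<omega>))"
proof -
  from gap_bounded[OF assms] obtain C where C: "\<forall>\<omega>. regular \<omega> \<longrightarrow> gap (w k \<omega>) \<le> C" ..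
  have meas: "(\<lambda>\<omega>. gap (w k \<omega>)) \<in> borel_measurable M"
    by (rule measurable_compose[OF measurable_processes(1)[OF assms] gap_measurable])
  have bound: "\<bar>gap (w k \<omega>)\<bar> \<le> C" if "regular \<omega>" for \<omega>
    using C that gap_nonneg[OF iterate_finite[OF that assms]] by simp
  show ?thesis by (rule integrable_if_bounded[OF meas bound])
qed

subsection \<open>Variance of the gradient estimator\<close>

definition estimator_error :: "nat \<Rightarrow> real" where
  "estimator_error k = expectation (\<lambda>\<omega>. (norm (v k \<omega> - grad (w k \<omega>)))\<^sup>2)"

definition step_square :: "nat \<Rightarrow> real" where
  "step_square k = expectation (\<lambda>\<omega>. (norm (w (Suc k) \<omega> - w k \<omega>))\<^sup>2)"

abbreviation \<rho> :: real where "\<rho> \<equiv> (real n - real b) / (real b * (real n - 1))"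

lemma \<rho>_nonneg: "0 \<le> \<rho>"
  using b n by simp

lemma grad_iterate_measurable:
  assumes "k \<le> m + 1"
  shows "(\<lambda>\<omega>. grad (w k \<omega>)) \<in> borel_measurable M"
  using measurable_processes(1)[OF assms] grad_measurable by (rule measurable_compose)

lemma integrable_estimator_error:
  assumes "k \<le> m + 1"
  shows "integrable M (\<lambda>\<omega>. (norm (v k \<omega> - grad (w k \<omega>)))\<^sup>2)"
proof (rule integrable_norm_squared)
  show "(\<lambda>\<omega>. v k \<omega> - grad (w k \<omega>)) \<in> borel_measurable M"
    using measurable_processes(2)[OF assms] grad_iterate_measurable[OF assms] by (rule borel_measurable_diff)
  show "\<exists>C. \<forall>\<omega>. regular \<omega> \<longrightarrow> norm (v k \<omega> - grad (w k \<omega>)) \<le> C"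
    by (rule bounded_add(2)[OF processes_bounded(1)[OF assms] gradient_bounded[OF assms]])
qed

lemma integrable_step_square:
  assumes "k \<le> m"
  shows "integrable M (\<lambda>\<omega>. (norm (w (Suc k) \<omega> - w k \<omega>))\<^sup>2)"
proof (rule integrable_norm_squared)
  have k: "Suc k \<le> m + 1" "k \<le> m + 1" using assms by auto
  show "(\<lambda>\<omega>. w (Suc k) \<omega> - w k \<omega>) \<in> borel_measurable M"
    using measurable_processes(1)[OF k(1)] measurable_processes(1)[OF k(2)] by (rule borel_measurable_diff)
  show "\<exists>C. \<forall>\<omega>. regular \<omega> \<longrightarrow> norm (w (Suc k) \<omega> - w k \<omega>) \<le> C"
    by (rule bounded_add(2)[OF iterate_bounded[OF k(1)] iterate_bounded[OF k(2)]])
qed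

lemma estimator_error_0: "estimator_error 0 = 0"
proof -
  have "estimator_error 0 = expectation (\<lambda>\<omega>. 0)"
    unfolding estimator_error_def
  proof (rule integral_cong_AE)
    show "AE \<omega> in M. (norm (v 0 \<omega> - grad (w 0 \<omega>)))\<^sup>2 = 0"
      using AE_regular by eventually_elim (simp add: estimator_start)
  qed (use integrable_estimator_error[of 0] in auto)
  thus ?thesis by simp
qed

text \<open>Given the past, the new batch only adds a centred deviation to the current error, so the mean square error
grows by the sampling variance of gradient differences, which mean-square smoothness bounds.\<close>

lemma estimator_error_Suc:
  assumes "k \<le> m"
  shows "estimator_error (Suc k) \<le> estimator_error k + \<rho> * L\<^sup>2 * step_square k"
proof -
  have k: "Suc k \<le> m + 1" "k \<le> m + 1" "Suc k \<le> m + 2" "Suc k \<in> {1..m+1}" using assms by auto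
  define e where "e \<omega> = v k \<omega> - grad (w k \<omega>)" for \<omega>
  define z where "z I \<omega> = gradient (batch_fun f I) (w (Suc k) \<omega>) - gradient (batch_fun f I) (w k \<omega>)" for I \<omega>
  define g where "g I \<omega> = (norm (e \<omega> + (z I \<omega> - z {1..n} \<omega>)))\<^sup>2" for I \<omega>
  define N where "N = real (card (batches n b))"
  have N: "0 < N" using b by (simp add: N_def card_batches)
  have Fk: "sets (F k) \<subseteq> sets (F (Suc k))" using F_mono[OF k(2)] by simp
  have sp: "space (F k) = space (F (Suc k))" using F[of k] F[of "Suc k"] assms by (simp add: subalgebra_def)
  have wk: "w k \<in> borel_measurable (F (Suc k))"
    using w_meas[OF k(2)] Fk sp by (meson measurable_from_subalg subalgebra_def)
  have bg: "gradient (batch_fun f I) \<in> borel_measurable borel" if "I \<subseteq> {1..n}" for I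
    by (rule borel_measurable_continuous_onI[OF batch_gradient_continuous[OF that]])
  have zm: "z I \<in> borel_measurable (F (Suc k))" if "I \<subseteq> {1..n}" for I
    unfolding z_def using measurable_compose[OF w_meas[OF k(1)] bg[OF that]] measurable_compose[OF wk bg[OF that]]
    by (rule borel_measurable_diff)
  have em: "e \<in> borel_measurable (F (Suc k))"
    unfolding e_def using v_meas[OF k(2)] measurable_compose[OF wk grad_measurable] by (auto intro: borel_measurable_diff)
  have gm: "g I \<in> borel_measurable (F (Suc k))" if "I \<subseteq> {1..n}" for I
  proof -
    note [measurable] = em zm[OF that] zm[OF order_refl]
    show ?thesis unfolding g_def by measurable
  qed
  have avg: "(\<Sum>I\<in>batches n b. g I \<omega>) \<le> N * ((norm (e \<omega>))\<^sup>2 + \<rho> * (L\<^sup>2 * (norm (w (Suc k) \<omega> - w k \<omega>))\<^sup>2))" for \<omega>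
  proof -
    define a where "a i = gradient (f i) (w (Suc k) \<omega>) - gradient (f i) (w k \<omega>)" for i
    have za: "z I \<omega> = (1 / real (card I)) *\<^sub>R (\<Sum>i\<in>I. a i)" if "I \<subseteq> {1..n}" for I
      using that by (simp add: z_def gradient_batch a_def sum_subtractf scaleR_diff_right)
    have "(\<Sum>I\<in>batches n b. g I \<omega>)
        = (\<Sum>I\<in>batches n b. (norm (e \<omega> + ((1 / real b) *\<^sub>R (\<Sum>i\<in>I. a i) - (1 / real n) *\<^sub>R (\<Sum>i\<in>{1..n}. a i))))\<^sup>2)"
    proof (intro sum.cong refl)
      fix I assume "I \<in> batches n b"
      hence I: "I \<subseteq> {1..n}" "card I = b" by (auto simp: batches_def)
      show "g I \<omega> = (norm (e \<omega> + ((1 / real b) *\<^sub>R (\<Sum>i\<in>I. a i) - (1 / real n) *\<^sub>R (\<Sum>i\<in>{1..n}. a i))))\<^sup>2"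
        unfolding g_def za[OF I(1)] za[OF order_refl] I(2) by simp
    qed
    also have "\<dots> \<le> N * ((norm (e \<omega>))\<^sup>2 + \<rho> * ((\<Sum>i\<in>{1..n}. (norm (a i))\<^sup>2) / real n))"
      unfolding N_def by (rule batch_deviation_le[OF b])
    also have "\<dots> \<le> N * ((norm (e \<omega>))\<^sup>2 + \<rho> * (L\<^sup>2 * (norm (w (Suc k) \<omega> - w k \<omega>))\<^sup>2))"
      using mean_lipschitz[of "w (Suc k) \<omega>" "w k \<omega>"] N \<rho>_nonneg unfolding a_def
      by (intro mult_left_mono add_left_mono) auto
    finally show ?thesis .
  qed
  have int: "integrable M (\<lambda>\<omega>. (norm (e \<omega>))\<^sup>2 + \<rho> * (L\<^sup>2 * (norm (w (Suc k) \<omega> - w k \<omega>))\<^sup>2))"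
    unfolding e_def
    by (intro Bochner_Integration.integrable_add integrable_mult_right integrable_estimator_error[OF k(2)]
        integrable_step_square[OF assms])
  have "ennreal (estimator_error (Suc k)) = (\<integral>\<^sup>+\<omega>. ennreal ((norm (v (Suc k) \<omega> - grad (w (Suc k) \<omega>)))\<^sup>2) \<partial>M)"
    unfolding estimator_error_def by (rule nn_integral_eq_integral[symmetric]) (use integrable_estimator_error[OF k(1)] in auto)
  also have "\<dots> = (\<integral>\<^sup>+\<omega>. ennreal (g (B (Suc k) \<omega>) \<omega>) \<partial>M)"
  proof (rule nn_integral_cong_AE)
    show "AE \<omega> in M. ennreal ((norm (v (Suc k) \<omega> - grad (w (Suc k) \<omega>)))\<^sup>2) = ennreal (g (B (Suc k) \<omega>) \<omega>)"
      using AE_regular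
    proof eventually_elim
      fix \<omega> assume "regular \<omega>"
      from estimator_Suc[OF this assms] have "v (Suc k) \<omega> = z (B (Suc k) \<omega>) \<omega> + v k \<omega>" by (simp add: z_def)
      hence "v (Suc k) \<omega> - grad (w (Suc k) \<omega>) = e \<omega> + (z (B (Suc k) \<omega>) \<omega> - z {1..n} \<omega>)"
        by (simp add: e_def z_def)
      thus "ennreal ((norm (v (Suc k) \<omega> - grad (w (Suc k) \<omega>)))\<^sup>2) = ennreal (g (B (Suc k) \<omega>) \<omega>)"
        by (simp only: g_def)
    qed
  qed
  also have "\<dots> = (\<integral>\<^sup>+\<omega>. (\<Sum>I\<in>batches n b. ennreal (1 / real (card (batches n b))) * ennreal (g I \<omega>)) \<partial>M)"
    by (rule nn_integral_uniform_batch[OF prob_space_axioms F[OF k(3)] b measurable_processes(5)[OF k(1)]])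
       (use uniform[OF k(4)] gm in auto)
  also have "\<dots> \<le> (\<integral>\<^sup>+\<omega>. ennreal ((norm (e \<omega>))\<^sup>2 + \<rho> * (L\<^sup>2 * (norm (w (Suc k) \<omega> - w k \<omega>))\<^sup>2)) \<partial>M)"
  proof (rule nn_integral_mono)
    fix \<omega>
    have "(\<Sum>I\<in>batches n b. ennreal (1 / N) * ennreal (g I \<omega>)) = (\<Sum>I\<in>batches n b. ennreal (1 / N * g I \<omega>))"
      using N by (intro sum.cong refl ennreal_mult[symmetric]) (auto simp: g_def)
    also have "\<dots> = ennreal (\<Sum>I\<in>batches n b. 1 / N * g I \<omega>)"
      using N by (intro sum_ennreal) (auto simp: g_def)
    also have "(\<Sum>I\<in>batches n b. 1 / N * g I \<omega>) = (\<Sum>I\<in>batches n b. g I \<omega>) / N"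
      by (simp add: sum_divide_distrib)
    also have "ennreal \<dots> \<le> ennreal ((norm (e \<omega>))\<^sup>2 + \<rho> * (L\<^sup>2 * (norm (w (Suc k) \<omega> - w k \<omega>))\<^sup>2))"
      using avg[of \<omega>] N by (intro ennreal_leI mult_imp_div_pos_le) (auto simp: mult.commute)
    finally show "(\<Sum>I\<in>batches n b. ennreal (1 / real (card (batches n b))) * ennreal (g I \<omega>))
        \<le> ennreal ((norm (e \<omega>))\<^sup>2 + \<rho> * (L\<^sup>2 * (norm (w (Suc k) \<omega> - w k \<omega>))\<^sup>2))"
      by (simp only: N_def)
  qed
  also have "\<dots> = ennreal (expectation (\<lambda>\<omega>. (norm (e \<omega>))\<^sup>2 + \<rho> * (L\<^sup>2 * (norm (w (Suc k) \<omega> - w k \<omega>))\<^sup>2)))"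
    by (rule nn_integral_eq_integral[OF int])
       (intro AE_I2 add_nonneg_nonneg mult_nonneg_nonneg \<rho>_nonneg zero_le_power2)
  also have "expectation (\<lambda>\<omega>. (norm (e \<omega>))\<^sup>2 + \<rho> * (L\<^sup>2 * (norm (w (Suc k) \<omega> - w k \<omega>))\<^sup>2))
      = estimator_error k + \<rho> * L\<^sup>2 * step_square k"
    unfolding estimator_error_def step_square_def e_def
    using integrable_estimator_error[OF k(2)] integrable_step_square[OF assms] by simp
  finally show ?thesis
  proof (rule ennreal_le_iff[THEN iffD1, rotated])
    show "0 \<le> estimator_error k + \<rho> * L\<^sup>2 * step_square k"
      unfolding estimator_error_def step_square_def using \<rho>_nonneg
      by (intro add_nonneg_nonneg mult_nonneg_nonneg) auto
  qed
qed

lemma estimator_error_le: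
  assumes "k \<le> m + 1"
  shows "estimator_error k \<le> \<rho> * L\<^sup>2 * (\<Sum>i<k. step_square i)"
  using assms
proof (induction k)
  case (Suc k)
  have "estimator_error (Suc k) \<le> estimator_error k + \<rho> * L\<^sup>2 * step_square k"
    using estimator_error_Suc[of k] Suc.prems by simp
  also have "\<dots> \<le> \<rho> * L\<^sup>2 * (\<Sum>i<k. step_square i) + \<rho> * L\<^sup>2 * step_square k"
    using Suc by simp
  finally show ?case by (simp add: distrib_left)
qed (simp add: estimator_error_0)

subsection \<open>The expected gap over one epoch\<close>

definition direction_term :: "nat \<Rightarrow> 'w \<Rightarrow> real" where
  "direction_term k \<omega> = (\<beta> k \<omega>)\<^sup>2 * (norm (d (k - 1) \<omega>))\<^sup>2"

lemma integrable_direction_term: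
  assumes "k \<in> {1..<m}"
  shows "integrable M (direction_term k)"
proof -
  obtain j where j: "k = Suc j" using assms by (cases k) auto
  have k: "k \<le> m + 1" "k - 1 \<le> m + 1" "j \<le> m" "j \<le> m + 1" using assms j by auto
  have "direction_term k = (\<lambda>\<omega>. (norm (\<beta> k \<omega> *\<^sub>R d (k - 1) \<omega>))\<^sup>2)"
    by (rule ext) (simp add: direction_term_def power_mult_distrib)
  moreover have "integrable M (\<lambda>\<omega>. (norm (\<beta> k \<omega> *\<^sub>R d (k - 1) \<omega>))\<^sup>2)"
  proof (rule integrable_norm_squared)
    show "(\<lambda>\<omega>. \<beta> k \<omega> *\<^sub>R d (k - 1) \<omega>) \<in> borel_measurable M"
      using measurable_processes(4)[OF k(1)] measurable_processes(3)[OF k(2)] by (rule borel_measurable_scaleR)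
    have "norm (\<beta> k \<omega> *\<^sub>R d (k - 1) \<omega>) \<le> 1 * (K + real j * Kv)" if "regular \<omega>" for \<omega>
      using parameter_bounded[OF that k(3)] direction_bounded[OF that k(4)]
      unfolding norm_scaleR j diff_Suc_1 by (intro mult_mono) auto
    thus "\<exists>C. \<forall>\<omega>. regular \<omega> \<longrightarrow> norm (\<beta> k \<omega> *\<^sub>R d (k - 1) \<omega>) \<le> C" by blast
  qed
  ultimately show ?thesis by simp
qed

lemma integrable_start_terms:
  shows "integrable M (\<lambda>\<omega>. (norm (v 0 \<omega>))\<^sup>2)"
    and "integrable M (\<lambda>\<omega>. \<bar>(norm (d 0 \<omega>))\<^sup>2 - (norm (v 0 \<omega>))\<^sup>2\<bar>)"
    and "integrable M (\<lambda>\<omega>. (norm (v 0 \<omega> + d 0 \<omega>))\<^sup>2)"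
proof -
  have 0: "0 \<le> m + 1" by simp
  note meas = measurable_processes(2,3)[OF 0] and bnd = processes_bounded[OF 0]
  show v: "integrable M (\<lambda>\<omega>. (norm (v 0 \<omega>))\<^sup>2)" by (rule integrable_norm_squared[OF meas(1) bnd(1)])
  have d: "integrable M (\<lambda>\<omega>. (norm (d 0 \<omega>))\<^sup>2)" by (rule integrable_norm_squared[OF meas(2) bnd(2)])
  show "integrable M (\<lambda>\<omega>. \<bar>(norm (d 0 \<omega>))\<^sup>2 - (norm (v 0 \<omega>))\<^sup>2\<bar>)"
    by (intro integrable_abs Bochner_Integration.integrable_diff v d)
  show "integrable M (\<lambda>\<omega>. (norm (v 0 \<omega> + d 0 \<omega>))\<^sup>2)"
    by (rule integrable_norm_squared[OF borel_measurable_add[OF meas] bounded_add(1)[OF bnd]])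
qed

lemma error_square_le:
  assumes "regular \<omega>" "k \<in> {1..<m}"
  shows "(norm (grad (w k \<omega>) + d k \<omega>))\<^sup>2 \<le> 2 * (norm (v k \<omega> - grad (w k \<omega>)))\<^sup>2 + 2 * direction_term k \<omega>"
proof -
  obtain j where j: "k = Suc j" "j \<le> m" using assms(2) by (cases k) auto
  let ?p = "v k \<omega> - grad (w k \<omega>)" and ?q = "\<beta> k \<omega> *\<^sub>R d (k - 1) \<omega>"
  have "grad (w k \<omega>) + d k \<omega> = ?q - ?p"
    using direction_Suc[OF assms(1) j(2)] by (simp add: j(1))
  hence "(norm (grad (w k \<omega>) + d k \<omega>))\<^sup>2 = (norm (?q - ?p))\<^sup>2" by (simp only:)
  also have "\<dots> = 2 * (norm ?p)\<^sup>2 + 2 * (norm ?q)\<^sup>2 - (norm (?q + ?p))\<^sup>2"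
  proof -
    have "(norm (q - p))\<^sup>2 = 2 * (norm p)\<^sup>2 + 2 * (norm q)\<^sup>2 - (norm (q + p))\<^sup>2" for p q :: 'a
      using norm_add_scaleR_squared[of q "-1" p] norm_add_scaleR_squared[of q 1 p] by simp
    thus ?thesis .
  qed
  also have "\<dots> \<le> 2 * (norm ?p)\<^sup>2 + 2 * (norm ?q)\<^sup>2" by simp
  also have "(norm ?q)\<^sup>2 = direction_term k \<omega>" by (simp add: direction_term_def power_mult_distrib)
  finally show ?thesis .
qed

definition expected_gap :: "nat \<Rightarrow> real" where "expected_gap k = expectation (\<lambda>\<omega>. gap (w k \<omega>))"

text \<open>The part of the direction error that does not come from sampling. At step \<open>0\<close> the estimator is exact
and the whole error is the initial mismatch; splitting the square, which costs a factor of two, is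
needed only later.\<close>

definition noise :: "nat \<Rightarrow> real" where
  "noise k = \<gamma> / 2 * (1 + 2 * \<eta>\<^sub>2\<^sup>2) *
    (if k = 0 then expectation (\<lambda>\<omega>. (norm (v 0 \<omega> + d 0 \<omega>))\<^sup>2) / 2 else expectation (direction_term k))"

text \<open>The accumulated decrease due to the step lengths; it dominates the variance of the estimator through
the parameter condition.\<close>

definition memory :: "nat \<Rightarrow> real" where
  "memory k = \<gamma> / 2 * (2 / \<eta>\<^sub>2 - L * \<gamma> - 3) * ((\<Sum>i<k. step_square i) / \<gamma>\<^sup>2)"

lemma integrable_error_square:
  assumes "k \<le> m + 1"
  shows "integrable M (\<lambda>\<omega>. (norm (grad (w k \<omega>) + d k \<omega>))\<^sup>2)"
  by (rule integrable_norm_squared[OF borel_measurable_add[OF grad_iterate_measurable[OF assms]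
        measurable_processes(3)[OF assms]] bounded_add(1)[OF gradient_bounded[OF assms] processes_bounded(2)[OF assms]]])

lemma expected_error_square_le:
  assumes "k < m"
  shows "\<gamma> / 4 * (1 + 2 * \<eta>\<^sub>2\<^sup>2) * expectation (\<lambda>\<omega>. (norm (grad (w k \<omega>) + d k \<omega>))\<^sup>2)
    \<le> noise k + \<gamma> / 2 * (1 + 2 * \<eta>\<^sub>2\<^sup>2) * estimator_error k"
proof (cases "k = 0")
  case True
  have "expectation (\<lambda>\<omega>. (norm (grad (w 0 \<omega>) + d 0 \<omega>))\<^sup>2) = expectation (\<lambda>\<omega>. (norm (v 0 \<omega> + d 0 \<omega>))\<^sup>2)"
  proof (rule integral_cong_AE)
    show "AE \<omega> in M. (norm (grad (w 0 \<omega>) + d 0 \<omega>))\<^sup>2 = (norm (v 0 \<omega> + d 0 \<omega>))\<^sup>2"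
      using AE_regular by eventually_elim (simp add: estimator_start)
  qed (use integrable_error_square[of 0] integrable_start_terms(3) in auto)
  thus ?thesis using True by (simp add: noise_def estimator_error_0)
next
  case False
  hence k: "k \<in> {1..<m}" "k \<le> m + 1" using assms by auto
  have "expectation (\<lambda>\<omega>. (norm (grad (w k \<omega>) + d k \<omega>))\<^sup>2)
      \<le> expectation (\<lambda>\<omega>. 2 * (norm (v k \<omega> - grad (w k \<omega>)))\<^sup>2 + 2 * direction_term k \<omega>)"
  proof (rule integral_mono_AE)
    show "AE \<omega> in M. (norm (grad (w k \<omega>) + d k \<omega>))\<^sup>2 \<le> 2 * (norm (v k \<omega> - grad (w k \<omega>)))\<^sup>2 + 2 * direction_term k \<omega>"
      using AE_regular by eventually_elim (rule error_square_le[OF _ k(1)])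
  qed (use integrable_error_square[OF k(2)] integrable_estimator_error[OF k(2)] integrable_direction_term[OF k(1)] in auto)
  also have "\<dots> = 2 * estimator_error k + 2 * expectation (direction_term k)"
    using integrable_estimator_error[OF k(2)] integrable_direction_term[OF k(1)]
    by (simp add: estimator_error_def)
  finally have "\<gamma> / 4 * (1 + 2 * \<eta>\<^sub>2\<^sup>2) * expectation (\<lambda>\<omega>. (norm (grad (w k \<omega>) + d k \<omega>))\<^sup>2)
      \<le> \<gamma> / 4 * (1 + 2 * \<eta>\<^sub>2\<^sup>2) * (2 * estimator_error k + 2 * expectation (direction_term k))"
    using \<gamma> by (intro mult_left_mono) auto
  also have "\<dots> = \<gamma> / 2 * (1 + 2 * \<eta>\<^sub>2\<^sup>2) * expectation (direction_term k)
      + \<gamma> / 2 * (1 + 2 * \<eta>\<^sub>2\<^sup>2) * estimator_error k"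
    by (simp add: algebra_simps)
  finally show ?thesis using False by (simp add: noise_def)
qed

lemma expected_gap_Suc:
  assumes "k < m"
  shows "expected_gap (Suc k) \<le> (1 - rate) * expected_gap k + noise k + memory k / (2 * real m)
    - (memory (Suc k) - memory k)"
proof -
  have k: "k \<le> m" "k \<le> m + 1" "Suc k \<le> m + 1" using assms by auto
  define R where "R = 2 / \<eta>\<^sub>2 - L * \<gamma> - 3"
  define S where "S = (\<Sum>i<k. step_square i)"
  have S: "0 \<le> S" by (auto simp: S_def step_square_def intro!: sum_nonneg)
  have "expected_gap (Suc k) \<le> expectation (\<lambda>\<omega>. (1 - rate) * gap (w k \<omega>)
      + \<gamma> / 4 * (1 + 2 * \<eta>\<^sub>2\<^sup>2) * (norm (grad (w k \<omega>) + d k \<omega>))\<^sup>2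
      - \<gamma> / 2 * R * ((norm (w (Suc k) \<omega> - w k \<omega>))\<^sup>2 / \<gamma>\<^sup>2))"
    unfolding expected_gap_def
  proof (rule integral_mono_AE)
    show "AE \<omega> in M. gap (w (Suc k) \<omega>) \<le> (1 - rate) * gap (w k \<omega>)
      + \<gamma> / 4 * (1 + 2 * \<eta>\<^sub>2\<^sup>2) * (norm (grad (w k \<omega>) + d k \<omega>))\<^sup>2
      - \<gamma> / 2 * R * ((norm (w (Suc k) \<omega> - w k \<omega>))\<^sup>2 / \<gamma>\<^sup>2)"
      using AE_regular unfolding R_def by eventually_elim (rule gap_iterate_Suc[OF _ k(1)])
  qed (use integrable_gap[OF k(2)] integrable_gap[OF k(3)] integrable_error_square[OF k(2)]
        integrable_step_square[OF k(1)] in auto)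
  also have "\<dots> = (1 - rate) * expected_gap k
      + \<gamma> / 4 * (1 + 2 * \<eta>\<^sub>2\<^sup>2) * expectation (\<lambda>\<omega>. (norm (grad (w k \<omega>) + d k \<omega>))\<^sup>2)
      - \<gamma> / 2 * R * (step_square k / \<gamma>\<^sup>2)"
    unfolding expected_gap_def step_square_def
    using integrable_gap[OF k(2)] integrable_error_square[OF k(2)] integrable_step_square[OF k(1)] by simp
  also have "\<gamma> / 2 * R * (step_square k / \<gamma>\<^sup>2) = memory (Suc k) - memory k"
    by (simp add: memory_def R_def add_divide_distrib distrib_left)
  finally have main: "expected_gap (Suc k) \<le> (1 - rate) * expected_gap k
      + \<gamma> / 4 * (1 + 2 * \<eta>\<^sub>2\<^sup>2) * expectation (\<lambda>\<omega>. (norm (grad (w k \<omega>) + d k \<omega>))\<^sup>2)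
      - (memory (Suc k) - memory k)" .
  have "\<gamma> / 2 * (1 + 2 * \<eta>\<^sub>2\<^sup>2) * estimator_error k \<le> \<gamma> / 2 * (1 + 2 * \<eta>\<^sub>2\<^sup>2) * (\<rho> * L\<^sup>2 * S)"
    using estimator_error_le[OF k(2)] \<gamma> by (intro mult_left_mono) (auto simp: S_def)
  also have "\<dots> = ((2 + 4 * \<eta>\<^sub>2\<^sup>2) * \<rho> * L\<^sup>2 * \<gamma>\<^sup>2 * real m) * (S / (4 * \<gamma> * real m))"
    using \<gamma> m by (simp add: power2_eq_square divide_simps) (simp add: algebra_simps)
  also have "\<dots> \<le> R * (S / (4 * \<gamma> * real m))"
    using params S \<gamma> unfolding R_def by (intro mult_right_mono) auto
  also have "\<dots> = memory k / (2 * real m)"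
    using \<gamma> by (simp add: memory_def R_def S_def power2_eq_square)
  finally show ?thesis using main expected_error_square_le[OF assms] by linarith
qed

lemma noise_nonneg: "0 \<le> noise k"
  unfolding noise_def direction_term_def using \<gamma>
  by (intro mult_nonneg_nonneg) (auto intro!: add_nonneg_nonneg divide_nonneg_nonneg)

text \<open>If the rate exceeds \<open>1/3\<close>, smoothness and gradient dominance are compatible only when all gaps vanish.
Otherwise the recursion lemma applies, and the late weights of the noise fit into the budget.\<close>

lemma epoch_contraction:
  fixes \<xi>' :: real
  defines "\<xi>' \<equiv> 1 / ((real m + 1) * rate)"
  shows "expected_gap m \<le> \<xi>' * (expected_gap 0 + \<gamma> / 2 * (2 + 4 * \<eta>\<^sub>2\<^sup>2) *
    epoch_error ((1 + c\<^sub>2) / (1 - c\<^sub>2)) \<beta>hat (expectation (\<lambda>\<omega>. (norm (v 0 \<omega>))\<^sup>2))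
      (expectation (\<lambda>\<omega>. \<bar>(norm (d 0 \<omega>))\<^sup>2 - (norm (v 0 \<omega>))\<^sup>2\<bar>))
      (expectation (\<lambda>\<omega>. (norm (v 0 \<omega> + d 0 \<omega>))\<^sup>2)))"
    (is "_ \<le> \<xi>' * (_ + _ * epoch_error ?\<Phi> _ ?N ?\<Delta> ?E)")
proof (cases "rate \<le> 1/3")
  case False
  hence tl: "\<not> 1 \<le> \<tau>\<^sub>o * L" using rate_le_third by blast
  have "expected_gap m = expectation (\<lambda>\<omega>. 0)"
    unfolding expected_gap_def
  proof (rule integral_cong_AE)
    show "AE \<omega> in M. gap (w m \<omega>) = 0"
      using AE_regular
    proof eventually_elim
      fix \<omega> assume "regular \<omega>"
      hence "\<phi> (w m \<omega>) \<noteq> \<infinity>" by (rule iterate_finite) simp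
      thus "gap (w m \<omega>) = 0" using gap_zero_or_condition_number tl by blast
    qed
  qed (use integrable_gap[of m] in auto)
  hence "expected_gap m = 0" by simp
  moreover have "0 \<le> expected_gap 0"
    unfolding expected_gap_def
  proof (rule integral_nonneg_AE)
    show "AE \<omega> in M. 0 \<le> gap (w 0 \<omega>)"
      using AE_regular by eventually_elim (rule gap_nonneg, rule iterate_finite, auto)
  qed
  moreover have "0 \<le> 1 - \<beta>hat\<^sup>2" using \<beta>hat by (simp add: power_le_one)
  hence "0 \<le> epoch_error ?\<Phi> \<beta>hat ?N ?\<Delta> ?E"
    unfolding epoch_error_def using c\<^sub>2 \<beta>hat by (intro add_nonneg_nonneg mult_nonneg_nonneg divide_nonneg_nonneg) auto
  hence "0 \<le> \<gamma> / 2 * (2 + 4 * \<eta>\<^sub>2\<^sup>2) * epoch_error ?\<Phi> \<beta>hat ?N ?\<Delta> ?E"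
    using \<gamma> by (intro mult_nonneg_nonneg) auto
  moreover have "0 \<le> \<xi>'" using rate_pos by (simp add: \<xi>'_def)
  ultimately show ?thesis by simp
next
  case True
  note x = rate_pos True
  have \<xi>': "0 < \<xi>'" using rate_pos by (simp add: \<xi>'_def)
  have gap_nn: "0 \<le> expected_gap k" if "k \<le> m" for k
    unfolding expected_gap_def
  proof (rule integral_nonneg_AE)
    show "AE \<omega> in M. 0 \<le> gap (w k \<omega>)"
      using AE_regular by eventually_elim (rule gap_nonneg, rule iterate_finite, use that in auto)
  qed
  have mem_mono: "memory k \<le> memory (Suc k)" for k
    unfolding memory_def using step_bound \<gamma>
    by (intro mult_left_mono divide_right_mono) (auto simp: step_square_def)
  have "expected_gap m \<le> \<xi>' * expected_gap 0 + (\<Sum>k<m. max ((1 - rate) ^ (m - 1 - k)) \<xi>' * noise k)"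
    unfolding \<xi>'_def
    by (rule recursion_with_memory_last_bound[where T = memory])
       (use x m gap_nn noise_nonneg mem_mono expected_gap_Suc in \<open>auto simp: memory_def\<close>)
  also have "(\<Sum>k<m. max ((1 - rate) ^ (m - 1 - k)) \<xi>' * noise k) = \<xi>' * (\<Sum>k<m. late_weight m rate k * noise k)"
  proof -
    have "max ((1 - rate) ^ (m - 1 - k)) \<xi>' = \<xi>' * late_weight m rate k" for k
    proof -
      have "\<xi>' * ((real m + 1) * rate * (1 - rate) ^ (m - 1 - k)) = (1 - rate) ^ (m - 1 - k)"
        using rate_pos by (simp add: \<xi>'_def)
      moreover have "\<xi>' * max u 1 = max (\<xi>' * u) \<xi>'" for u using \<xi>' by (simp add: max_def)
      ultimately show ?thesis by (simp only: late_weight_def)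
    qed
    thus ?thesis by (simp add: sum_distrib_left mult.assoc)
  qed
  finally have bound: "expected_gap m \<le> \<xi>' * (expected_gap 0 + (\<Sum>k<m. late_weight m rate k * noise k))"
    by (simp add: distrib_left)
  obtain s where s: "1 \<le> s"
    and budget: "(\<Sum>k\<in>{1..<m}. late_weight m rate k * ((\<beta>hat ^ (2 * k) + damped_sum c\<^sub>2 \<beta>hat k / s) / 2))
      \<le> \<beta>hat\<^sup>2 / (1 - \<beta>hat\<^sup>2)"
     "(\<Sum>k\<in>{1..<m}. late_weight m rate k * ((\<beta>hat ^ (2 * k) + ?\<Phi> * damped_sum 1 \<beta>hat k
        + (s - ?\<Phi>) * damped_sum c\<^sub>2 \<beta>hat k) / 2)) \<le> ?\<Phi> * \<beta>hat\<^sup>2 / ((1 - \<beta>hat)\<^sup>2 * (1 + \<beta>hat))"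
    using direction_error_budget[OF \<beta>hat c\<^sub>2 x m] by blast
  define \<nu> where "\<nu> k = \<beta>hat ^ (2 * k) + ?\<Phi> * damped_sum 1 \<beta>hat k + (s - ?\<Phi>) * damped_sum c\<^sub>2 \<beta>hat k" for k
  define \<mu> where "\<mu> k = \<beta>hat ^ (2 * k) + damped_sum c\<^sub>2 \<beta>hat k / s" for k
  have direction_bound: "expectation (direction_term k) \<le> \<nu> k * ?N + \<mu> k * ?\<Delta>" if k: "k \<in> {1..<m}" for k
  proof -
    have "expectation (direction_term k) \<le> expectation (\<lambda>\<omega>. \<nu> k * (norm (v 0 \<omega>))\<^sup>2 + \<mu> k * \<bar>(norm (d 0 \<omega>))\<^sup>2 - (norm (v 0 \<omega>))\<^sup>2\<bar>)"
    proof (rule integral_mono_AE)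
      show "AE \<omega> in M. direction_term k \<omega> \<le> \<nu> k * (norm (v 0 \<omega>))\<^sup>2 + \<mu> k * \<bar>(norm (d 0 \<omega>))\<^sup>2 - (norm (v 0 \<omega>))\<^sup>2\<bar>"
        using AE_regular unfolding direction_term_def \<nu>_def \<mu>_def
        by eventually_elim (rule direction_error[OF _ s k])
    qed (use integrable_direction_term[OF k] integrable_start_terms in auto)
    thus ?thesis using integrable_start_terms by simp
  qed
  define g where "g = \<gamma> / 2 * (2 + 4 * \<eta>\<^sub>2\<^sup>2)"
  have g: "0 \<le> g" using \<gamma> by (simp add: g_def)
  have lw: "0 \<le> late_weight m rate k" for k by (simp add: late_weight_def le_max_iff_disj)
  have split: "(\<Sum>k<m. late_weight m rate k * noise k)
      = late_weight m rate 0 * noise 0 + (\<Sum>k\<in>{1..<m}. late_weight m rate k * noise k)"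
    using m by (simp add: atLeast0LessThan[symmetric] sum.atLeast_Suc_lessThan)
  have first: "late_weight m rate 0 * noise 0 = g * (1/4 * ?E)"
    using late_weight_zero[OF x m] by (simp add: noise_def g_def algebra_simps)
  have "(\<Sum>k\<in>{1..<m}. late_weight m rate k * noise k)
      \<le> (\<Sum>k\<in>{1..<m}. g * (late_weight m rate k * (\<nu> k / 2) * ?N + late_weight m rate k * (\<mu> k / 2) * ?\<Delta>))"
  proof (rule sum_mono)
    fix k assume k: "k \<in> {1..<m}"
    have "noise k = g * (expectation (direction_term k) / 2)"
      using k by (simp add: noise_def g_def algebra_simps)
    also have "\<dots> \<le> g * ((\<nu> k * ?N + \<mu> k * ?\<Delta>) / 2)"
      using direction_bound[OF k] g by (intro mult_left_mono divide_right_mono) auto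
    finally have "late_weight m rate k * noise k \<le> late_weight m rate k * (g * ((\<nu> k * ?N + \<mu> k * ?\<Delta>) / 2))"
      using lw by (rule mult_left_mono)
    thus "late_weight m rate k * noise k
        \<le> g * (late_weight m rate k * (\<nu> k / 2) * ?N + late_weight m rate k * (\<mu> k / 2) * ?\<Delta>)"
      by (simp add: algebra_simps add_divide_distrib)
  qed
  also have "\<dots> = g * ((\<Sum>k\<in>{1..<m}. late_weight m rate k * (\<nu> k / 2)) * ?N
      + (\<Sum>k\<in>{1..<m}. late_weight m rate k * (\<mu> k / 2)) * ?\<Delta>)"
    by (simp only: sum_distrib_left[symmetric] sum.distrib sum_distrib_right)
  also have "\<dots> \<le> g * (?\<Phi> * \<beta>hat\<^sup>2 / ((1 - \<beta>hat)\<^sup>2 * (1 + \<beta>hat)) * ?N + \<beta>hat\<^sup>2 / (1 - \<beta>hat\<^sup>2) * ?\<Delta>)"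
    using budget g unfolding \<nu>_def[symmetric] \<mu>_def[symmetric]
    by (intro mult_left_mono add_mono mult_right_mono) auto
  finally have rest: "(\<Sum>k\<in>{1..<m}. late_weight m rate k * noise k)
      \<le> g * (?\<Phi> * \<beta>hat\<^sup>2 / ((1 - \<beta>hat)\<^sup>2 * (1 + \<beta>hat)) * ?N + \<beta>hat\<^sup>2 / (1 - \<beta>hat\<^sup>2) * ?\<Delta>)" .
  have quarter: "g * (1/4 * ?E) \<le> g * (1/2 * ?E)" using g by (intro mult_left_mono) auto
  have "(\<Sum>k<m. late_weight m rate k * noise k)
      \<le> g * (?\<Phi> * \<beta>hat\<^sup>2 / ((1 - \<beta>hat)\<^sup>2 * (1 + \<beta>hat)) * ?N + \<beta>hat\<^sup>2 / (1 - \<beta>hat\<^sup>2) * ?\<Delta>) + g * (1/2 * ?E)"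
    unfolding split first using add_mono[OF quarter rest] by (simp only: add.commute)
  also have "\<dots> = g * epoch_error ?\<Phi> \<beta>hat ?N ?\<Delta> ?E"
    by (simp only: epoch_error_def distrib_left)
  finally have "(\<Sum>k<m. late_weight m rate k * noise k)
      \<le> g * epoch_error ?\<Phi> \<beta>hat ?N ?\<Delta> ?E" .
  hence "\<xi>' * (expected_gap 0 + (\<Sum>k<m. late_weight m rate k * noise k))
      \<le> \<xi>' * (expected_gap 0 + g * epoch_error ?\<Phi> \<beta>hat ?N ?\<Delta> ?E)"
    using \<xi>' by (intro mult_left_mono add_left_mono) auto
  from order_trans[OF bound this] show ?thesis unfolding g_def .
qed

lemma epoch_end:
  "\<exists>K'. AE \<omega> in M. bounded_start K' (w m \<omega>) (v m \<omega>) \<and> bounded_start K' (w m \<omega>) (grad (w m \<omega>))"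
proof -
  have m': "m \<le> m + 1" by simp
  obtain A where A: "\<And>\<omega>. regular \<omega> \<Longrightarrow> norm (w m \<omega>) \<le> A" using iterate_bounded[OF m'] by blast
  obtain G where G: "\<And>\<omega>. regular \<omega> \<Longrightarrow> norm (grad (w m \<omega>)) \<le> G" using gradient_bounded[OF m'] by blast
  obtain D where D: "\<And>\<omega>. regular \<omega> \<Longrightarrow> gap (w m \<omega>) \<le> D" using gap_bounded[OF m'] by blast
  define K' where "K' = max (max A Kv) (max G D)"
  have "AE \<omega> in M. bounded_start K' (w m \<omega>) (v m \<omega>) \<and> bounded_start K' (w m \<omega>) (grad (w m \<omega>))"
    using AE_regular
  proof eventually_elim
    fix \<omega> assume r: "regular \<omega>"
    show "bounded_start K' (w m \<omega>) (v m \<omega>) \<and> bounded_start K' (w m \<omega>) (grad (w m \<omega>))"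
      using iterate_finite[OF r m'] A[OF r] estimator_bounded[OF r m'] G[OF r] D[OF r]
      by (auto simp: K'_def bounded_start_def le_max_iff_disj)
  qed
  thus ?thesis by blast
qed

end

section \<open>Iterating the epochs\<close>

lemma ereal_expectation_eq_integral:
  assumes "integrable M Y" "AE \<omega> in M. X \<omega> = ereal (Y \<omega>)"
  shows "ereal_expectation M X = ereal (\<integral>\<omega>. Y \<omega> \<partial>M)"
proof -
  have p: "(\<integral>\<^sup>+\<omega>. e2ennreal (X \<omega>) \<partial>M) = (\<integral>\<^sup>+\<omega>. ennreal (Y \<omega>) \<partial>M)"
    by (rule nn_integral_cong_AE) (use assms(2) in eventually_elim, simp add: ennreal.abs_eq)
  have q: "(\<integral>\<^sup>+\<omega>. e2ennreal (- X \<omega>) \<partial>M) = (\<integral>\<^sup>+\<omega>. ennreal (- Y \<omega>) \<partial>M)"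
    by (rule nn_integral_cong_AE) (use assms(2) in eventually_elim, simp add: ennreal.abs_eq)
  have "(\<integral>\<^sup>+\<omega>. ennreal (Y \<omega>) \<partial>M) \<noteq> \<infinity>" "(\<integral>\<^sup>+\<omega>. ennreal (- Y \<omega>) \<partial>M) \<noteq> \<infinity>"
    using assms(1) by (auto simp: real_integrable_def)
  then obtain a c where "(\<integral>\<^sup>+\<omega>. ennreal (Y \<omega>) \<partial>M) = ennreal a" "0 \<le> a"
    "(\<integral>\<^sup>+\<omega>. ennreal (- Y \<omega>) \<partial>M) = ennreal c" "0 \<le> c"
    by (metis ennreal_cases infinity_ennreal_def)
  thus ?thesis
    unfolding ereal_expectation_def p q real_lebesgue_integral_def[OF assms(1)] by simp
qed

lemma (in prob_space) ereal_expectation_infinite: "ereal_expectation M (\<lambda>\<omega>. \<infinity>) = \<infinity>"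
proof -
  have "e2ennreal \<infinity> = \<infinity>" by (simp add: infinity_ennreal_def top_ereal_def[symmetric] top_ennreal.abs_eq)
  moreover have "e2ennreal (- \<infinity>) = 0" by (simp add: e2ennreal_neg)
  ultimately show ?thesis by (simp add: ereal_expectation_def emeasure_space_1)
qed

lemma linear_recursion_le:
  fixes a \<delta> :: "nat \<Rightarrow> real"
  assumes "0 \<le> r" and "\<And>j. j < s \<Longrightarrow> a (Suc j) \<le> r * a j + \<delta> j"
    and "\<And>j. j < s \<Longrightarrow> \<delta> j \<le> (1 - r) * \<epsilon>" and "j \<le> s"
  shows "a j - \<epsilon> \<le> r ^ j * (a 0 - \<epsilon>)"
  using assms(4)
proof (induction j)
  case (Suc j)
  have "a (Suc j) - \<epsilon> \<le> r * a j + (1 - r) * \<epsilon> - \<epsilon>" using assms(2,3)[of j] Suc.prems by simp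
  also have "\<dots> = r * (a j - \<epsilon>)" by (simp add: algebra_simps)
  also have "\<dots> \<le> r * (r ^ j * (a 0 - \<epsilon>))" using Suc assms(1) by (intro mult_left_mono) auto
  finally show ?case by simp
qed simp

context dominant_problem begin

text \<open>The hypotheses on integrals are restricted to a finite initial value: otherwise the initial expected
gap is infinite and both bounds are trivial.\<close>

lemma linear_convergence_of_gaps:
  fixes wt :: "nat \<Rightarrow> 'w \<Rightarrow> 'a" and \<delta> :: "nat \<Rightarrow> real"
  assumes M: "prob_space M" and w0: "\<And>\<omega>. wt 0 \<omega> = w\<^sub>0" and r: "0 < r" "r < 1" and s: "1 \<le> s"
    and int: "\<And>j. \<phi> w\<^sub>0 \<noteq> \<infinity> \<Longrightarrow> j \<le> s \<Longrightarrow> integrable M (\<lambda>\<omega>. gap (wt j \<omega>))"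
    and fin: "\<And>j. \<phi> w\<^sub>0 \<noteq> \<infinity> \<Longrightarrow> j \<le> s \<Longrightarrow> AE \<omega> in M. \<phi> (wt j \<omega>) \<noteq> \<infinity>"
    and step: "\<And>j. \<phi> w\<^sub>0 \<noteq> \<infinity> \<Longrightarrow> j < s \<Longrightarrow>
      (\<integral>\<omega>. gap (wt (Suc j) \<omega>) \<partial>M) \<le> r * (\<integral>\<omega>. gap (wt j \<omega>) \<partial>M) + \<delta> j"
    and \<epsilon>: "\<epsilon> = Max (\<delta> ` {0..<s}) / (1 - r)"
  defines "P \<equiv> objective n f \<phi>"
  shows "ereal_expectation M (\<lambda>\<omega>. P (wt s \<omega>) - P wstar)
           \<le> ereal (r ^ s) * ereal_expectation M (\<lambda>\<omega>. P (wt 0 \<omega>) - P wstar - ereal \<epsilon>) + ereal \<epsilon>"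
    and "linear_to_ball (\<lambda>j. ereal_expectation M (\<lambda>\<omega>. P (wt j \<omega>) - P wstar)) r \<epsilon> s"
proof -
  interpret prob_space M by fact
  have Pstar: "P wstar = ereal (cost wstar)" unfolding P_def by (rule objective_eq[OF wstar_finite])
  have "ereal_expectation M (\<lambda>\<omega>. P (wt s \<omega>) - P wstar)
           \<le> ereal (r ^ s) * ereal_expectation M (\<lambda>\<omega>. P (wt 0 \<omega>) - P wstar - ereal \<epsilon>) + ereal \<epsilon> \<and>
      linear_to_ball (\<lambda>j. ereal_expectation M (\<lambda>\<omega>. P (wt j \<omega>) - P wstar)) r \<epsilon> s"
  proof (cases "\<phi> w\<^sub>0 = \<infinity>")
    case True
    hence "P w\<^sub>0 = \<infinity>" by (simp add: P_def objective_eq_infinity_iff)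
    hence "ereal_expectation M (\<lambda>\<omega>. P (wt 0 \<omega>) - P wstar) = \<infinity>"
      "ereal_expectation M (\<lambda>\<omega>. P (wt 0 \<omega>) - P wstar - ereal \<epsilon>) = \<infinity>"
      by (simp_all add: w0 Pstar ereal_expectation_infinite)
    thus ?thesis using r by (simp add: linear_to_ball_def max_def)
  next
    case False
    define a where "a j = (\<integral>\<omega>. gap (wt j \<omega>) \<partial>M)" for j
    have E: "ereal_expectation M (\<lambda>\<omega>. P (wt j \<omega>) - P wstar) = ereal (a j)" if "j \<le> s" for j
      unfolding a_def
    proof (rule ereal_expectation_eq_integral[OF int[OF False that]])
      show "AE \<omega> in M. P (wt j \<omega>) - P wstar = ereal (gap (wt j \<omega>))"
        using fin[OF False that] by eventually_elim (simp add: P_def objective_eq wstar_finite gap_def)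
    qed
    have E0: "ereal_expectation M (\<lambda>\<omega>. P (wt 0 \<omega>) - P wstar - ereal \<epsilon>) = ereal (a 0 - \<epsilon>)"
    proof -
      have "ereal_expectation M (\<lambda>\<omega>. P (wt 0 \<omega>) - P wstar - ereal \<epsilon>)
          = ereal (\<integral>\<omega>. gap (wt 0 \<omega>) - \<epsilon> \<partial>M)"
        by (rule ereal_expectation_eq_integral)
           (use False in \<open>auto simp: w0 P_def objective_eq wstar_finite gap_def\<close>)
      thus ?thesis by (simp add: a_def w0 prob_space)
    qed
    have a0: "0 \<le> a j" if "j \<le> s" for j
      unfolding a_def
      by (rule integral_nonneg_AE) (use fin[OF False that] in eventually_elim, rule gap_nonneg)
    have \<delta>: "\<delta> j \<le> (1 - r) * \<epsilon>" if "j < s" for j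
      using r that by (simp add: \<epsilon>)
    have lin: "a j - \<epsilon> \<le> r ^ j * (a 0 - \<epsilon>)" if "j \<le> s" for j
      by (rule linear_recursion_le[where s = s and \<delta> = \<delta>]) (use r step[OF False] \<delta> that in \<open>auto simp: a_def\<close>)
    have "ereal (a s) \<le> ereal (r ^ s) * ereal (a 0 - \<epsilon>) + ereal \<epsilon>" using lin[of s] by simp
    moreover have "max 0 (\<bar>ereal (a j)\<bar> - ereal \<epsilon>) \<le> ereal (r ^ j) * max 0 (\<bar>ereal (a 0)\<bar> - ereal \<epsilon>)"
      if j: "j \<le> s" for j
    proof -
      have mx: "max 0 (\<bar>ereal x\<bar> - ereal \<epsilon>) = ereal (max 0 (x - \<epsilon>))" if "0 \<le> x" for x
        using that by (simp add: max_def)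
      have "r ^ j * (a 0 - \<epsilon>) \<le> r ^ j * max 0 (a 0 - \<epsilon>)" using r by (intro mult_left_mono) auto
      hence "a j - \<epsilon> \<le> r ^ j * max 0 (a 0 - \<epsilon>)" using lin[OF j] by linarith
      moreover have "0 \<le> r ^ j * max 0 (a 0 - \<epsilon>)" using r by simp
      ultimately have "max 0 (a j - \<epsilon>) \<le> r ^ j * max 0 (a 0 - \<epsilon>)" by simp
      thus ?thesis
        unfolding mx[OF a0[OF j]] mx[OF a0[of 0, simplified]] times_ereal.simps ereal_less_eq(3) .
    qed
    ultimately show ?thesis using E E0 by (simp add: linear_to_ball_def)
  qed
  thus "ereal_expectation M (\<lambda>\<omega>. P (wt s \<omega>) - P wstar)
           \<le> ereal (r ^ s) * ereal_expectation M (\<lambda>\<omega>. P (wt 0 \<omega>) - P wstar - ereal \<epsilon>) + ereal \<epsilon>"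
    and "linear_to_ball (\<lambda>j. ereal_expectation M (\<lambda>\<omega>. P (wt j \<omega>) - P wstar)) r \<epsilon> s" by auto
qed

end

text \<open>The condition \<open>restart\<close> covers both rules for the initial direction of an epoch. It ensures that this
direction is bounded, so that the epochs can be chained.\<close>

locale cg_method = dominant_problem f \<phi> n L wstar \<tau>\<^sub>o \<gamma> \<eta>\<^sub>1 \<eta>\<^sub>2
  for f :: "nat \<Rightarrow> 'a::euclidean_space \<Rightarrow> real" and \<phi> n L wstar \<tau>\<^sub>o \<gamma> \<eta>\<^sub>1 \<eta>\<^sub>2 +
  fixes M :: "'w measure" and F :: "nat \<Rightarrow> nat \<Rightarrow> 'w measure" and m b S :: nat and c\<^sub>1 c\<^sub>2 \<beta>hat :: real
    and B :: "nat \<Rightarrow> nat \<Rightarrow> 'w \<Rightarrow> nat set" and \<beta> t :: "nat \<Rightarrow> nat \<Rightarrow> 'w \<Rightarrow> real"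
    and w v d :: "nat \<Rightarrow> nat \<Rightarrow> 'w \<Rightarrow> 'a" and w\<^sub>0 :: 'a and d_init :: "nat \<Rightarrow> 'w \<Rightarrow> 'a"
  assumes m: "1 \<le> m" and b: "1 \<le> b" "b \<le> n"
    and c\<^sub>2: "0 < c\<^sub>2" "c\<^sub>2 < 1" and \<beta>hat: "0 < \<beta>hat" "\<beta>hat < 1"
    and run: "cg_run d_init M F n f \<phi> m b \<gamma> \<eta>\<^sub>2 c\<^sub>1 c\<^sub>2 w\<^sub>0 S B \<beta> t w v d"
    and decrease: "AE \<omega> in M. \<forall>s\<in>{1..S}. \<forall>k\<le>m. (norm (v s (k+1) \<omega>))\<^sup>2 \<le> \<beta>hat * (norm (v s k \<omega>))\<^sup>2"
    and steps: "AE \<omega> in M. \<forall>s\<in>{1..S}. \<forall>k\<le>m. t s k \<omega> \<in> {\<eta>\<^sub>1, \<eta>\<^sub>2}"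
    and params: "(2 + 4 * \<eta>\<^sub>2\<^sup>2) * ((real n - real b) / (real b * (real n - 1))) * L\<^sup>2 * \<gamma>\<^sup>2 * real m
                   \<le> 2 / \<eta>\<^sub>2 - L * \<gamma> - 3"
    and restart: "AE \<omega> in M. \<forall>s\<in>{1..S}. d s 0 \<omega> = - grad (w s 0 \<omega>) \<or> (2 \<le> s \<and> d s 0 \<omega> = - v (s-1) m \<omega>)"
begin

abbreviation wt :: "nat \<Rightarrow> 'w \<Rightarrow> 'a" where "wt \<equiv> outer_iterate w\<^sub>0 m w"

lemma M_prob: "prob_space M" and adapted: "adapted_run M F n m S B \<beta> t w v d"
  and uniform: "uniform_batches M F n m b S B"
  using run by (auto simp: cg_run_def)

lemma run_AE:
  assumes "s \<in> {1..S}"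
  shows outer_start: "AE \<omega> in M. w s 0 \<omega> = wt (s - 1) \<omega>"
    and run_epoch: "AE \<omega> in M. cg_epoch n f \<phi> m \<gamma> \<eta>\<^sub>2 c\<^sub>1 c\<^sub>2 (\<lambda>k. B s k \<omega>) (\<lambda>k. \<beta> s k \<omega>) (\<lambda>k. t s k \<omega>)
          (\<lambda>k. w s k \<omega>) (\<lambda>k. v s k \<omega>) (\<lambda>k. d s k \<omega>)"
proof -
  have all: "AE \<omega> in M. \<forall>s\<in>{1..S}. w s 0 \<omega> = wt (s - 1) \<omega> \<and> d s 0 \<omega> = d_init s \<omega> \<and>
      cg_epoch n f \<phi> m \<gamma> \<eta>\<^sub>2 c\<^sub>1 c\<^sub>2 (\<lambda>k. B s k \<omega>) (\<lambda>k. \<beta> s k \<omega>) (\<lambda>k. t s k \<omega>)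
          (\<lambda>k. w s k \<omega>) (\<lambda>k. v s k \<omega>) (\<lambda>k. d s k \<omega>)"
    using run by (simp add: cg_run_def)
  show "AE \<omega> in M. w s 0 \<omega> = wt (s - 1) \<omega>"
    using all by eventually_elim (use assms in blast)
  show "AE \<omega> in M. cg_epoch n f \<phi> m \<gamma> \<eta>\<^sub>2 c\<^sub>1 c\<^sub>2 (\<lambda>k. B s k \<omega>) (\<lambda>k. \<beta> s k \<omega>) (\<lambda>k. t s k \<omega>)
          (\<lambda>k. w s k \<omega>) (\<lambda>k. v s k \<omega>) (\<lambda>k. d s k \<omega>)"
    using all by eventually_elim (use assms in blast)
qed

lemma stochastic_epochI:
  assumes s: "s \<in> {1..S}"
    and start: "AE \<omega> in M. bounded_start K (w s 0 \<omega>) (d s 0 \<omega>)"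
  shows "stochastic_epoch f \<phi> n L wstar \<tau>\<^sub>o \<gamma> \<eta>\<^sub>1 \<eta>\<^sub>2 M (F s) m b c\<^sub>1 c\<^sub>2 \<beta>hat K (B s) (\<beta> s) (t s) (w s) (v s) (d s)"
proof (intro stochastic_epoch.intro stochastic_epoch_axioms.intro dominant_problem_axioms M_prob)
  note A = adapted[unfolded adapted_run_def]
  note A\<^sub>1 = conjunct1[OF A] and A\<^sub>2 = conjunct1[OF conjunct2[OF A]]
    and A\<^sub>4 = conjunct2[OF conjunct2[OF conjunct2[OF A]]]
  show "subalgebra M (F s k)" if "k \<le> m + 2" for k using bspec[OF A\<^sub>1 s] that by blast
  show "sets (F s k) \<subseteq> sets (F s (k + 1))" if "k \<le> m + 1" for k using bspec[OF A\<^sub>2 s] that by blast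
  note all = bspec[OF A\<^sub>4 s]
  show "w s k \<in> borel_measurable (F s k)" if "k \<le> m + 1" for k using all that by blast
  show "B s k \<in> measurable (F s (k+1)) (count_space (Pow {1..n}))" if "k \<le> m + 1" for k using all that by blast
  show "v s k \<in> borel_measurable (F s (k+1))" if "k \<le> m + 1" for k using all that by blast
  show "d s k \<in> borel_measurable (F s (k+1))" if "k \<le> m + 1" for k using all that by blast
  show "\<beta> s k \<in> borel_measurable (F s (k+1))" if "k \<le> m + 1" for k using all that by blast
  show "measure M ({\<omega>\<in>space M. B s k \<omega> = I} \<inter> A)
        = pmf (pmf_of_set {J. J \<subseteq> {1..n} \<and> card J = b}) I * measure M A"
    if "k \<in> {1..m+1}" "A \<in> sets (F s k)" for k A I
    using uniform s that unfolding uniform_batches_def by blast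
  show "AE \<omega> in M. cg_epoch n f \<phi> m \<gamma> \<eta>\<^sub>2 c\<^sub>1 c\<^sub>2 (\<lambda>k. B s k \<omega>) (\<lambda>k. \<beta> s k \<omega>) (\<lambda>k. t s k \<omega>)
          (\<lambda>k. w s k \<omega>) (\<lambda>k. v s k \<omega>) (\<lambda>k. d s k \<omega>)" by (rule run_epoch[OF s])
  show "AE \<omega> in M. \<forall>k\<le>m. (norm (v s (k+1) \<omega>))\<^sup>2 \<le> \<beta>hat * (norm (v s k \<omega>))\<^sup>2"
    using decrease by eventually_elim (use s in blast)
  show "AE \<omega> in M. \<forall>k\<le>m. t s k \<omega> \<in> {\<eta>\<^sub>1, \<eta>\<^sub>2}"
    using steps by eventually_elim (use s in blast)
qed (use m b c\<^sub>2 \<beta>hat params start in auto)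

lemma epoch_start:
  assumes w\<^sub>0: "\<phi> w\<^sub>0 \<noteq> \<infinity>" and "s < S"
  shows "\<exists>K. AE \<omega> in M. bounded_start K (w (Suc s) 0 \<omega>) (d (Suc s) 0 \<omega>)"
  using \<open>s < S\<close>
proof (induction s)
  case 0
  hence 1: "1 \<in> {1..S}" by simp
  define K where "K = max (norm w\<^sub>0) (max (norm (grad w\<^sub>0)) (gap w\<^sub>0))"
  have "AE \<omega> in M. bounded_start K (w (Suc 0) 0 \<omega>) (d (Suc 0) 0 \<omega>)"
    using restart outer_start[OF 1]
  proof eventually_elim
    fix \<omega> assume r: "\<forall>s\<in>{1..S}. d s 0 \<omega> = - grad (w s 0 \<omega>) \<or> (2 \<le> s \<and> d s 0 \<omega> = - v (s-1) m \<omega>)"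
      and "w 1 0 \<omega> = wt (1 - 1) \<omega>"
    hence w1: "w (Suc 0) 0 \<omega> = w\<^sub>0" by (simp add: outer_iterate_def)
    have "d (Suc 0) 0 \<omega> = - grad w\<^sub>0" using bspec[OF r 1] w1 by simp
    thus "bounded_start K (w (Suc 0) 0 \<omega>) (d (Suc 0) 0 \<omega>)"
      using w\<^sub>0 unfolding w1 bounded_start_def by (simp add: K_def le_max_iff_disj)
  qed
  thus ?case by blast
next
  case (Suc s)
  then obtain K where K: "AE \<omega> in M. bounded_start K (w (Suc s) 0 \<omega>) (d (Suc s) 0 \<omega>)" by auto
  have s: "Suc s \<in> {1..S}" "Suc (Suc s) \<in> {1..S}" using Suc.prems by auto
  interpret E: stochastic_epoch f \<phi> n L wstar \<tau>\<^sub>o \<gamma> \<eta>\<^sub>1 \<eta>\<^sub>2 M "F (Suc s)" m b c\<^sub>1 c\<^sub>2 \<beta>hat K "B (Suc s)"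
    "\<beta> (Suc s)" "t (Suc s)" "w (Suc s)" "v (Suc s)" "d (Suc s)" by (rule stochastic_epochI[OF s(1) K])
  obtain K' where K': "AE \<omega> in M. bounded_start K' (w (Suc s) m \<omega>) (v (Suc s) m \<omega>)
      \<and> bounded_start K' (w (Suc s) m \<omega>) (grad (w (Suc s) m \<omega>))" using E.epoch_end by blast
  have "AE \<omega> in M. bounded_start K' (w (Suc (Suc s)) 0 \<omega>) (d (Suc (Suc s)) 0 \<omega>)"
    using restart outer_start[OF s(2)] K'
  proof eventually_elim
    fix \<omega> assume r: "\<forall>s\<in>{1..S}. d s 0 \<omega> = - grad (w s 0 \<omega>) \<or> (2 \<le> s \<and> d s 0 \<omega> = - v (s-1) m \<omega>)"
      and "w (Suc (Suc s)) 0 \<omega> = wt (Suc (Suc s) - 1) \<omega>"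
      and k: "bounded_start K' (w (Suc s) m \<omega>) (v (Suc s) m \<omega>)
      \<and> bounded_start K' (w (Suc s) m \<omega>) (grad (w (Suc s) m \<omega>))"
    hence w1: "w (Suc (Suc s)) 0 \<omega> = w (Suc s) m \<omega>" by (simp add: outer_iterate_def)
    have "d (Suc (Suc s)) 0 \<omega> = - grad (w (Suc s) m \<omega>) \<or> d (Suc (Suc s)) 0 \<omega> = - v (Suc s) m \<omega>"
      using bspec[OF r s(2)] w1 by auto
    thus "bounded_start K' (w (Suc (Suc s)) 0 \<omega>) (d (Suc (Suc s)) 0 \<omega>)"
      using k unfolding w1 bounded_start_def by auto
  qed
  thus ?case by blast
qed

lemma expectation_gap_outer:
  assumes w\<^sub>0: "\<phi> w\<^sub>0 \<noteq> \<infinity>" and s: "s < S"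
  defines "\<xi>' \<equiv> 1 / ((real m + 1) * rate)"
  shows "(\<integral>\<omega>. gap (wt (Suc s) \<omega>) \<partial>M) \<le> \<xi>' * ((\<integral>\<omega>. gap (wt s \<omega>) \<partial>M) + \<gamma> / 2 * (2 + 4 * \<eta>\<^sub>2\<^sup>2) *
    epoch_error ((1 + c\<^sub>2) / (1 - c\<^sub>2)) \<beta>hat (\<integral>\<omega>. (norm (grad (wt s \<omega>)))\<^sup>2 \<partial>M)
        (\<integral>\<omega>. \<bar>(norm (d (Suc s) 0 \<omega>))\<^sup>2 - (norm (grad (wt s \<omega>)))\<^sup>2\<bar> \<partial>M)
        (\<integral>\<omega>. (norm (grad (wt s \<omega>) + d (Suc s) 0 \<omega>))\<^sup>2 \<partial>M))"
    and "integrable M (\<lambda>\<omega>. gap (wt (Suc s) \<omega>))"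
    and "AE \<omega> in M. \<phi> (wt (Suc s) \<omega>) \<noteq> \<infinity>"
proof -
  have s1: "Suc s \<in> {1..S}" using s by simp
  obtain K where K: "AE \<omega> in M. bounded_start K (w (Suc s) 0 \<omega>) (d (Suc s) 0 \<omega>)" using epoch_start[OF w\<^sub>0 s] by blast
  interpret E: stochastic_epoch f \<phi> n L wstar \<tau>\<^sub>o \<gamma> \<eta>\<^sub>1 \<eta>\<^sub>2 M "F (Suc s)" m b c\<^sub>1 c\<^sub>2 \<beta>hat K "B (Suc s)"
    "\<beta> (Suc s)" "t (Suc s)" "w (Suc s)" "v (Suc s)" "d (Suc s)" by (rule stochastic_epochI[OF s1 K])
  have wt_Suc: "wt (Suc s) = w (Suc s) m" by (rule ext) (simp add: outer_iterate_def)
  show "integrable M (\<lambda>\<omega>. gap (wt (Suc s) \<omega>))" unfolding wt_Suc by (rule E.integrable_gap) simp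
  show "AE \<omega> in M. \<phi> (wt (Suc s) \<omega>) \<noteq> \<infinity>"
    unfolding wt_Suc using E.AE_regular by eventually_elim (rule E.iterate_finite, auto)
  have w0: "AE \<omega> in M. w (Suc s) 0 \<omega> = wt s \<omega>" using outer_start[OF s1] by simp
  have v0: "AE \<omega> in M. v (Suc s) 0 \<omega> = grad (wt s \<omega>)"
    using w0 E.AE_regular by eventually_elim (simp add: E.estimator_start)
  have wtm: "wt s \<in> borel_measurable M"
  proof (cases s)
    case 0
    have "wt s = (\<lambda>\<omega>. w\<^sub>0)" using 0 by (auto simp: outer_iterate_def)
    thus ?thesis by simp
  next
    case (Suc j)
    hence "wt s = w s m" by (auto simp: outer_iterate_def)
    moreover have "w s m \<in> borel_measurable (F s m)" "subalgebra M (F s m)"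
      using adapted s Suc unfolding adapted_run_def by auto
    ultimately show ?thesis by (simp add: measurable_from_subalg)
  qed
  have gm: "(\<lambda>\<omega>. grad (wt s \<omega>)) \<in> borel_measurable M"
    using wtm E.grad_measurable by (rule measurable_compose)
  have gapm: "(\<lambda>\<omega>. gap (wt s \<omega>)) \<in> borel_measurable M"
    using wtm gap_measurable by (rule measurable_compose)
  note meas[measurable] = gm gapm E.measurable_processes(2,3)[of 0, simplified]
  have 1: "E.expected_gap 0 = (\<integral>\<omega>. gap (wt s \<omega>) \<partial>M)"
    unfolding E.expected_gap_def
  proof (rule integral_cong_AE)
    show "AE \<omega> in M. gap (w (Suc s) 0 \<omega>) = gap (wt s \<omega>)" using w0 by eventually_elim simp
    show "(\<lambda>\<omega>. gap (w (Suc s) 0 \<omega>)) \<in> borel_measurable M" using E.integrable_gap[of 0] by auto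
  qed (rule gapm)
  have 2: "(\<integral>\<omega>. (norm (v (Suc s) 0 \<omega>))\<^sup>2 \<partial>M) = (\<integral>\<omega>. (norm (grad (wt s \<omega>)))\<^sup>2 \<partial>M)"
  proof (rule integral_cong_AE)
    show "AE \<omega> in M. (norm (v (Suc s) 0 \<omega>))\<^sup>2 = (norm (grad (wt s \<omega>)))\<^sup>2" using v0 by eventually_elim simp
  qed measurable
  have 3: "(\<integral>\<omega>. \<bar>(norm (d (Suc s) 0 \<omega>))\<^sup>2 - (norm (v (Suc s) 0 \<omega>))\<^sup>2\<bar> \<partial>M)
      = (\<integral>\<omega>. \<bar>(norm (d (Suc s) 0 \<omega>))\<^sup>2 - (norm (grad (wt s \<omega>)))\<^sup>2\<bar> \<partial>M)"
  proof (rule integral_cong_AE)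
    show "AE \<omega> in M. \<bar>(norm (d (Suc s) 0 \<omega>))\<^sup>2 - (norm (v (Suc s) 0 \<omega>))\<^sup>2\<bar>
        = \<bar>(norm (d (Suc s) 0 \<omega>))\<^sup>2 - (norm (grad (wt s \<omega>)))\<^sup>2\<bar>" using v0 by eventually_elim simp
  qed measurable
  have 4: "(\<integral>\<omega>. (norm (v (Suc s) 0 \<omega> + d (Suc s) 0 \<omega>))\<^sup>2 \<partial>M)
      = (\<integral>\<omega>. (norm (grad (wt s \<omega>) + d (Suc s) 0 \<omega>))\<^sup>2 \<partial>M)"
  proof (rule integral_cong_AE)
    show "AE \<omega> in M. (norm (v (Suc s) 0 \<omega> + d (Suc s) 0 \<omega>))\<^sup>2 = (norm (grad (wt s \<omega>) + d (Suc s) 0 \<omega>))\<^sup>2"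
      using v0 by eventually_elim simp
  qed measurable
  show "(\<integral>\<omega>. gap (wt (Suc s) \<omega>) \<partial>M) \<le> \<xi>' * ((\<integral>\<omega>. gap (wt s \<omega>) \<partial>M) + \<gamma> / 2 * (2 + 4 * \<eta>\<^sub>2\<^sup>2) *
    epoch_error ((1 + c\<^sub>2) / (1 - c\<^sub>2)) \<beta>hat (\<integral>\<omega>. (norm (grad (wt s \<omega>)))\<^sup>2 \<partial>M)
        (\<integral>\<omega>. \<bar>(norm (d (Suc s) 0 \<omega>))\<^sup>2 - (norm (grad (wt s \<omega>)))\<^sup>2\<bar> \<partial>M)
        (\<integral>\<omega>. (norm (grad (wt s \<omega>) + d (Suc s) 0 \<omega>))\<^sup>2 \<partial>M))"
    using E.epoch_contraction unfolding 1 2 3 4 E.expected_gap_def[of m] wt_Suc \<xi>'_def .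
qed

end

lemma (in cg_method) convergence_of_run:
  fixes \<delta> :: "nat \<Rightarrow> real"
  assumes s: "s \<in> {1..S}" and r: "r = 1 / ((real m + 1) * rate)" "r < 1"
    and error: "\<And>j. j < s \<Longrightarrow> r * (\<gamma> / 2 * (2 + 4 * \<eta>\<^sub>2\<^sup>2) *
      epoch_error ((1 + c\<^sub>2) / (1 - c\<^sub>2)) \<beta>hat (\<integral>\<omega>. (norm (grad (wt j \<omega>)))\<^sup>2 \<partial>M)
        (\<integral>\<omega>. \<bar>(norm (d (Suc j) 0 \<omega>))\<^sup>2 - (norm (grad (wt j \<omega>)))\<^sup>2\<bar> \<partial>M)
        (\<integral>\<omega>. (norm (grad (wt j \<omega>) + d (Suc j) 0 \<omega>))\<^sup>2 \<partial>M)) \<le> \<delta> j"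
    and \<epsilon>: "\<epsilon> = Max (\<delta> ` {0..<s}) / (1 - r)"
  defines "P \<equiv> objective n f \<phi>"
  shows "ereal_expectation M (\<lambda>\<omega>. P (wt s \<omega>) - P wstar)
           \<le> ereal (r ^ s) * ereal_expectation M (\<lambda>\<omega>. P (wt 0 \<omega>) - P wstar - ereal \<epsilon>) + ereal \<epsilon>"
    and "linear_to_ball (\<lambda>j. ereal_expectation M (\<lambda>\<omega>. P (wt j \<omega>) - P wstar)) r \<epsilon> s"
proof -
  interpret prob_space M by (rule M_prob)
  have r0: "0 < r" using rate_pos by (simp add: r)
  have w0: "wt 0 \<omega> = w\<^sub>0" for \<omega> by (simp add: outer_iterate_def)
  have s1: "1 \<le> s" using s by simp
  have int: "integrable M (\<lambda>\<omega>. gap (wt j \<omega>))" if "\<phi> w\<^sub>0 \<noteq> \<infinity>" "j \<le> s" for j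
  proof (cases j)
    case (Suc i)
    show ?thesis unfolding Suc by (rule expectation_gap_outer(2)[OF that(1)]) (use that s Suc in auto)
  qed (simp add: w0)
  have fin: "AE \<omega> in M. \<phi> (wt j \<omega>) \<noteq> \<infinity>" if "\<phi> w\<^sub>0 \<noteq> \<infinity>" "j \<le> s" for j
  proof (cases j)
    case (Suc i)
    show ?thesis unfolding Suc by (rule expectation_gap_outer(3)[OF that(1)]) (use that s Suc in auto)
  qed (use that in \<open>simp add: w0\<close>)
  have step: "(\<integral>\<omega>. gap (wt (Suc j) \<omega>) \<partial>M) \<le> r * (\<integral>\<omega>. gap (wt j \<omega>) \<partial>M) + \<delta> j"
    if "\<phi> w\<^sub>0 \<noteq> \<infinity>" "j < s" for j
  proof -
    have "j < S" using that s by simp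
    from expectation_gap_outer(1)[OF that(1) this] error[OF that(2)]
    show ?thesis unfolding r(1)[symmetric] distrib_left[of r] by (rule order_trans[OF _ add_left_mono])
  qed
  show "ereal_expectation M (\<lambda>\<omega>. P (wt s \<omega>) - P wstar)
           \<le> ereal (r ^ s) * ereal_expectation M (\<lambda>\<omega>. P (wt 0 \<omega>) - P wstar - ereal \<epsilon>) + ereal \<epsilon>"
    and "linear_to_ball (\<lambda>j. ereal_expectation M (\<lambda>\<omega>. P (wt j \<omega>) - P wstar)) r \<epsilon> s"
    unfolding P_def
    by (rule linear_convergence_of_gaps[OF M_prob w0 r0 r(2) s1 int fin step \<epsilon>], assumption+)+
qed

text \<open>The constant \<open>C\<close> of the theorem is the one for which the error terms of an epoch factor through
the coefficient of the squared gradient.\<close>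

lemma epoch_error_constant_le:
  fixes \<beta> :: real
  assumes "0 < \<beta>" "\<beta> < 1" "\<Phi> \<le> \<alpha>" "0 < \<alpha>" "0 \<le> N" "\<Delta> \<le> \<tau> * \<sigma>\<^sup>2" "E \<le> \<sigma>\<^sup>2" "0 \<le> g"
  shows "g * epoch_error \<Phi> \<beta> N \<Delta> E
    \<le> g * (\<alpha> * \<beta>\<^sup>2 / ((1 - \<beta>)\<^sup>2 * (1 + \<beta>))) *
      (N + ((1 - \<beta>) / \<alpha> * \<tau> + (1 - \<beta>)\<^sup>2 * (1 + \<beta>) / (2 * \<alpha> * \<beta>\<^sup>2)) * \<sigma>\<^sup>2)"
proof -
  define k where "k = \<beta>\<^sup>2 / ((1 - \<beta>)\<^sup>2 * (1 + \<beta>))"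
  have k: "0 < k" using assms by (simp add: k_def)
  have sq: "1 - \<beta>\<^sup>2 = (1 - \<beta>) * (1 + \<beta>)" by (simp add: power2_eq_square algebra_simps)
  have b: "0 < \<beta>\<^sup>2 / (1 - \<beta>\<^sup>2)" unfolding sq using assms by simp
  have k1: "k * (1 - \<beta>) = \<beta>\<^sup>2 / (1 - \<beta>\<^sup>2)" unfolding sq k_def using assms by (simp add: power2_eq_square)
  define z where "z = (1 - \<beta>)\<^sup>2 * (1 + \<beta>) / \<beta>\<^sup>2"
  have k2: "k * z = 1" unfolding k_def z_def using assms by simp
  have z: "(1 - \<beta>)\<^sup>2 * (1 + \<beta>) / (2 * \<alpha> * \<beta>\<^sup>2) = z / (2 * \<alpha>)" by (simp add: z_def ac_simps)
  have "\<Phi> * k * N + \<beta>\<^sup>2 / (1 - \<beta>\<^sup>2) * \<Delta> + 1/2 * E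
      \<le> \<alpha> * k * N + \<beta>\<^sup>2 / (1 - \<beta>\<^sup>2) * (\<tau> * \<sigma>\<^sup>2) + 1/2 * \<sigma>\<^sup>2"
    using assms k b by (intro add_mono mult_right_mono mult_left_mono) auto
  also have "\<dots> = \<alpha> * k * N + k * (1 - \<beta>) * (\<tau> * \<sigma>\<^sup>2) + k * z * (1/2 * \<sigma>\<^sup>2)"
    unfolding k1 k2 by simp
  also have "\<dots> = \<alpha> * k * (N + ((1 - \<beta>) / \<alpha> * \<tau> + (1 - \<beta>)\<^sup>2 * (1 + \<beta>) / (2 * \<alpha> * \<beta>\<^sup>2)) * \<sigma>\<^sup>2)"
    unfolding z using assms(4) by (simp add: distrib_left distrib_right)
  finally have "g * (\<Phi> * k * N + \<beta>\<^sup>2 / (1 - \<beta>\<^sup>2) * \<Delta> + 1/2 * E)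
      \<le> g * (\<alpha> * k * (N + ((1 - \<beta>) / \<alpha> * \<tau> + (1 - \<beta>)\<^sup>2 * (1 + \<beta>) / (2 * \<alpha> * \<beta>\<^sup>2)) * \<sigma>\<^sup>2))"
    using assms(8) by (rule mult_left_mono)
  thus ?thesis by (simp add: k_def epoch_error_def mult.assoc)
qed

theorem corollary2:
  fixes f :: "nat \<Rightarrow> real ^ 'd \<Rightarrow> real" and \<phi> :: "real ^ 'd \<Rightarrow> ereal"
    and n m b S :: nat
    and \<gamma> \<eta>\<^sub>1 \<eta>\<^sub>2 c\<^sub>1 c\<^sub>2 L \<beta>hat \<sigma> \<tau> \<alpha> \<tau>\<^sub>o \<xi> C \<xi>' :: real
    and w\<^sub>0 wstar :: "real ^ 'd"
    and M :: "'w measure" and F :: "nat \<Rightarrow> nat \<Rightarrow> 'w measure"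
    and B :: "nat \<Rightarrow> nat \<Rightarrow> 'w \<Rightarrow> nat set" and \<beta> t :: "nat \<Rightarrow> nat \<Rightarrow> 'w \<Rightarrow> real"
    and w v d :: "nat \<Rightarrow> nat \<Rightarrow> 'w \<Rightarrow> real ^ 'd"
    and \<delta>1 \<delta>2 \<epsilon>1 \<epsilon>2 :: "nat \<Rightarrow> real"
  defines "P \<equiv> objective n f \<phi>"
    and "wtilde \<equiv> outer_iterate w\<^sub>0 m w"
  assumes "n \<ge> 1" and "1 \<le> b" and "b \<le> n" and "m \<ge> 1"
    and "0 < \<gamma>" and "\<gamma> \<le> 1" and "0 < \<eta>\<^sub>1" and "\<eta>\<^sub>1 \<le> \<eta>\<^sub>2"
    and "0 < c\<^sub>1" and "c\<^sub>1 < c\<^sub>2" and "c\<^sub>2 < 1"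
    and smooth: "\<And>i x. i \<in> {1..n} \<Longrightarrow> f i differentiable (at x)"
    and phi: "closed_proper_convex \<phi>"
    and bounded_below: "\<exists>l::real. \<forall>x. ereal l \<le> P x"
    \<comment> \<open>Assumption 1\<close>
    and "0 < L"
    and A1: "\<And>x y. (\<Sum>i\<in>{1..n}. (norm (gradient (f i) x - gradient (f i) y))\<^sup>2) / real n
                     \<le> L\<^sup>2 * (norm (x - y))\<^sup>2"
    \<comment> \<open>Assumption 2\<close>
    and "0 < \<beta>hat" and "\<beta>hat < 1"
    and A2: "AE \<omega> in M. \<forall>s\<in>{1..S}. \<forall>k\<le>m. (norm (v s (k+1) \<omega>))\<^sup>2 \<le> \<beta>hat * (norm (v s k \<omega>))\<^sup>2"
    and "1 < \<alpha>" and "(1 + c\<^sub>2) / (1 - c\<^sub>2) \<le> \<alpha>"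
    and minimizer: "is_arg_min P (\<lambda>_. True) wstar"
    and unique: "\<And>x. is_arg_min P (\<lambda>_. True) x \<Longrightarrow> x = wstar"
    and "0 < \<tau>\<^sub>o" and dominant: "gradient_dominant \<tau>\<^sub>o n f \<phi> wstar"
    and steps: "AE \<omega> in M. \<forall>s\<in>{1..S}. \<forall>k\<le>m. t s k \<omega> \<in> {\<eta>\<^sub>1, \<eta>\<^sub>2}"
    and params: "(2 + 4 * \<eta>\<^sub>2\<^sup>2) * ((real n - real b) / (real b * (real n - 1))) * L\<^sup>2 * \<gamma>\<^sup>2 * real m
                   - (2 / \<eta>\<^sub>2 - L * \<gamma> - 3) \<le> 0"
    and xi: "\<xi> = (2 + 4 * \<eta>\<^sub>2\<^sup>2) * \<alpha> * \<beta>hat\<^sup>2 /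
                   ((real m + 1) * \<eta>\<^sub>1\<^sup>2 * (1 - \<beta>hat)\<^sup>2 * (1 + \<beta>hat))"
    and C: "C = ((1 - \<beta>hat) / \<alpha> * \<tau> + (1 - \<beta>hat)\<^sup>2 * (1 + \<beta>hat) / (2 * \<alpha> * \<beta>hat\<^sup>2)) * \<sigma>\<^sup>2"
    and xi': "\<xi>' = \<tau>\<^sub>o / ((real m + 1) * \<eta>\<^sub>1\<^sup>2 * \<gamma>)" and "\<xi>' < 1"
    and delta1: "\<And>k. \<delta>1 k = \<tau>\<^sub>o * \<xi> / 2 *
                   ((\<integral>\<omega>. (norm (gradient (full_fun n f) (wtilde k \<omega>)))\<^sup>2 \<partial>M) + C)"
    and eps1: "\<And>s. \<epsilon>1 s = Max (\<delta>1 ` {0..<s}) / (1 - \<xi>')"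
    and delta2: "\<And>k. \<delta>2 k = \<tau>\<^sub>o * \<xi> / 2 *
                   (\<integral>\<omega>. (norm (gradient (full_fun n f) (wtilde k \<omega>)))\<^sup>2 \<partial>M)"
    and eps2: "\<And>s. \<epsilon>2 s = Max (\<delta>2 ` {0..<s}) / (1 - \<xi>')"
  shows
    "(algorithm1 M F n f \<phi> m b \<gamma> \<eta>\<^sub>2 c\<^sub>1 c\<^sub>2 w\<^sub>0 S B \<beta> t w v d \<longrightarrow>
      0 < \<sigma> \<longrightarrow> 0 < \<tau> \<longrightarrow>
      \<comment> \<open>Assumption 3\<close>
      (\<forall>s\<in>{1..S}. \<forall>k\<le>m+1.
         (\<integral>\<^sup>+\<omega>. ennreal ((norm (v s k \<omega> - gradient (full_fun n f) (w s k \<omega>)))\<^sup>2) \<partial>M)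
           \<le> ennreal (\<sigma>\<^sup>2)) \<longrightarrow>
      (\<forall>s\<in>{1..S}. \<forall>k\<le>m+1.
         (\<integral>\<^sup>+\<omega>. ennreal \<bar>(norm (v s k \<omega>))\<^sup>2 - (norm (gradient (full_fun n f) (w s k \<omega>)))\<^sup>2\<bar> \<partial>M)
           \<le> ennreal (\<tau> * \<sigma>\<^sup>2)) \<longrightarrow>
      (\<forall>s\<in>{1..S}.
         0 < \<epsilon>1 s \<and>
         ereal_expectation M (\<lambda>\<omega>. P (wtilde s \<omega>) - P wstar)
           \<le> ereal (\<xi>' ^ s) * ereal_expectation M (\<lambda>\<omega>. P (wtilde 0 \<omega>) - P wstar - ereal (\<epsilon>1 s))
               + ereal (\<epsilon>1 s) \<and>
         linear_to_ball (\<lambda>j. ereal_expectation M (\<lambda>\<omega>. P (wtilde j \<omega>) - P wstar)) \<xi>' (\<epsilon>1 s) s)) \<and>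
     (algorithm2 M F n f \<phi> m b \<gamma> \<eta>\<^sub>2 c\<^sub>1 c\<^sub>2 w\<^sub>0 S B \<beta> t w v d \<longrightarrow>
      (\<forall>s\<in>{1..S}.
         (gradient (full_fun n f) w\<^sub>0 \<noteq> 0 \<longrightarrow> 0 < \<epsilon>2 s) \<and>
         ereal_expectation M (\<lambda>\<omega>. P (wtilde s \<omega>) - P wstar)
           \<le> ereal (\<xi>' ^ s) * ereal_expectation M (\<lambda>\<omega>. P (wtilde 0 \<omega>) - P wstar - ereal (\<epsilon>2 s))
               + ereal (\<epsilon>2 s) \<and>
         linear_to_ball (\<lambda>j. ereal_expectation M (\<lambda>\<omega>. P (wtilde j \<omega>) - P wstar)) \<xi>' (\<epsilon>2 s) s))"
proof -
  have c\<^sub>2: "0 < c\<^sub>2" "c\<^sub>2 < 1" using \<open>0 < c\<^sub>1\<close> \<open>c\<^sub>1 < c\<^sub>2\<close> \<open>c\<^sub>2 < 1\<close> by auto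
  have "0 \<le> (2 + 4 * \<eta>\<^sub>2\<^sup>2) * ((real n - real b) / (real b * (real n - 1))) * L\<^sup>2 * \<gamma>\<^sup>2 * real m"
    using \<open>n \<ge> 1\<close> \<open>b \<le> n\<close> by (intro mult_nonneg_nonneg) auto
  hence bound: "0 \<le> 2 / \<eta>\<^sub>2 - L * \<gamma> - 3" using params by linarith
  have min: "objective n f \<phi> wstar \<le> objective n f \<phi> x" for x
    using minimizer unfolding is_arg_min_linorder P_def by blast
  interpret dominant_problem f \<phi> n L wstar \<tau>\<^sub>o \<gamma> \<eta>\<^sub>1 \<eta>\<^sub>2
    by unfold_locales (fact | rule smooth A1 min bound)+
  have rate: "\<xi>' = 1 / ((real m + 1) * rate)" by (simp add: xi' rate_def)
  have \<xi>'0: "0 < \<xi>'" using rate_pos by (simp add: rate)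
  have \<alpha>: "0 < \<alpha>" using \<open>1 < \<alpha>\<close> by simp
  \<comment> \<open>\<open>g\<close> converts the error of an epoch into its share of the gap; with the coefficient of \<open>N\<close> it becomes \<open>\<tau>\<^sub>o \<xi> / 2\<close>\<close>
  define g where "g = \<xi>' * (\<gamma> / 2 * (2 + 4 * \<eta>\<^sub>2\<^sup>2))"
  have g: "0 \<le> g" using \<xi>'0 \<gamma> by (simp add: g_def)
  have coeff: "g * (\<alpha> * \<beta>hat\<^sup>2 / ((1 - \<beta>hat)\<^sup>2 * (1 + \<beta>hat))) = \<tau>\<^sub>o * \<xi> / 2"
    using \<gamma> unfolding g_def xi xi' by (simp add: ac_simps)
  have \<xi>: "0 < \<xi>" unfolding xi
    using \<open>0 < \<beta>hat\<close> \<open>\<beta>hat < 1\<close> \<alpha> \<eta>\<^sub>1 by (intro divide_pos_pos mult_pos_pos) (auto intro: add_pos_nonneg)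
  have curvature: "(2 + 4 * \<eta>\<^sub>2\<^sup>2) * ((real n - real b) / (real b * (real n - 1))) * L\<^sup>2 * \<gamma>\<^sup>2 * real m
                   \<le> 2 / \<eta>\<^sub>2 - L * \<gamma> - 3" using params by linarith
  have \<epsilon>_pos: "0 < Max (\<delta> ` {0..<s}) / (1 - \<xi>')" if "s \<in> {1..S}" "0 < \<delta> 0" for s and \<delta> :: "nat \<Rightarrow> real"
  proof -
    have "\<delta> 0 \<le> Max (\<delta> ` {0..<s})" using that by (intro Max_ge) auto
    thus ?thesis using that(2) \<open>\<xi>' < 1\<close> by simp
  qed
  have cg_instance: "cg_method f \<phi> n L wstar \<tau>\<^sub>o \<gamma> \<eta>\<^sub>1 \<eta>\<^sub>2 M F m b S c\<^sub>1 c\<^sub>2 \<beta>hat B \<beta> t w v d w\<^sub>0 d_init"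
    if "cg_run d_init M F n f \<phi> m b \<gamma> \<eta>\<^sub>2 c\<^sub>1 c\<^sub>2 w\<^sub>0 S B \<beta> t w v d"
      "AE \<omega> in M. \<forall>s\<in>{1..S}. d s 0 \<omega> = - grad (w s 0 \<omega>) \<or> (2 \<le> s \<and> d s 0 \<omega> = - v (s-1) m \<omega>)" for d_init
    by unfold_locales (fact | rule that c\<^sub>2 A2 steps curvature)+
  have start: "AE \<omega> in M. \<forall>s\<in>{1..S}. w s 0 \<omega> = wtilde (s-1) \<omega> \<and> d s 0 \<omega> = d_init s \<omega>"
    if "cg_run d_init M F n f \<phi> m b \<gamma> \<eta>\<^sub>2 c\<^sub>1 c\<^sub>2 w\<^sub>0 S B \<beta> t w v d" for d_init
  proof -
    have "AE \<omega> in M. \<forall>s\<in>{1..S}. w s 0 \<omega> = wtilde (s - 1) \<omega> \<and> d s 0 \<omega> = d_init s \<omega> \<and>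
        cg_epoch n f \<phi> m \<gamma> \<eta>\<^sub>2 c\<^sub>1 c\<^sub>2 (\<lambda>k. B s k \<omega>) (\<lambda>k. \<beta> s k \<omega>) (\<lambda>k. t s k \<omega>)
          (\<lambda>k. w s k \<omega>) (\<lambda>k. v s k \<omega>) (\<lambda>k. d s k \<omega>)"
      using that by (simp add: cg_run_def wtilde_def)
    thus ?thesis by eventually_elim blast
  qed
  show ?thesis
  proof (intro conjI impI ballI)
    assume alg: "algorithm1 M F n f \<phi> m b \<gamma> \<eta>\<^sub>2 c\<^sub>1 c\<^sub>2 w\<^sub>0 S B \<beta> t w v d" and \<sigma>: "0 < \<sigma>" and \<tau>: "0 < \<tau>"
      and A3: "\<forall>s\<in>{1..S}. \<forall>k\<le>m+1. (\<integral>\<^sup>+\<omega>. ennreal ((norm (v s k \<omega> - grad (w s k \<omega>)))\<^sup>2) \<partial>M) \<le> ennreal (\<sigma>\<^sup>2)"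
      and norms: "\<forall>s\<in>{1..S}. \<forall>k\<le>m+1.
         (\<integral>\<^sup>+\<omega>. ennreal \<bar>(norm (v s k \<omega>))\<^sup>2 - (norm (grad (w s k \<omega>)))\<^sup>2\<bar> \<partial>M) \<le> ennreal (\<tau> * \<sigma>\<^sup>2)"
    fix s assume s: "s \<in> {1..S}"
    define d_init where "d_init = (\<lambda>s \<omega>. - (if s = 1 then grad w\<^sub>0 else v (s-1) m \<omega>))"
    have run: "cg_run d_init M F n f \<phi> m b \<gamma> \<eta>\<^sub>2 c\<^sub>1 c\<^sub>2 w\<^sub>0 S B \<beta> t w v d"
      using alg unfolding algorithm1_def d_init_def .
    interpret R: cg_method f \<phi> n L wstar \<tau>\<^sub>o \<gamma> \<eta>\<^sub>1 \<eta>\<^sub>2 M F m b S c\<^sub>1 c\<^sub>2 \<beta>hat B \<beta> t w v d w\<^sub>0 d_init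
    proof (rule cg_instance[OF run])
      show "AE \<omega> in M. \<forall>s\<in>{1..S}. d s 0 \<omega> = - grad (w s 0 \<omega>) \<or> (2 \<le> s \<and> d s 0 \<omega> = - v (s-1) m \<omega>)"
        using start[OF run]
      proof eventually_elim
        fix \<omega> assume a: "\<forall>s\<in>{1..S}. w s 0 \<omega> = wtilde (s-1) \<omega> \<and> d s 0 \<omega> = d_init s \<omega>"
        show "\<forall>s\<in>{1..S}. d s 0 \<omega> = - grad (w s 0 \<omega>) \<or> (2 \<le> s \<and> d s 0 \<omega> = - v (s-1) m \<omega>)"
        proof
          fix s assume s: "s \<in> {1..S}"
          show "d s 0 \<omega> = - grad (w s 0 \<omega>) \<or> (2 \<le> s \<and> d s 0 \<omega> = - v (s-1) m \<omega>)"
          proof (cases "s = 1")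
            case True
            thus ?thesis using bspec[OF a s] by (simp add: wtilde_def outer_iterate_def d_init_def)
          next
            case False
            thus ?thesis using bspec[OF a s] s by (simp add: d_init_def)
          qed
        qed
      qed
    qed
    \<comment> \<open>the first epoch starts with the exact gradient, a later one with the final estimator \<open>v j m\<close> of its predecessor\<close>
    have E: "(\<integral>\<omega>. (norm (grad (wtilde j \<omega>) + d (Suc j) 0 \<omega>))\<^sup>2 \<partial>M) \<le> \<sigma>\<^sup>2"
      and D: "(\<integral>\<omega>. \<bar>(norm (d (Suc j) 0 \<omega>))\<^sup>2 - (norm (grad (wtilde j \<omega>)))\<^sup>2\<bar> \<partial>M) \<le> \<tau> * \<sigma>\<^sup>2" if j: "j < s" for j
    proof -
      have js: "Suc j \<in> {1..S}" using j s by simp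
      have d0: "AE \<omega> in M. d (Suc j) 0 \<omega> = d_init (Suc j) \<omega>"
        using start[OF run] by eventually_elim (use js in blast)
      have "(\<integral>\<^sup>+\<omega>. ennreal ((norm (grad (wtilde j \<omega>) + d (Suc j) 0 \<omega>))\<^sup>2) \<partial>M) \<le> ennreal (\<sigma>\<^sup>2) \<and>
          (\<integral>\<^sup>+\<omega>. ennreal \<bar>(norm (d (Suc j) 0 \<omega>))\<^sup>2 - (norm (grad (wtilde j \<omega>)))\<^sup>2\<bar> \<partial>M) \<le> ennreal (\<tau> * \<sigma>\<^sup>2)"
      proof (cases "j = 0")
        case True
        have "(\<integral>\<^sup>+\<omega>. ennreal ((norm (grad (wtilde j \<omega>) + d (Suc j) 0 \<omega>))\<^sup>2) \<partial>M) = (\<integral>\<^sup>+\<omega>. 0 \<partial>M)"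
          by (rule nn_integral_cong_AE) (use d0 in eventually_elim, simp add: True wtilde_def outer_iterate_def d_init_def)
        moreover have "(\<integral>\<^sup>+\<omega>. ennreal \<bar>(norm (d (Suc j) 0 \<omega>))\<^sup>2 - (norm (grad (wtilde j \<omega>)))\<^sup>2\<bar> \<partial>M) = (\<integral>\<^sup>+\<omega>. 0 \<partial>M)"
          by (rule nn_integral_cong_AE) (use d0 in eventually_elim, simp add: True wtilde_def outer_iterate_def d_init_def)
        ultimately show ?thesis by simp
      next
        case False
        hence jS: "j \<in> {1..S}" using js by simp
        have "(\<integral>\<^sup>+\<omega>. ennreal ((norm (grad (wtilde j \<omega>) + d (Suc j) 0 \<omega>))\<^sup>2) \<partial>M)
            = (\<integral>\<^sup>+\<omega>. ennreal ((norm (v j m \<omega> - grad (w j m \<omega>)))\<^sup>2) \<partial>M)"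
          by (rule nn_integral_cong_AE)
             (use d0 in eventually_elim, use False in \<open>simp add: wtilde_def outer_iterate_def d_init_def norm_minus_commute\<close>)
        also have "\<dots> \<le> ennreal (\<sigma>\<^sup>2)" using A3[rule_format, OF jS, of m] by simp
        finally have 1: "(\<integral>\<^sup>+\<omega>. ennreal ((norm (grad (wtilde j \<omega>) + d (Suc j) 0 \<omega>))\<^sup>2) \<partial>M) \<le> ennreal (\<sigma>\<^sup>2)" .
        have "(\<integral>\<^sup>+\<omega>. ennreal \<bar>(norm (d (Suc j) 0 \<omega>))\<^sup>2 - (norm (grad (wtilde j \<omega>)))\<^sup>2\<bar> \<partial>M)
            = (\<integral>\<^sup>+\<omega>. ennreal \<bar>(norm (v j m \<omega>))\<^sup>2 - (norm (grad (w j m \<omega>)))\<^sup>2\<bar> \<partial>M)"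
          by (rule nn_integral_cong_AE)
             (use d0 in eventually_elim, use False in \<open>simp add: wtilde_def outer_iterate_def d_init_def\<close>)
        also have "\<dots> \<le> ennreal (\<tau> * \<sigma>\<^sup>2)" using norms[rule_format, OF jS, of m] by simp
        finally show ?thesis using 1 by blast
      qed
      thus "(\<integral>\<omega>. (norm (grad (wtilde j \<omega>) + d (Suc j) 0 \<omega>))\<^sup>2 \<partial>M) \<le> \<sigma>\<^sup>2"
        and "(\<integral>\<omega>. \<bar>(norm (d (Suc j) 0 \<omega>))\<^sup>2 - (norm (grad (wtilde j \<omega>)))\<^sup>2\<bar> \<partial>M) \<le> \<tau> * \<sigma>\<^sup>2"
        using \<tau> by (auto intro!: integral_real_bounded)
    qed
    have error: "\<xi>' * (\<gamma> / 2 * (2 + 4 * \<eta>\<^sub>2\<^sup>2) *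
      epoch_error ((1 + c\<^sub>2) / (1 - c\<^sub>2)) \<beta>hat (\<integral>\<omega>. (norm (grad (wtilde j \<omega>)))\<^sup>2 \<partial>M)
        (\<integral>\<omega>. \<bar>(norm (d (Suc j) 0 \<omega>))\<^sup>2 - (norm (grad (wtilde j \<omega>)))\<^sup>2\<bar> \<partial>M)
        (\<integral>\<omega>. (norm (grad (wtilde j \<omega>) + d (Suc j) 0 \<omega>))\<^sup>2 \<partial>M)) \<le> \<delta>1 j" if "j < s" for j
    proof -
      have "g * epoch_error ((1 + c\<^sub>2) / (1 - c\<^sub>2)) \<beta>hat (\<integral>\<omega>. (norm (grad (wtilde j \<omega>)))\<^sup>2 \<partial>M)
        (\<integral>\<omega>. \<bar>(norm (d (Suc j) 0 \<omega>))\<^sup>2 - (norm (grad (wtilde j \<omega>)))\<^sup>2\<bar> \<partial>M)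
        (\<integral>\<omega>. (norm (grad (wtilde j \<omega>) + d (Suc j) 0 \<omega>))\<^sup>2 \<partial>M)
       \<le> g * (\<alpha> * \<beta>hat\<^sup>2 / ((1 - \<beta>hat)\<^sup>2 * (1 + \<beta>hat))) * ((\<integral>\<omega>. (norm (grad (wtilde j \<omega>)))\<^sup>2 \<partial>M) + C)"
        unfolding C
        by (rule epoch_error_constant_le[OF \<open>0 < \<beta>hat\<close> \<open>\<beta>hat < 1\<close> \<open>(1 + c\<^sub>2) / (1 - c\<^sub>2) \<le> \<alpha>\<close> \<alpha> _ D[OF that] E[OF that] g]) simp
      from this[unfolded coeff, unfolded g_def mult.assoc[of \<xi>']] show ?thesis unfolding delta1 .
    qed
    note conv = R.convergence_of_run[OF s rate \<open>\<xi>' < 1\<close>, folded wtilde_def P_def, OF error eps1]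
    have "0 \<le> (\<integral>\<omega>. (norm (grad (wtilde 0 \<omega>)))\<^sup>2 \<partial>M)" by simp
    moreover have "0 < C" unfolding C using \<sigma> \<tau> \<alpha> \<open>0 < \<beta>hat\<close> \<open>\<beta>hat < 1\<close>
      by (intro mult_pos_pos add_pos_pos divide_pos_pos) auto
    ultimately have "0 < \<delta>1 0"
      unfolding delta1 using \<tau>\<^sub>o \<xi> by (intro mult_pos_pos divide_pos_pos add_nonneg_pos) simp_all
    thus "0 < \<epsilon>1 s" unfolding eps1 by (rule \<epsilon>_pos[OF s])
    show "ereal_expectation M (\<lambda>\<omega>. P (wtilde s \<omega>) - P wstar)
           \<le> ereal (\<xi>' ^ s) * ereal_expectation M (\<lambda>\<omega>. P (wtilde 0 \<omega>) - P wstar - ereal (\<epsilon>1 s))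
               + ereal (\<epsilon>1 s)" by (rule conv(1))
    show "linear_to_ball (\<lambda>j. ereal_expectation M (\<lambda>\<omega>. P (wtilde j \<omega>) - P wstar)) \<xi>' (\<epsilon>1 s) s" by (rule conv(2))
  next
    assume alg: "algorithm2 M F n f \<phi> m b \<gamma> \<eta>\<^sub>2 c\<^sub>1 c\<^sub>2 w\<^sub>0 S B \<beta> t w v d"
    fix s assume s: "s \<in> {1..S}"
    have run: "cg_run (\<lambda>s \<omega>. - grad (w s 0 \<omega>)) M F n f \<phi> m b \<gamma> \<eta>\<^sub>2 c\<^sub>1 c\<^sub>2 w\<^sub>0 S B \<beta> t w v d"
      using alg unfolding algorithm2_def .
    interpret R: cg_method f \<phi> n L wstar \<tau>\<^sub>o \<gamma> \<eta>\<^sub>1 \<eta>\<^sub>2 M F m b S c\<^sub>1 c\<^sub>2 \<beta>hat B \<beta> t w v d w\<^sub>0 "\<lambda>s \<omega>. - grad (w s 0 \<omega>)"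
      by (rule cg_instance[OF run]) (use start[OF run] in eventually_elim, blast)
    \<comment> \<open>there is no mismatch; the zeros stand for \<open>\<tau>\<close> and \<open>\<sigma>\<close> in the constant of the first algorithm\<close>
    have E: "(\<integral>\<omega>. (norm (grad (wtilde j \<omega>) + d (Suc j) 0 \<omega>))\<^sup>2 \<partial>M) \<le> 0\<^sup>2"
      and D: "(\<integral>\<omega>. \<bar>(norm (d (Suc j) 0 \<omega>))\<^sup>2 - (norm (grad (wtilde j \<omega>)))\<^sup>2\<bar> \<partial>M) \<le> 0 * 0\<^sup>2" if j: "j < s" for j
    proof -
      have js: "Suc j \<in> {1..S}" using j s by simp
      have d0: "AE \<omega> in M. d (Suc j) 0 \<omega> = - grad (wtilde j \<omega>)"
        using start[OF run]
      proof eventually_elim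
        fix \<omega> assume a: "\<forall>s\<in>{1..S}. w s 0 \<omega> = wtilde (s-1) \<omega> \<and> d s 0 \<omega> = - grad (w s 0 \<omega>)"
        show "d (Suc j) 0 \<omega> = - grad (wtilde j \<omega>)" using bspec[OF a js] by simp
      qed
      have "(\<integral>\<^sup>+\<omega>. ennreal ((norm (grad (wtilde j \<omega>) + d (Suc j) 0 \<omega>))\<^sup>2) \<partial>M) = (\<integral>\<^sup>+\<omega>. 0 \<partial>M)"
        by (rule nn_integral_cong_AE) (use d0 in eventually_elim, simp)
      moreover have "(\<integral>\<^sup>+\<omega>. ennreal \<bar>(norm (d (Suc j) 0 \<omega>))\<^sup>2 - (norm (grad (wtilde j \<omega>)))\<^sup>2\<bar> \<partial>M) = (\<integral>\<^sup>+\<omega>. 0 \<partial>M)"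
        by (rule nn_integral_cong_AE) (use d0 in eventually_elim, simp)
      ultimately show "(\<integral>\<omega>. (norm (grad (wtilde j \<omega>) + d (Suc j) 0 \<omega>))\<^sup>2 \<partial>M) \<le> 0\<^sup>2"
        and "(\<integral>\<omega>. \<bar>(norm (d (Suc j) 0 \<omega>))\<^sup>2 - (norm (grad (wtilde j \<omega>)))\<^sup>2\<bar> \<partial>M) \<le> 0 * 0\<^sup>2"
        by (auto intro!: integral_real_bounded)
    qed
    have error: "\<xi>' * (\<gamma> / 2 * (2 + 4 * \<eta>\<^sub>2\<^sup>2) *
      epoch_error ((1 + c\<^sub>2) / (1 - c\<^sub>2)) \<beta>hat (\<integral>\<omega>. (norm (grad (wtilde j \<omega>)))\<^sup>2 \<partial>M)
        (\<integral>\<omega>. \<bar>(norm (d (Suc j) 0 \<omega>))\<^sup>2 - (norm (grad (wtilde j \<omega>)))\<^sup>2\<bar> \<partial>M)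
        (\<integral>\<omega>. (norm (grad (wtilde j \<omega>) + d (Suc j) 0 \<omega>))\<^sup>2 \<partial>M)) \<le> \<delta>2 j" if "j < s" for j
    proof -
      have "g * epoch_error ((1 + c\<^sub>2) / (1 - c\<^sub>2)) \<beta>hat (\<integral>\<omega>. (norm (grad (wtilde j \<omega>)))\<^sup>2 \<partial>M)
        (\<integral>\<omega>. \<bar>(norm (d (Suc j) 0 \<omega>))\<^sup>2 - (norm (grad (wtilde j \<omega>)))\<^sup>2\<bar> \<partial>M)
        (\<integral>\<omega>. (norm (grad (wtilde j \<omega>) + d (Suc j) 0 \<omega>))\<^sup>2 \<partial>M)
       \<le> g * (\<alpha> * \<beta>hat\<^sup>2 / ((1 - \<beta>hat)\<^sup>2 * (1 + \<beta>hat))) * ((\<integral>\<omega>. (norm (grad (wtilde j \<omega>)))\<^sup>2 \<partial>M) +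
          ((1 - \<beta>hat) / \<alpha> * 0 + (1 - \<beta>hat)\<^sup>2 * (1 + \<beta>hat) / (2 * \<alpha> * \<beta>hat\<^sup>2)) * 0\<^sup>2)"
        by (rule epoch_error_constant_le[OF \<open>0 < \<beta>hat\<close> \<open>\<beta>hat < 1\<close> \<open>(1 + c\<^sub>2) / (1 - c\<^sub>2) \<le> \<alpha>\<close> \<alpha> _ D[OF that] E[OF that] g]) simp
      from this[unfolded coeff, unfolded g_def mult.assoc[of \<xi>'] power_zero_numeral mult_zero_right add_0_right]
      show ?thesis unfolding delta2 .
    qed
    note conv = R.convergence_of_run[OF s rate \<open>\<xi>' < 1\<close>, folded wtilde_def P_def, OF error eps2]
    show "0 < \<epsilon>2 s" if "grad w\<^sub>0 \<noteq> 0"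
    proof -
      interpret prob_space M by (rule R.M_prob)
      have "(\<integral>\<omega>. (norm (grad (wtilde 0 \<omega>)))\<^sup>2 \<partial>M) = (norm (grad w\<^sub>0))\<^sup>2"
        by (simp add: wtilde_def outer_iterate_def prob_space)
      hence "0 < \<delta>2 0" unfolding delta2 using \<tau>\<^sub>o \<xi> that by simp
      thus ?thesis unfolding eps2 by (rule \<epsilon>_pos[OF s])
    qed
    show "ereal_expectation M (\<lambda>\<omega>. P (wtilde s \<omega>) - P wstar)
           \<le> ereal (\<xi>' ^ s) * ereal_expectation M (\<lambda>\<omega>. P (wtilde 0 \<omega>) - P wstar - ereal (\<epsilon>2 s))
               + ereal (\<epsilon>2 s)" by (rule conv(1))
    show "linear_to_ball (\<lambda>j. ereal_expectation M (\<lambda>\<omega>. P (wtilde j \<omega>) - P wstar)) \<xi>' (\<epsilon>2 s) s" by (rule conv(2))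
  qed
qed

end
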